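(* Let $f,g$ be two non-constant polynomials in one complex variable with $\deg(f)\ge\deg(g)$. Let $K$ be an infinite compact subset of $\mathbb{C}$ such that $f^{-1}(K)=g^{-1}(K)$. Then there is a polynomial $P$ such that $f=P\circ g$ and $P^{-1}(K)=K$, except if $(f,g,K)$ belongs to one of the following two classes, where $z$, $Q$, $d$, $d'$ and $a$ denote respectively a suitable coordinate, a suitable polynomial, two suitable natural numbers and a suitable complex number: (1) $K$ is a union of circles centred at $0$, and $f(z)=Q(z)^d$, $g(z)=aQ(z)^{d'}$; (2) $K$ is the segment $[-1,1]$, and $f=\pm T_d\circ Q$, $g=\pm T_{d'}\circ Q$, where $T_m$ denotes the Chebyshev polynomial.
   Context: The Chebyshev polynomial $T_m$ is defined by the relation $T_m(\cos z)=\cos(mz)$. "In a suitable coordinate" means: there is an affine automorphism $A$ of $\mathbb{C}$ (the target of $f$ and $g$, which contains $K$) such that the description holds for $(A\circ f,A\circ g,A(K))$. *)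

theory Defs
  imports "HOL-Analysis.Analysis" "HOL-Computational_Algebra.Computational_Algebra"
begin

definition chebyshev_T :: "nat \<Rightarrow> complex poly" where
  "chebyshev_T m = (THE p. \<forall>z. poly p (cos z) = cos (of_nat m * z))"

lemma chebyshev_exists:
  "\<exists>p::complex poly. \<forall>z. poly p (cos z) = cos (of_nat m * z)"
proof (induction m rule: less_induct)
  case (less m)
  show ?case
  proof (cases "m < 2")
    case True
    then consider "m = 0" | "m = 1" by linarith
    then show ?thesis
    proof cases
      case 1
      then show ?thesis by (intro exI[of _ 1]) simp
    next
      case 2
      then show ?thesis by (intro exI[of _ "[:0, 1:]"]) simp
    qed
  next
    case False
    define k where "k = m - 2"
    have m: "m = k + 2" using False by (simp add: k_def)
    obtain p q :: "complex poly"
      where p: "\<forall>z. poly p (cos z) = cos (of_nat (k + 1) * z)"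
        and q: "\<forall>z. poly q (cos z) = cos (of_nat k * z)"
      using less[of "k + 1"] less[of k] m by auto
    have "poly ([:0, 2:] * p - q) (cos z) = cos (of_nat m * z)" for z
    proof -
      define w where "w = of_nat (k + 1) * z"
      have mk: "of_nat m * z = w + z" "of_nat k * z = w - z"
        by (simp_all add: m w_def algebra_simps)
      have "poly p (cos z) = cos w"
        using p by (simp only: w_def)
      moreover have "poly q (cos z) = cos (w - z)"
        using q by (simp only: mk)
      ultimately show ?thesis
        by (simp add: mk cos_add cos_diff)
    qed
    then show ?thesis by blast
  qed
qed

lemma chebyshev_unique:
  fixes p q :: "complex poly"
  assumes "\<forall>z. poly p (cos z) = cos (of_nat m * z)"
    and "\<forall>z. poly q (cos z) = cos (of_nat m * z)"
  shows "p = q"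
proof -
  have "poly p w = poly q w" for w
    using assms cos_Arccos[of w] by metis
  then show ?thesis by (simp add: poly_eq_poly_eq_iff[symmetric] fun_eq_iff)
qed

lemma poly_chebyshev_T_cos: "poly (chebyshev_T m) (cos z) = cos (of_nat m * z)"
proof -
  have "\<exists>!p::complex poly. \<forall>z. poly p (cos z) = cos (of_nat m * z)"
    using chebyshev_exists[of m] chebyshev_unique[of _ m] by blast
  from theI'[OF this] show ?thesis
    unfolding chebyshev_T_def by blast
qed

text \<open>Radius \<open>0\<close> is admitted, so that the closed discs centred at \<open>0\<close>
  are unions of circles.  This is needed: \<open>z ^ 3\<close> and \<open>z ^ 2\<close> have the
  same preimage of the closed unit disc, and \<open>z ^ 3\<close> is not a polynomial in \<open>z ^ 2\<close>.\<close>

definition union_of_circles :: "complex set \<Rightarrow> bool" where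
  "union_of_circles K \<longleftrightarrow> (\<exists>R\<subseteq>{0..}. K = (\<Union>r\<in>R. sphere 0 r))"

definition circle_class :: "complex poly \<Rightarrow> complex poly \<Rightarrow> complex set \<Rightarrow> bool" where
  "circle_class f g K \<longleftrightarrow> union_of_circles K \<and>
     (\<exists>Q d d' a. f = Q ^ d \<and> g = smult a (Q ^ d'))"

text \<open>The two signs are independent of each other.\<close>

definition chebyshev_class :: "complex poly \<Rightarrow> complex poly \<Rightarrow> complex set \<Rightarrow> bool" where
  "chebyshev_class f g K \<longleftrightarrow> K = closed_segment (-1) 1 \<and>
     (\<exists>Q d d'. (f = pcompose (chebyshev_T d) Q \<or> f = - pcompose (chebyshev_T d) Q) \<and>
               (g = pcompose (chebyshev_T d') Q \<or> g = - pcompose (chebyshev_T d') Q))"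

end

theory Submission
  imports Defs "HOL-Computational_Algebra.Field_as_Ring"
begin

text \<open>
  Let \<open>T\<^sub>k\<close> be the monic polynomial of degree \<open>k\<close> of least maximum modulus on \<open>K\<close>.  Averaging over
  fibres shows that \<open>T\<^sub>k \<circ> f\<close> is extremal on \<open>f\<^sup>-\<^sup>1(K)\<close>; since extremal polynomials are unique,
  \<open>T\<^sub>a \<circ> f\<close> and \<open>T\<^sub>b \<circ> g\<close> are proportional whenever they have the same degree.  Hence \<open>f\<close> and \<open>g\<close> have a
  common right factor \<open>w\<close> leaving polynomials \<open>F\<close>, \<open>G\<close> of coprime degrees \<open>n \<ge> m\<close>; the case \<open>m = 1\<close> is
  the first alternative of the theorem.

  Otherwise \<open>T\<^sub>m\<^sub>k \<circ> F = T\<^sub>n\<^sub>k \<circ> G\<close> for all \<open>k\<close>, after rescaling.  By coprimality this implies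
  \<open>T\<^sub>m\<^sub>k = U\<^sub>k \<circ> T\<^sub>m\<close> and \<open>T\<^sub>n\<^sub>k = U\<^sub>k \<circ> T\<^sub>n\<close> for suitable \<open>U\<^sub>k\<close>, so \<open>(T\<^sub>n, T\<^sub>m, U)\<close> satisfies the same
  relations as \<open>(F, G, T)\<close> and the construction can be iterated.  High up in this tower there are
  squares \<open>A \<circ> p = B \<circ> q\<close> with \<open>deg p = deg B = n\<close> and \<open>deg A = deg q\<close> arbitrarily large; the
  Riemann-Hurwitz formula for \<open>A\<close> then leaves only \<open>B\<close> with one critical value, or with two critical
  values and ramification indices at most \<open>2\<close>.  Both properties descend the tower to \<open>F\<close> and \<open>G\<close>.
  Finally the relation \<open>F\<^sup>-\<^sup>1(K) = G\<^sup>-\<^sup>1(K)\<close>, lifted through \<open>exp\<close> or \<open>cos\<close>, shows that the lift of \<open>K\<close>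
  is invariant under all real translations.
\<close>

section \<open>Fibres and traces\<close>

text \<open>Coprime degrees matter because they make a square
  \<open>A \<circ> p = B \<circ> q\<close> a fibre product: for generic x, q maps the fibre of p
  over x bijectively to the fibre of B over A(x), and as traces are polynomials in x, this persists
  for every x, with multiplicities. The ramification of B is thereby imposed on A, except at the at
  most n - 1 critical values of p. In the bottom square A has degree m < n and these exceptions
  spoil the count; stacking squares keeps n fixed while the degree of A grows. Knowing F and G up to
  affine changes is still not enough: they must be powers or Chebyshev polynomials in the same
  coordinates of source and target. The source coordinate comes from distinguished points common to
  F and G (the centre, or the two points of odd index), the target coordinate from comparing
  neighbouring levels. For m = 2 the Chebyshev case needs yet another level, since the Chebyshev
  polynomial of degree 2, taken at a multiple of z, is always an affine function of itself.\<close>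

definition fib :: "complex poly \<Rightarrow> complex \<Rightarrow> complex multiset" where
  "fib p x = proots (p - [:x:])"

definition ramif :: "complex poly \<Rightarrow> complex \<Rightarrow> nat" where
  "ramif p z = order z (p - [:poly p z:])"

lemma sum_mset_eqI: "(\<And>z. z \<in># M \<Longrightarrow> f z = g z) \<Longrightarrow> (\<Sum>z\<in>#M. f z) = (\<Sum>z\<in>#M. g z)"
  by (metis image_mset_cong)

lemma degree_minus_const [simp]: "degree (p - [:x:]) = degree (p :: 'a::comm_ring poly)"
proof (cases "degree p = 0")
  case False
  have "degree (p + [:-x:]) = degree p" using False by (intro degree_add_eq_left) auto
  thus ?thesis by (simp add: diff_conv_add_uminus)
qed (auto elim!: degree_eq_zeroE)

lemma minus_const_nonzero: "degree (p :: 'a::comm_ring poly) > 0 \<Longrightarrow> p - [:x:] \<noteq> 0"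
  using degree_minus_const[of p x] by (metis degree_0 less_irrefl)

lemma size_fib [simp]: "size (fib p x) = degree p"
  by (simp add: fib_def size_proots_complex)

lemma set_fib: "degree p > 0 \<Longrightarrow> set_mset (fib p x) = {z. poly p z = x}"
  using minus_const_nonzero[of p x] by (auto simp: fib_def)

lemma count_fib:
  assumes "degree p > 0"
  shows "count (fib p x) z = (if poly p z = x then ramif p z else 0)"
  using minus_const_nonzero[OF assms, of x] by (auto simp: fib_def ramif_def order_0I)

lemma ramif_pos: "degree p > 0 \<Longrightarrow> ramif p z > 0"
  using minus_const_nonzero[of p "poly p z"] by (simp add: ramif_def order_gt_0_iff)

lemma finite_fibre: "degree (p :: complex poly) > 0 \<Longrightarrow> finite {z. poly p z = x}"
  using poly_roots_finite[OF minus_const_nonzero[of p x]] by simp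

lemma sum_ramif_fibre:
  assumes "degree p > 0"
  shows "(\<Sum>z | poly p z = x. ramif p z) = degree p"
proof -
  have "degree p = size (fib p x)" by simp
  also have "\<dots> = (\<Sum>z | poly p z = x. count (fib p x) z)"
    by (simp add: size_multiset_overloaded_eq set_fib[OF assms])
  also have "\<dots> = (\<Sum>z | poly p z = x. ramif p z)"
    by (intro sum.cong) (auto simp: count_fib[OF assms])
  finally show ?thesis ..
qed

section \<open>Newton's identities and traces along fibres\<close>

lemma coeff_synthetic_div:
  fixes p :: "'a::comm_ring_1 poly"
  shows "coeff (synthetic_div p c) a = (\<Sum>j\<le>degree p. coeff p (a + 1 + j) * c ^ j)"
proof (induction p arbitrary: a)
  case (pCons b p)
  show ?case
  proof (cases "p = 0")
    case False
    show ?thesis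
    proof (cases a)
      case 0
      have "(\<Sum>j\<le>degree (pCons b p). coeff (pCons b p) (a + 1 + j) * c ^ j) =
            (\<Sum>j\<le>Suc (degree p). coeff p j * c ^ j)"
        using False 0 by simp
      also have "\<dots> = poly p c" by (simp add: poly_altdef coeff_eq_0)
      finally show ?thesis using 0 by simp
    next
      case (Suc a')
      have "(\<Sum>j\<le>degree (pCons b p). coeff (pCons b p) (a + 1 + j) * c ^ j) =
            (\<Sum>j\<le>Suc (degree p). coeff p (a' + 1 + j) * c ^ j)"
        using False Suc by simp
      also have "\<dots> = (\<Sum>j\<le>degree p. coeff p (a' + 1 + j) * c ^ j)"
        by (simp add: coeff_eq_0)
      finally show ?thesis using Suc pCons.IH[of a'] by simp
    qed
  qed simp
qed simp

lemma synthetic_div_mult_root: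
  fixes p :: "'a::idom poly"
  assumes "poly p z = 0"
  shows "synthetic_div (q * p) z = q * synthetic_div p z"
proof -
  have p: "p = [:-z, 1:] * synthetic_div p z"
    using synthetic_div_correct'[of z p] assms by simp
  have "[:-z, 1:] * synthetic_div (q * p) z = q * p"
    using synthetic_div_correct'[of z "q * p"] assms by simp
  also have "\<dots> = [:-z, 1:] * (q * synthetic_div p z)"
    by (subst p) (simp only: ac_simps)
  finally show ?thesis
    by (metis mult_left_cancel pCons_eq_0_iff one_neq_zero)
qed

text \<open>The product rule: \<open>z\<close> is a root, so \<open>synthetic_div (P Z) z\<close> is
  the product with one factor of \<open>z\<close> left out.\<close>

lemma pderiv_prod_roots:
  fixes Z :: "complex multiset"
  defines "P \<equiv> \<lambda>Z. \<Prod>z\<in>#Z. [:-z, 1:]"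
  shows "pderiv (P Z) = (\<Sum>z\<in>#Z. synthetic_div (P Z) z)"
proof (induction Z)
  case (add w Z)
  have root: "poly (P Z) z = 0" if "z \<in># Z" for z
    using that by (auto simp: P_def poly_prod_mset prod_mset_zero_iff)
  have 1: "(\<Sum>z\<in>#Z. synthetic_div (P (add_mset w Z)) z) = [:-w, 1:] * pderiv (P Z)"
  proof -
    have "(\<Sum>z\<in>#Z. synthetic_div (P (add_mset w Z)) z) =
          (\<Sum>z\<in>#Z. [:-w, 1:] * synthetic_div (P Z) z)"
      by (intro sum_mset_eqI)
         (use root in \<open>auto simp: P_def synthetic_div_mult_root simp del: mult_pCons_left\<close>)
    also have "\<dots> = [:-w, 1:] * pderiv (P Z)"
      by (simp only: add.IH sum_mset_distrib_left)
    finally show ?thesis .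
  qed
  have 2: "synthetic_div (P (add_mset w Z)) w = P Z"
  proof -
    have "synthetic_div (P Z * [:-w, 1:]) w = P Z * synthetic_div [:-w, 1:] w"
      by (rule synthetic_div_mult_root) simp
    thus ?thesis by (simp add: P_def mult.commute del: mult_pCons_left mult_pCons_right)
  qed
  have "pderiv (P (add_mset w Z)) = P Z + [:-w, 1:] * pderiv (P Z)"
    by (simp add: P_def pderiv_mult pderiv_pCons del: mult_pCons_left mult_pCons_right)
  also have "\<dots> = (\<Sum>z\<in>#add_mset w Z. synthetic_div (P (add_mset w Z)) z)"
    by (simp only: image_mset_add_mset sum_mset.add_mset 1 2)
  finally show ?case .
qed (simp add: P_def)

text \<open>Comparing coefficients in \<open>p' = (\<Sum>z. (p - x) / (X - z))\<close>, summed over the fibre,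
  gives Newton's identities; the constant term of \<open>p - x\<close> does not occur in the first
  \<open>degree p\<close> of them.\<close>

lemma coeff_sum_mset: "coeff (\<Sum>z\<in>#M. f z) n = (\<Sum>z\<in>#M. coeff (f z) n)"
  by (induction M) simp_all

lemma power_sum_fib_const:
  assumes "degree p > 0" and "i < degree p"
  shows "(\<Sum>z\<in>#fib p x. z ^ i) = (\<Sum>z\<in>#fib p y. z ^ i)"
  using assms(2)
proof (induction i rule: less_induct)
  case (less i)
  define n where "n = degree p"
  \<comment> \<open>In degree \<open>n - 1 - i\<close> only power sums of order at most
    \<open>i\<close> occur, that of order \<open>i\<close> with the leading coefficient of
    \<open>p\<close>. So the identity determines it from the lower ones.\<close>
  define a where "a = n - 1 - i"
  define s where "s = (\<lambda>x j. \<Sum>z\<in>#fib p x. z ^ j)"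
  have n: "n > 0" "i < n" using assms less.prems by (auto simp: n_def)
  have newton: "of_nat (a + 1) * coeff p (a + 1) = (\<Sum>j\<le>i. coeff p (a + 1 + j) * s x j)" for x
  proof -
    define l where "l = lead_coeff p"
    define q where "q = p - [:x:]"
    have l: "lead_coeff q = l" "l \<noteq> 0"
      using assms(1) by (auto simp: q_def l_def coeff_pCons split: nat.splits)
    have dec: "smult l (\<Prod>z\<in>#fib p x. [:-z, 1:]) = q"
      using complex_poly_decompose_multiset[of q] l by (simp add: fib_def q_def)
    have "synthetic_div (smult l P) z = smult l (synthetic_div P z)" for P z
    proof -
      have "smult l P + smult z (smult l (synthetic_div P z)) = pCons (l * poly P z) (smult l (synthetic_div P z))"
        using arg_cong[OF synthetic_div_correct[of P z], of "smult l"]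
        by (simp add: smult_add_right mult.commute)
      thus ?thesis using synthetic_div_unique by metis
    qed
    hence sd: "synthetic_div q z = smult l (synthetic_div (\<Prod>z\<in>#fib p x. [:-z, 1:]) z)" for z
      unfolding dec[symmetric] by simp
    have "pderiv q = smult l (\<Sum>z\<in>#fib p x. synthetic_div (\<Prod>z\<in>#fib p x. [:-z, 1:]) z)"
      by (subst dec[symmetric]) (simp only: pderiv_smult pderiv_prod_roots)
    also have "\<dots> = (\<Sum>z\<in>#fib p x. synthetic_div q z)"
    proof -
      have "smult l (\<Sum>z\<in>#M. F z) = (\<Sum>z\<in>#M. smult l (F z))" for M and F :: "complex \<Rightarrow> complex poly"
        by (induction M) (simp_all add: smult_add_right)
      thus ?thesis unfolding sd .
    qed
    finally have "pderiv q = (\<Sum>z\<in>#fib p x. synthetic_div q z)" .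
    hence "coeff (pderiv q) a = (\<Sum>z\<in>#fib p x. coeff (synthetic_div q z) a)"
      by (simp only: coeff_sum_mset)
    also have "coeff (pderiv q) a = of_nat (a + 1) * coeff p (a + 1)"
      by (simp add: q_def coeff_pderiv)
    also have "(\<Sum>z\<in>#fib p x. coeff (synthetic_div q z) a) =
        (\<Sum>z\<in>#fib p x. (\<Sum>j\<le>i. coeff p (a + 1 + j) * z ^ j))"
    proof (rule sum_mset_eqI)
      fix z
      have "coeff (synthetic_div q z) a = (\<Sum>j\<le>n. coeff p (a + 1 + j) * z ^ j)"
        unfolding coeff_synthetic_div by (simp add: q_def n_def)
      also have "\<dots> = (\<Sum>j\<le>i. coeff p (a + 1 + j) * z ^ j)"
        by (rule sum.mono_neutral_right)
           (use n in \<open>auto simp: a_def n_def intro!: coeff_eq_0\<close>)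
      finally show "coeff (synthetic_div q z) a = (\<Sum>j\<le>i. coeff p (a + 1 + j) * z ^ j)" .
    qed
    also have "(\<Sum>z\<in>#fib p x. (\<Sum>j\<le>i. coeff p (a + 1 + j) * z ^ j)) =
       (\<Sum>j\<le>i. coeff p (a + 1 + j) * s x j)"
    proof -
      have "(\<Sum>z\<in>#M. (\<Sum>j\<le>i. c j * z ^ j)) = (\<Sum>j\<le>i. c j * (\<Sum>z\<in>#M. z ^ j))"
        for M :: "complex multiset" and c
        by (induction M) (simp_all add: sum.distrib algebra_simps)
      thus ?thesis by (simp add: s_def)
    qed
    finally show ?thesis .
  qed
  have "(\<Sum>j\<le>i. coeff p (a + 1 + j) * s x j) = (\<Sum>j\<le>i. coeff p (a + 1 + j) * s y j)"
    using newton[of x] newton[of y] by simp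
  moreover have "(\<Sum>j<i. coeff p (a + 1 + j) * s x j) = (\<Sum>j<i. coeff p (a + 1 + j) * s y j)"
    by (intro sum.cong) (use less in \<open>auto simp: s_def\<close>)
  ultimately have "coeff p (a + 1 + i) * s x i = coeff p (a + 1 + i) * s y i"
    by (simp add: lessThan_Suc_atMost[symmetric])
  moreover have "coeff p (a + 1 + i) \<noteq> 0"
  proof -
    have "a + 1 + i = degree p" using n by (simp add: a_def n_def)
    thus ?thesis using assms(1) by (metis degree_0 leading_coeff_0_iff less_irrefl)
  qed
  ultimately show ?case by (simp add: s_def)
qed

lemma sum_mset_poly:
  "(\<Sum>z\<in>#M. poly q z) = (\<Sum>i\<le>degree q. coeff q i * (\<Sum>z\<in>#M. z ^ i))"
  for q :: "complex poly"
  by (induction M) (simp_all add: poly_altdef sum.distrib algebra_simps)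

text \<open>On the fibre over \<open>x\<close> the polynomial \<open>p\<close> has the value
  \<open>x\<close>. Dividing \<open>q = p * q1 + q2\<close> therefore turns the sum into
  \<open>x\<close> times the trace of \<open>q1\<close> plus the trace of \<open>q2\<close>, and the
  latter is constant by \<open>power_sum_fib_const\<close>.\<close>

lemma trace_exists:
  fixes p q :: "complex poly"
  assumes "degree p > 0"
  shows "\<exists>r. (\<forall>x. (\<Sum>z\<in>#fib p x. poly q z) = poly r x) \<and> degree r * degree p \<le> degree q"
proof (induction "degree q" arbitrary: q rule: less_induct)
  case less
  show ?case
  proof (cases "degree q < degree p")
    case True
    have "(\<Sum>z\<in>#fib p x. poly q z) = poly [:\<Sum>z\<in>#fib p 0. poly q z:] x" for x
      using True power_sum_fib_const[OF assms, of _ x 0] by (simp add: sum_mset_poly)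
    thus ?thesis by (intro exI[of _ "[:\<Sum>z\<in>#fib p 0. poly q z:]"]) auto
  next
    case False
    define q1 where "q1 = q div p"
    define q2 where "q2 = q mod p"
    have p: "p \<noteq> 0" using assms by auto
    have q: "q = p * q1 + q2" by (simp add: q1_def q2_def)
    have d2: "degree q2 < degree p" using assms p degree_mod_less[of p q] by (auto simp: q2_def)
    have d1: "degree q = degree p + degree q1"
    proof (cases "q1 = 0")
      case True
      thus ?thesis using q d2 False by simp
    next
      case q1: False
      hence "degree (p * q1) = degree p + degree q1" using p by (simp add: degree_mult_eq)
      moreover have "degree (p * q1 + q2) = degree (p * q1)"
        using d2 calculation by (intro degree_add_eq_left) simp
      ultimately show ?thesis using q by simp
    qed
    obtain r1 where r1: "\<And>x. (\<Sum>z\<in>#fib p x. poly q1 z) = poly r1 x"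
        "degree r1 * degree p \<le> degree q1"
      using less[of q1] d1 assms False by auto
    obtain r2 where r2: "\<And>x. (\<Sum>z\<in>#fib p x. poly q2 z) = poly r2 x"
        "degree r2 * degree p \<le> degree q2"
      using less[of q2] d2 False by auto
    define r where "r = [:0, 1:] * r1 + r2"
    have "degree r2 = 0"
    proof (rule ccontr)
      assume "degree r2 \<noteq> 0"
      hence "1 * degree p \<le> degree r2 * degree p" by (intro mult_le_mono1) simp
      thus False using r2(2) d2 by linarith
    qed
    hence "degree r \<le> Suc (degree r1)"
      unfolding r_def by (intro degree_add_le) (auto simp: degree_pCons_le)
    hence "degree r * degree p \<le> Suc (degree r1) * degree p" by (rule mult_le_mono1)
    also have "\<dots> \<le> degree q" using r1(2) d1 False by simp
    finally have dr: "degree r * degree p \<le> degree q" .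
    have "(\<Sum>z\<in>#fib p x. poly q z) = poly r x" for x
    proof -
      have "(\<Sum>z\<in>#fib p x. poly q z) = (\<Sum>z\<in>#fib p x. x * poly q1 z + poly q2 z)"
        by (intro sum_mset_eqI) (subst q, use assms in \<open>auto simp: set_fib\<close>)
      also have "\<dots> = x * (\<Sum>z\<in>#fib p x. poly q1 z) + (\<Sum>z\<in>#fib p x. poly q2 z)"
        by (simp add: sum_mset.distrib sum_mset_distrib_left)
      finally show ?thesis by (simp add: r1 r2 r_def)
    qed
    thus ?thesis using dr by blast
  qed
qed

text \<open>A polynomial vanishing at every other point of the two supports isolates the
  multiplicity of \<open>v\<close>.\<close>

lemma mset_eq_if_sums_eq:
  fixes M N :: "complex multiset"
  assumes "\<And>h :: complex poly. (\<Sum>z\<in>#M. poly h z) = (\<Sum>z\<in>#N. poly h z)"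
  shows "M = N"
proof (rule multiset_eqI)
  fix v
  define S where "S = (set_mset M \<union> set_mset N) - {v}"
  define h where "h = (\<Prod>u\<in>S. [:-u, 1:])"
  have fin: "finite S" by (simp add: S_def)
  have h0: "poly h u = 0" if "u \<in> set_mset M \<union> set_mset N" "u \<noteq> v" for u
    using that fin by (auto simp: h_def poly_prod S_def)
  have hv: "poly h v \<noteq> 0" using fin by (auto simp: h_def poly_prod S_def)
  have "(\<Sum>z\<in>#L. poly h z) = of_nat (count L v) * poly h v"
    if "set_mset L \<subseteq> set_mset M \<union> set_mset N" for L
    using that by (induction L) (auto simp: h0 algebra_simps)
  from this[of M] this[of N] assms[of h] hv show "count M v = count N v" by simp
qed

text \<open>\<open>h\<close> is the average of \<open>f\<close> over the fibres of \<open>w\<close>.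
  Where \<open>f\<close> is constant along the fibre, the average returns \<open>f\<close>, and this
  happens at infinitely many points.\<close>

lemma poly_factors_through:
  fixes f w :: "complex poly"
  assumes "degree w > 0"
    and "finite {z0. \<exists>z. poly w z = poly w z0 \<and> poly f z \<noteq> poly f z0}"
  shows "\<exists>h. f = pcompose h w"
proof -
  obtain r where r: "\<And>x. (\<Sum>z\<in>#fib w x. poly f z) = poly r x"
    using trace_exists[OF assms(1), of f] by blast
  define B where "B = {z0. \<exists>z. poly w z = poly w z0 \<and> poly f z \<noteq> poly f z0}"
  define h where "h = smult (1 / of_nat (degree w)) r"
  have "poly (f - pcompose h w) z0 = 0"
    if z0: "z0 \<notin> B" for z0
  proof -
    have that: "poly f z = poly f z0" if "poly w z = poly w z0" for z
      using that z0 unfolding B_def by blast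
    have "poly r (poly w z0) = (\<Sum>z\<in>#fib w (poly w z0). poly f z0)"
      unfolding r[symmetric]
    proof (rule sum_mset_eqI)
      fix z assume "z \<in># fib w (poly w z0)"
      hence "poly w z = poly w z0" using set_fib[OF assms(1)] by blast
      thus "poly f z = poly f z0" by (rule that)
    qed
    also have "\<dots> = of_nat (degree w) * poly f z0"
      by (simp only: sum_mset_constant size_fib)
    finally have "poly (pcompose h w) z0 = poly f z0"
      unfolding h_def poly_pcompose poly_smult using assms(1) by (simp only: of_nat_eq_0_iff) simp
    thus ?thesis by (metis diff_self poly_diff)
  qed
  hence "- B \<subseteq> {z0. poly (f - pcompose h w) z0 = 0}" by (intro subsetI) simp
  moreover have "infinite (- B)"
    using assms(2) infinite_UNIV_char_0[where 'a = complex] by (simp add: B_def finite_compl)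
  ultimately have "infinite {z0. poly (f - pcompose h w) z0 = 0}"
    using finite_subset by blast
  hence "f - pcompose h w = 0" using poly_roots_finite by blast
  thus ?thesis by auto
qed

section \<open>Ramification\<close>

lemma ramif_pcompose:
  assumes "degree A > 0" "degree p > 0"
  shows "ramif (pcompose A p) z = ramif A (poly p z) * ramif p z"
proof -
  define w where "w = poly p z"
  define P where "P = A - [:poly A w:]"
  have P: "P \<noteq> 0" unfolding P_def by (rule minus_const_nonzero[OF assms(1)])
  obtain R where R: "P = [:-w, 1:] ^ order w P * R" "\<not> [:-w, 1:] dvd R"
    using order_decomp[OF P] by blast
  have "poly R w \<noteq> 0" using R(2) by (simp add: poly_eq_0_iff_dvd)
  hence Rz: "poly (pcompose R p) z \<noteq> 0" by (simp add: poly_pcompose w_def)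
  have p: "p - [:w:] \<noteq> 0" by (rule minus_const_nonzero[OF assms(2)])
  have lin: "pcompose [:-w, 1:] p = p - [:w:]"
    by (simp add: pcompose_pCons)
  have pow: "pcompose (q ^ k) p = pcompose q p ^ k" for q k
    by (induction k) (simp_all add: pcompose_mult pcompose_1)
  have "pcompose A p - [:poly (pcompose A p) z:] = pcompose P p"
    by (simp add: P_def pcompose_diff poly_pcompose w_def)
  also have "\<dots> = (p - [:w:]) ^ order w P * pcompose R p"
    by (subst R(1)) (simp only: pcompose_mult pow lin)
  finally have "ramif (pcompose A p) z = order z ((p - [:w:]) ^ order w P * pcompose R p)"
    by (simp add: ramif_def)
  also have "\<dots> = order w P * order z (p - [:w:])"
  proof -
    have "order z (q ^ k) = k * order z q" if "q \<noteq> 0" for q :: "complex poly" and k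
      using that by (induction k) (simp_all add: order_mult)
    moreover have "pcompose R p \<noteq> 0" using Rz by auto
    ultimately show ?thesis using p Rz by (subst order_mult) (auto simp: order_0I)
  qed
  finally show ?thesis by (simp add: ramif_def P_def w_def)
qed

lemma pderiv_nonzero: "degree (p :: complex poly) > 0 \<Longrightarrow> pderiv p \<noteq> 0"
  by (simp add: pderiv_eq_0_iff)

lemma ramif_eq_Suc_order_pderiv:
  assumes "degree p > 0"
  shows "ramif p z = Suc (order z (pderiv p))"
proof -
  have d: "pderiv (p - [:poly p z:]) = pderiv p" by (simp add: pderiv_diff pderiv_pCons)
  have "order z (p - [:poly p z:]) = Suc (order z (pderiv (p - [:poly p z:])))"
    by (rule order_pderiv)
       (use assms ramif_pos[OF assms, of z] pderiv_nonzero[OF assms] d in \<open>auto simp: ramif_def\<close>)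
  thus ?thesis by (simp add: ramif_def d)
qed

lemma ramif_eq_1_iff:
  assumes "degree p > 0"
  shows "ramif p z = 1 \<longleftrightarrow> poly (pderiv p) z \<noteq> 0"
  using ramif_eq_Suc_order_pderiv[OF assms, of z] pderiv_nonzero[OF assms]
  by (simp add: order_eq_0_iff)

lemma finite_vimage_poly: "degree p > 0 \<Longrightarrow> finite X \<Longrightarrow> finite {z. poly p z \<in> X}"
  for p :: "complex poly"
proof -
  assume *: "degree p > 0" "finite X"
  have "{z. poly p z \<in> X} = (\<Union>x\<in>X. {z. poly p z = x})" by auto
  thus ?thesis using * by (simp add: finite_fibre)
qed

lemma sum_vimage:
  fixes h :: "complex \<Rightarrow> 'a::comm_monoid_add"
  assumes "degree p > 0" "finite X"
  shows "(\<Sum>z | poly p z \<in> X. h z) = (\<Sum>x\<in>X. \<Sum>z | poly p z = x. h z)"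
proof -
  have "{z. poly p z \<in> X} = (\<Union>x\<in>X. {z. poly p z = x})" by auto
  moreover have "(\<Sum>z\<in>(\<Union>x\<in>X. {z. poly p z = x}). h z) = (\<Sum>x\<in>X. \<Sum>z | poly p z = x. h z)"
    by (rule sum.UNION_disjoint) (use assms finite_fibre in auto)
  ultimately show ?thesis by simp
qed

lemma sum_ramif_vimage:
  assumes "degree p > 0" "finite X"
  shows "(\<Sum>z | poly p z \<in> X. ramif p z) = card X * degree p"
  by (simp add: sum_vimage[OF assms] sum_ramif_fibre[OF assms(1)])

lemma sum_order_eq: 
  assumes "p \<noteq> 0" shows "(\<Sum>z | poly p z = 0. order z p) = degree (p :: complex poly)"
proof -
  have "degree p = size (proots p)" by (simp add: size_proots_complex)
  also have "\<dots> = (\<Sum>z | poly p z = 0. order z p)"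
    using assms by (simp add: size_multiset_overloaded_eq)
  finally show ?thesis ..
qed

text \<open>Riemann-Hurwitz for a polynomial: the index exceeds 1 by the order of
  \<open>pderiv p\<close>, and over the whole plane these orders add up to
  \<open>degree p - 1\<close>.\<close>

lemma card_vimage_lower:
  fixes p :: "complex poly"
  assumes "degree p > 0" "finite X"
  shows "card X * degree p \<le> card {z. poly p z \<in> X} + (degree p - 1)"
    and "(\<And>z. poly (pderiv p) z = 0 \<Longrightarrow> poly p z \<in> X) \<Longrightarrow>
           card X * degree p = card {z. poly p z \<in> X} + (degree p - 1)"
proof -
  let ?S = "{z. poly p z \<in> X}" and ?R = "{z. poly (pderiv p) z = 0}"
  have fin: "finite ?S" by (rule finite_vimage_poly[OF assms])
  have finR: "finite ?R" using poly_roots_finite[OF pderiv_nonzero[OF assms(1)]] .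
  have "card X * degree p = (\<Sum>z\<in>?S. ramif p z)"
    by (rule sum_ramif_vimage[OF assms, symmetric])
  also have "\<dots> = card ?S + (\<Sum>z\<in>?S. order z (pderiv p))"
    by (simp add: ramif_eq_Suc_order_pderiv[OF assms(1)] sum_Suc)
  also have "(\<Sum>z\<in>?S. order z (pderiv p)) = (\<Sum>z\<in>?S \<inter> ?R. order z (pderiv p))"
    by (rule sum.mono_neutral_right[OF fin]) (blast, intro ballI order_0I, blast)
  finally have eq: "card X * degree p = card ?S + (\<Sum>z\<in>?S \<inter> ?R. order z (pderiv p))" .
  have R: "(\<Sum>z\<in>?R. order z (pderiv p)) = degree p - 1"
    using sum_order_eq[OF pderiv_nonzero[OF assms(1)]] by (simp add: degree_pderiv)
  have "(\<Sum>z\<in>?S \<inter> ?R. order z (pderiv p)) \<le> (\<Sum>z\<in>?R. order z (pderiv p))"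
    by (rule sum_mono2[OF finR]) auto
  thus "card X * degree p \<le> card ?S + (degree p - 1)" using eq R by simp
  assume "\<And>z. poly (pderiv p) z = 0 \<Longrightarrow> poly p z \<in> X"
  hence "?S \<inter> ?R = ?R" by auto
  thus "card X * degree p = card ?S + (degree p - 1)" using eq R by simp
qed

section \<open>Points of odd ramification index\<close>

definition odd_fib :: "complex poly \<Rightarrow> complex set \<Rightarrow> complex set" where
  "odd_fib p X = {z. poly p z \<in> X \<and> odd (ramif p z)}"

lemma odd_fib_subset: "odd_fib p X \<subseteq> {z. poly p z \<in> X}"
  by (auto simp: odd_fib_def)

lemma finite_odd_fib: "degree p > 0 \<Longrightarrow> finite X \<Longrightarrow> finite (odd_fib p X)"
  by (rule finite_subset[OF odd_fib_subset finite_vimage_poly])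

text \<open>Indices multiply along a composition, and a product is odd iff both factors are. For a
  Chebyshev polynomial of positive degree the odd points over -1 and 1 are again -1 and 1.\<close>

lemma odd_fib_pcompose:
  assumes "degree A > 0" "degree p > 0"
  shows "odd_fib (pcompose A p) X = odd_fib p (odd_fib A X)"
  by (auto simp: odd_fib_def poly_pcompose ramif_pcompose[OF assms])

lemma card_odd_fib_lower_aux:
  assumes "degree p > 0" "finite X"
  shows "2 * card {z. poly p z \<in> X} \<le> card X * degree p + card (odd_fib p X)"
proof -
  let ?S = "{z. poly p z \<in> X}"
  have fin: "finite ?S" by (rule finite_vimage_poly[OF assms])
  have "2 * card ?S = (\<Sum>z\<in>?S. 2)" by simp
  also have "\<dots> \<le> (\<Sum>z\<in>?S. ramif p z + (if odd (ramif p z) then 1 else 0))"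
  proof (rule sum_mono)
    fix z
    have "ramif p z > 0" by (rule ramif_pos[OF assms(1)])
    thus "2 \<le> ramif p z + (if odd (ramif p z) then 1 else 0)" by presburger
  qed
  also have "\<dots> = (\<Sum>z\<in>?S. ramif p z) + card (odd_fib p X)"
    by (simp add: sum.distrib sum.If_cases[OF fin] odd_fib_def Collect_conj_eq Int_commute)
  finally show ?thesis by (simp add: sum_ramif_vimage[OF assms])
qed

text \<open>Every index \<open>e \<ge> 1\<close> satisfies \<open>2 \<le> e + e mod 2\<close>, which
  bounds the number of points over \<open>X\<close> from above; Riemann-Hurwitz bounds it from
  below. Over two values there are thus at least two odd points.\<close>

lemma card_odd_fib_lower:
  assumes "degree p > 0" "finite X"
  shows "card X * degree p \<le> card (odd_fib p X) + 2 * (degree p - 1)"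
  using card_odd_fib_lower_aux[OF assms] card_vimage_lower(1)[OF assms] by linarith

lemma card_odd_fib_parity:
  assumes "degree p > 0" "finite X"
  shows "even (card (odd_fib p X)) \<longleftrightarrow> even (card X * degree p)"
proof -
  let ?S = "{z. poly p z \<in> X}"
  have fin: "finite ?S" by (rule finite_vimage_poly[OF assms])
  have "even (\<Sum>z\<in>?S. ramif p z) \<longleftrightarrow> even (card {z\<in>?S. odd (ramif p z)})"
    by (rule even_sum_iff[OF fin])
  thus ?thesis by (simp add: sum_ramif_vimage[OF assms] odd_fib_def)
qed

text \<open>The equality case of \<open>card_odd_fib_lower\<close>: odd indices must be 1, even ones
  2, and no ramification is left outside the two fibres.\<close>

lemma card_odd_fib_2:
  assumes "degree p > 0" "x1 \<noteq> x2" "card (odd_fib p {x1, x2}) = 2"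
  shows "poly p z \<in> {x1, x2} \<Longrightarrow> ramif p z = (if z \<in> odd_fib p {x1, x2} then 1 else 2)"
    and "poly (pderiv p) z = 0 \<Longrightarrow> poly p z \<in> {x1, x2}"
proof -
  let ?X = "{x1, x2}" let ?S = "{z. poly p z \<in> ?X}" and ?R = "{z. poly (pderiv p) z = 0}"
  let ?m = "\<lambda>z. if z \<in> odd_fib p ?X then 1 else 2 :: nat"
  have X: "card ?X = 2" "finite ?X" using assms(2) by auto
  have fin: "finite ?S" by (rule finite_vimage_poly[OF assms(1) X(2)])
  have finR: "finite ?R" using poly_roots_finite[OF pderiv_nonzero[OF assms(1)]] .
  have sum1: "(\<Sum>z\<in>?S. ramif p z) = 2 * degree p"
    using sum_ramif_vimage[OF assms(1) X(2)] X by simp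
  have m_le: "?m z \<le> ramif p z" if "z \<in> ?S" for z
    using that ramif_pos[OF assms(1), of z] by (cases "ramif p z = 1") (auto simp: odd_fib_def)
  have "(\<Sum>z\<in>?S. ?m z) + card (odd_fib p ?X) = 2 * card ?S"
  proof -
    have "(\<Sum>z\<in>?S. ?m z) + card (odd_fib p ?X) = (\<Sum>z\<in>?S. ?m z + (if z \<in> odd_fib p ?X then 1 else 0))"
      unfolding sum.distrib sum.If_cases[OF fin] Collect_mem_eq Int_absorb1[OF odd_fib_subset]
      by simp
    also have "\<dots> = (\<Sum>z\<in>?S. 2)" by (intro sum.cong) auto
    finally show ?thesis by simp
  qed
  moreover have low: "2 * degree p \<le> card ?S + (degree p - 1)"
    using card_vimage_lower(1)[OF assms(1) X(2)] X by simp
  moreover have "(\<Sum>z\<in>?S. ?m z) \<le> (\<Sum>z\<in>?S. ramif p z)" by (rule sum_mono) (rule m_le)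
  ultimately have eq: "(\<Sum>z\<in>?S. ?m z) = (\<Sum>z\<in>?S. ramif p z)" and card: "card ?S = degree p + 1"
    using assms(1,3) sum1 by linarith+
  show "ramif p z = ?m z" if "poly p z \<in> ?X"
  proof (rule ccontr)
    assume "ramif p z \<noteq> ?m z"
    hence "?m z < ramif p z" using m_le[of z] that by simp
    hence "(\<Sum>z\<in>?S. ?m z) < (\<Sum>z\<in>?S. ramif p z)"
      by (intro sum_strict_mono_ex1[OF fin]) (use m_le that in blast)+
    thus False using eq by simp
  qed
  show "poly p z \<in> ?X" if "poly (pderiv p) z = 0"
  proof (rule ccontr)
    assume z: "poly p z \<notin> ?X"
    have "(\<Sum>z\<in>?S. ramif p z) = card ?S + (\<Sum>z\<in>?S. order z (pderiv p))"
      by (simp add: ramif_eq_Suc_order_pderiv[OF assms(1)] sum_Suc)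
    moreover have "(\<Sum>z\<in>?S. order z (pderiv p)) = (\<Sum>z\<in>?S \<inter> ?R. order z (pderiv p))"
      by (rule sum.mono_neutral_right[OF fin]) (blast, intro ballI order_0I, blast)
    moreover have "(\<Sum>z\<in>?S \<inter> ?R. order z (pderiv p)) < (\<Sum>z\<in>?R. order z (pderiv p))"
    proof (rule sum_strict_mono2[OF finR])
      show "?S \<inter> ?R \<subseteq> ?R" by auto
      show "z \<in> ?R - (?S \<inter> ?R)" using z that by auto
      show "0 < order z (pderiv p)" using that pderiv_nonzero[OF assms(1)] by (simp add: order_gt_0_iff)
    qed simp
    moreover have "(\<Sum>z\<in>?R. order z (pderiv p)) = degree p - 1"
      using sum_order_eq[OF pderiv_nonzero[OF assms(1)]] by (simp add: degree_pderiv)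
    ultimately show False using sum1 card by linarith
  qed
qed

lemma poly_eqI_infinite:
  fixes p q :: "complex poly"
  assumes "finite B" "\<And>x. x \<notin> B \<Longrightarrow> poly p x = poly q x"
  shows "p = q"
proof -
  have "- B \<subseteq> {x. poly (p - q) x = 0}" using assms(2) by auto
  moreover have "infinite (- B)"
    using assms(1) infinite_UNIV_char_0[where 'a = complex] by (simp add: finite_compl)
  ultimately have "infinite {x. poly (p - q) x = 0}" using finite_subset by blast
  hence "p - q = 0" using poly_roots_finite by blast
  thus ?thesis by simp
qed

lemma poly_eq_of_eq_on_vimage:
  fixes p q w :: "complex poly"
  assumes "degree w > 0" "pcompose p w = pcompose q w"
  shows "p = q"
proof -
  have "pcompose (p - q) w = 0" using assms(2) by (simp add: pcompose_diff)
  thus ?thesis using assms(1) pcompose_eq_0[of "p - q" w] by auto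
qed

text \<open>Over a generic \<open>x\<close> the map \<open>q\<close> is injective on the fibre of
  \<open>p\<close> and lands in the fibre of \<open>B\<close> over \<open>poly A x\<close>, which
  has just as many elements. Sums of a test polynomial over either side are polynomials in
  \<open>x\<close>, so the equality passes to the remaining \<open>x\<close>, with
  multiplicities.\<close>

lemma image_fib_eq_fib:
  assumes comp: "pcompose A p = pcompose B q"
    and deg: "degree p > 0" "degree B = degree p"
    and inj: "finite {z0. \<exists>z. poly p z = poly p z0 \<and> poly q z = poly q z0 \<and> z \<noteq> z0}"
  shows "image_mset (poly q) (fib p x) = fib B (poly A x)"
proof (rule mset_eq_if_sums_eq)
  fix h :: "complex poly"
  define E where "E = {z0. \<exists>z. poly p z = poly p z0 \<and> poly q z = poly q z0 \<and> z \<noteq> z0}"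
  define Bad where "Bad = poly p ` (E \<union> {z. poly (pderiv p) z = 0})"
  have finB: "finite Bad"
    using inj poly_roots_finite[OF pderiv_nonzero[OF deg(1)]] by (simp add: Bad_def E_def)
  obtain r1 where r1: "\<And>x. (\<Sum>z\<in>#fib p x. poly (pcompose h q) z) = poly r1 x"
    using trace_exists[OF deg(1)] by blast
  obtain r2 where r2: "\<And>x. (\<Sum>z\<in>#fib B x. poly h z) = poly r2 x"
    using trace_exists[of B] deg by metis
  have degB: "degree B > 0" using deg by simp
  have "r1 = pcompose r2 A"
  proof (rule poly_eqI_infinite[OF finB])
    fix x assume x: "x \<notin> Bad"
    let ?F = "{z. poly p z = x}"
    have finF: "finite ?F" by (rule finite_fibre[OF deg(1)])
    have mul1: "ramif p z = 1" if "poly p z = x" for z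
      using that x unfolding ramif_eq_1_iff[OF deg(1)] Bad_def by blast
    have "fib p x = mset_set ?F"
      by (rule multiset_eqI) (use finF mul1 in \<open>auto simp: count_fib[OF deg(1)] count_mset_set'\<close>)
    moreover have injq: "inj_on (poly q) ?F"
    proof (rule inj_onI)
      fix z z' assume "z \<in> ?F" "z' \<in> ?F" "poly q z = poly q z'"
      show "z = z'"
      proof (rule ccontr)
        assume "z \<noteq> z'"
        hence "z \<in> E" unfolding E_def
          using \<open>z \<in> ?F\<close> \<open>z' \<in> ?F\<close> \<open>poly q z = poly q z'\<close> by (intro CollectI exI[of _ z']) simp
        hence "x \<in> Bad" using \<open>z \<in> ?F\<close> unfolding Bad_def by blast
        thus False using x by simp
      qed
    qed
    ultimately have im: "image_mset (poly q) (fib p x) = mset_set (poly q ` ?F)"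
      by (simp add: image_mset_mset_set)
    have sub: "poly q ` ?F \<subseteq> set_mset (fib B (poly A x))"
    proof
      fix y assume "y \<in> poly q ` ?F"
      then obtain z where "poly p z = x" "y = poly q z" by auto
      moreover have "poly A (poly p z) = poly B (poly q z)"
        using arg_cong[OF comp, of "\<lambda>p. poly p z"] by (simp add: poly_pcompose)
      ultimately show "y \<in> set_mset (fib B (poly A x))" by (simp add: set_fib[OF degB])
    qed
    have "mset_set (poly q ` ?F) \<subseteq># mset_set (set_mset (fib B (poly A x)))"
      by (rule subset_imp_msubset_mset_set[OF sub]) simp
    also have "\<dots> \<subseteq># fib B (poly A x)" by (rule mset_set_set_mset_msubset)
    finally have sub2: "image_mset (poly q) (fib p x) \<subseteq># fib B (poly A x)" using im by simp
    have "image_mset (poly q) (fib p x) = fib B (poly A x)"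
      using sub2 deg mset_subset_size[of "image_mset (poly q) (fib p x)" "fib B (poly A x)"]
      by (metis size_fib size_image_mset less_irrefl subset_mset.le_neq_trans)
    hence "(\<Sum>z\<in>#fib p x. poly h (poly q z)) = (\<Sum>z\<in>#fib B (poly A x). poly h z)"
      by (simp add: multiset.map_comp comp_def flip: \<open>image_mset (poly q) (fib p x) = fib B (poly A x)\<close>)
    thus "poly r1 x = poly (pcompose r2 A) x"
      using r1[of x] r2[of "poly A x"] by (simp add: poly_pcompose)
  qed
  hence "poly r1 x = poly r2 (poly A x)" by (simp add: poly_pcompose)
  thus "(\<Sum>z\<in>#image_mset (poly q) (fib p x). poly h z) = (\<Sum>z\<in>#fib B (poly A x). poly h z)"
    using r1[of x] r2[of "poly A x"] by (simp add: poly_pcompose image_mset.compositionality comp_def)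
qed

section \<open>Extremal polynomials\<close>

text \<open>Up to a factor, these are the Chebyshev polynomials of the set \<open>E\<close>. The
  second clause for \<open>q = p\<close> says that \<open>M\<close> is attained.\<close>

definition extremal :: "complex set \<Rightarrow> complex poly \<Rightarrow> real \<Rightarrow> bool" where
  "extremal E p M \<longleftrightarrow> (\<forall>z\<in>E. norm (poly p z) \<le> M) \<and>
     (\<forall>q. degree q = degree p \<and> lead_coeff q = lead_coeff p \<longrightarrow> (\<exists>z\<in>E. M \<le> norm (poly q z)))"

lemma bounded_coords_convergent_subseq:
  fixes b :: "nat \<Rightarrow> nat \<Rightarrow> complex"
  assumes "\<And>j i. norm (b j i) \<le> R"
  shows "\<exists>r c. strict_mono r \<and> (\<forall>i<k. (\<lambda>j. b (r j) i) \<longlonglongrightarrow> c i)"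
proof (induction k)
  case 0
  show ?case by (intro exI[of _ id]) (auto simp: strict_mono_def)
next
  case (Suc k)
  then obtain r c where r: "strict_mono (r :: nat \<Rightarrow> nat)" "\<And>i. i < k \<Longrightarrow> (\<lambda>j. b (r j) i) \<longlonglongrightarrow> c i"
    by blast
  have "\<forall>j. b (r j) k \<in> cball 0 R" using assms by simp
  moreover have "seq_compact (cball (0::complex) R)"
    by (rule compact_imp_seq_compact) simp
  ultimately obtain l s where s: "strict_mono (s :: nat \<Rightarrow> nat)" "((\<lambda>j. b (r j) k) \<circ> s) \<longlonglongrightarrow> l"
    unfolding seq_compact_def by metis
  have "(\<lambda>j. b ((r \<circ> s) j) i) \<longlonglongrightarrow> (c(k := l)) i" if "i < Suc k" for i
  proof (cases "i = k")
    case True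
    thus ?thesis using s(2) by (simp add: comp_def)
  next
    case False
    hence "(\<lambda>j. b (r j) i) \<longlonglongrightarrow> c i" using that r(2) by simp
    from LIMSEQ_subseq_LIMSEQ[OF this s(1)] show ?thesis using False by (simp add: comp_def)
  qed
  moreover have "strict_mono (r \<circ> s)" using r(1) s(1) by (rule strict_mono_o)
  ultimately show ?case by blast
qed

text \<open>The minimum is taken over tuples of roots rather than coefficients. Moving a root to the
  closest point of a disc containing \<open>K\<close> does not increase its distance to any point of
  \<open>K\<close>, so the roots may be confined to that disc and a convergent subsequence
  exists.\<close>

lemma extremal_exists:
  assumes "compact K" "K \<noteq> {}"
  shows "\<exists>p M. degree p = k \<and> lead_coeff p = 1 \<and> extremal K p M"
proof -
  define B where "B = (\<lambda>a m. \<forall>z\<in>K. norm (\<Prod>i<k. z - a i :: complex) \<le> m)"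
  define V where "V = {m. 0 \<le> m \<and> (\<exists>a. B a m)}"
  define M where "M = Inf V"
  obtain R where R: "K \<subseteq> cball 0 R" "R \<ge> 0"
  proof -
    obtain R where "\<forall>z\<in>K. norm z \<le> R" using compact_imp_bounded[OF assms(1)] by (auto simp: bounded_iff)
    thus ?thesis using that[of "max R 0"] by force
  qed
  have max: "\<exists>m\<ge>0. \<exists>z\<in>K. norm (poly q z) = m \<and> (\<forall>z\<in>K. norm (poly q z) \<le> m)" for q
  proof -
    have "continuous_on K (\<lambda>z. norm (poly q z))" by (intro continuous_intros)
    from continuous_attains_sup[OF assms this] obtain x
      where "x \<in> K" "\<forall>y\<in>K. norm (poly q y) \<le> norm (poly q x)" by blast
    thus ?thesis by (intro exI[of _ "norm (poly q x)"]) auto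
  qed
  have pr: "poly (\<Prod>i<k. [:-a i, 1:]) z = (\<Prod>i<k. z - a i)" for a and z :: complex
    by (simp add: poly_prod)
  have "V \<noteq> {}"
  proof -
    obtain m where "m \<ge> 0" "\<forall>z\<in>K. norm (poly (\<Prod>i<k. [:-0, 1:]) z) \<le> m" using max by blast
    hence "m \<in> V" unfolding V_def B_def pr[of "\<lambda>_. 0"] by (intro CollectI conjI exI[of _ "\<lambda>_. 0"])
    thus ?thesis by blast
  qed
  have bdd: "bdd_below V" by (rule bdd_belowI[of _ 0]) (simp add: V_def)
  have "\<exists>b. (\<forall>i. norm (b i) \<le> R) \<and> B b (M + inverse (real (Suc j)))" for j
  proof -
    have "Inf V < M + inverse (real (Suc j))" by (simp add: M_def)
    then obtain m where "m \<in> V" "m < M + inverse (real (Suc j))"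
      using cInf_lessD[OF \<open>V \<noteq> {}\<close>] by blast
    then obtain a where a: "B a m" "m < M + inverse (real (Suc j))"
      unfolding V_def by blast
    define b where "b = (\<lambda>i. closest_point (cball 0 R) (a i))"
    have "norm (b i) \<le> R" for i
      using closest_point_in_set[of "cball (0::complex) R" "a i"] R(2) by (auto simp: b_def)
    moreover have "B b m" unfolding B_def
    proof
      fix z assume z: "z \<in> K"
      have "norm (z - b i) \<le> norm (z - a i)" for i
      proof -
        have "closest_point (cball 0 R) z = z" using z R by (intro closest_point_self) auto
        thus ?thesis using closest_point_lipschitz[of "cball 0 R" z "a i"] R(2)
          by (simp add: b_def dist_norm)
      qed
      hence "norm (\<Prod>i<k. z - b i) \<le> norm (\<Prod>i<k. z - a i)"
        by (simp add: prod_norm[symmetric] prod_mono)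
      also have "\<dots> \<le> m" using a(1) z by (auto simp: B_def)
      finally show "norm (\<Prod>i<k. z - b i) \<le> m" .
    qed
    ultimately show ?thesis using a(2) unfolding B_def by (intro exI[of _ b]) force
  qed
  then obtain b where b: "\<And>j i. norm (b j i) \<le> R" "\<And>j. B (b j) (M + inverse (real (Suc j)))"
    by metis
  obtain r c where r: "strict_mono r" "\<And>i. i < k \<Longrightarrow> (\<lambda>j. b (r j) i) \<longlonglongrightarrow> c i"
    using bounded_coords_convergent_subseq[of b R k] b(1) by blast
  define p where "p = (\<Prod>i<k. [:-c i, 1:])"
  have degp: "degree p = k" by (simp add: p_def degree_prod_sum_eq)
  have lead: "lead_coeff p = 1" by (simp add: p_def lead_coeff_prod)
  have "norm (poly p z) \<le> M" if z: "z \<in> K" for z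
  proof (rule LIMSEQ_le)
    show "(\<lambda>j. norm (\<Prod>i<k. z - b (r j) i)) \<longlonglongrightarrow> norm (poly p z)"
      unfolding p_def pr by (intro tendsto_intros r(2)) simp
    have "(\<lambda>j. M + inverse (real (Suc j))) \<longlonglongrightarrow> M + 0"
      by (intro tendsto_intros LIMSEQ_inverse_real_of_nat)
    from LIMSEQ_subseq_LIMSEQ[OF this r(1)]
    show "(\<lambda>j. M + inverse (real (Suc (r j)))) \<longlonglongrightarrow> M" by (simp add: comp_def)
    show "\<exists>N. \<forall>n\<ge>N. norm (\<Prod>i<k. z - b (r n) i) \<le> M + inverse (real (Suc (r n)))"
      using b(2) z unfolding B_def by blast
  qed
  moreover have "\<exists>z\<in>K. M \<le> norm (poly q z)" if q: "degree q = k" "lead_coeff q = 1" for q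
  proof -
    obtain a where a: "q = (\<Prod>i<k. [:-a i, 1:])"
      using complex_poly_decompose'[of q] q by (metis smult_1_left)
    from max[of q] obtain m z
      where m: "m \<ge> 0" "z \<in> K" "norm (poly q z) = m" "\<forall>z\<in>K. norm (poly q z) \<le> m"
      by (elim exE conjE bexE)
    have "B a m" unfolding B_def pr[symmetric] a[symmetric] by (rule m(4))
    hence "m \<in> V" using m(1) unfolding V_def by blast
    hence "M \<le> m" unfolding M_def by (rule cInf_lower[OF _ bdd])
    thus ?thesis using m(2,3) by (intro bexI[of _ z]) simp_all
  qed
  ultimately have "extremal K p M" unfolding extremal_def lead unfolding degp by blast
  thus ?thesis using degp lead by blast
qed

text \<open>Newton interpolation. The bound is put on the coefficients because for empty
  \<open>X\<close> it has to say \<open>w = 0\<close>, which no bound on \<open>degree w\<close>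
  expresses.\<close>

lemma interpolation_exists:
  fixes c :: "complex \<Rightarrow> complex"
  assumes "finite X"
  shows "\<exists>w. (\<forall>x\<in>X. poly w x = c x) \<and> (\<forall>i\<ge>card X. coeff w i = 0)"
  using assms
proof (induction X)
  case empty
  show ?case by (intro exI[of _ 0]) auto
next
  case (insert y X)
  then obtain w where w: "\<And>x. x \<in> X \<Longrightarrow> poly w x = c x" "\<And>i. i \<ge> card X \<Longrightarrow> coeff w i = 0" by blast
  define P where "P = (\<Prod>u\<in>X. [:-u, 1:])"
  have Py: "poly P y \<noteq> 0" using insert.hyps by (auto simp: P_def poly_prod)
  have PX: "poly P x = 0" if "x \<in> X" for x using insert.hyps that by (auto simp: P_def poly_prod)
  have degP: "degree P = card X" by (simp add: P_def degree_prod_sum_eq)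
  define w' where "w' = w + smult ((c y - poly w y) / poly P y) P"
  have "poly w' x = c x" if "x \<in> insert y X" for x
    using that Py PX w(1) by (auto simp: w'_def)
  moreover have "coeff w' i = 0" if "i \<ge> card (insert y X)" for i
    using that insert.hyps w(2)[of i] degP by (simp add: w'_def coeff_eq_0)
  ultimately show ?case by blast
qed

text \<open>Strict convexity of the disc, by the parallelogram identity.\<close>

lemma eq_if_norm_midpoint:
  fixes a b :: complex
  assumes "norm a \<le> M" "norm b \<le> M" "norm ((a + b) / 2) \<ge> M"
  shows "a = b"
proof -
  have M: "M \<ge> 0" using assms(1) norm_ge_zero order_trans by blast
  have "(norm (a + b))\<^sup>2 + (norm (a - b))\<^sup>2 = 2 * (norm a)\<^sup>2 + 2 * (norm b)\<^sup>2"
    by (simp add: power2_norm_eq_inner inner_add_left inner_add_right inner_diff_left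
        inner_diff_right inner_commute)
  moreover have "(norm a)\<^sup>2 \<le> M\<^sup>2" "(norm b)\<^sup>2 \<le> M\<^sup>2"
    using assms by (auto intro!: power_mono)
  moreover have "(2 * M)\<^sup>2 \<le> (norm (a + b))\<^sup>2"
    using assms(3) M by (intro power_mono) (auto simp: norm_divide)
  moreover have "(2 * M)\<^sup>2 = 4 * M\<^sup>2" by (simp add: power_mult_distrib)
  ultimately have "(norm (a - b))\<^sup>2 \<le> 0" by linarith
  thus ?thesis by simp
qed

text \<open>The midpoint \<open>h\<close> of two extremal polynomials is extremal and attains the maximum only where
  the two agree; if these points are fewer than the degree, subtracting a small multiple of a
  polynomial interpolating \<open>h\<close> there decreases the norm.\<close>

lemma extremal_unique:
  assumes "compact E" "infinite E" "extremal E p M" "extremal E q M'"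
    and deg: "degree q = degree p" and lead: "lead_coeff q = lead_coeff p"
  shows "p = q"
proof (rule ccontr)
  assume "p \<noteq> q"
  have "M \<le> M'" "M' \<le> M"
    using assms(3,4) deg lead unfolding extremal_def by (metis order_trans)+
  hence MM: "M' = M" by simp
  define d where "d = degree p"
  define h where "h = smult (1/2) (p + q)"
  have hz: "poly h z = (poly p z + poly q z) / 2" for z by (simp add: h_def)
  have h_le: "norm (poly h z) \<le> M" if "z \<in> E" for z
  proof -
    have "norm (poly p z) \<le> M" "norm (poly q z) \<le> M"
      using assms(3,4) that MM unfolding extremal_def by auto
    hence "norm (poly p z + poly q z) \<le> 2 * M" using norm_triangle_ineq[of "poly p z" "poly q z"] by linarith
    thus ?thesis by (simp add: hz norm_divide)
  qed
  define X where "X = {z\<in>E. M \<le> norm (poly h z)}"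
  have X_eq: "poly (p - q) z = 0" if "z \<in> X" for z
  proof -
    have "norm (poly p z) \<le> M" "norm (poly q z) \<le> M"
      using assms(3,4) that MM unfolding extremal_def X_def by auto
    thus ?thesis using that eq_if_norm_midpoint[of "poly p z" M "poly q z"] by (auto simp: X_def hz)
  qed
  have nz: "p - q \<noteq> 0" using \<open>p \<noteq> q\<close> by simp
  have finX: "finite X" by (rule finite_subset[OF _ poly_roots_finite[OF nz]]) (use X_eq in auto)
  have "card X \<le> card {z. poly (p - q) z = 0}"
    by (rule card_mono[OF poly_roots_finite[OF nz]]) (use X_eq in auto)
  also have "\<dots> \<le> degree (p - q)" by (rule card_poly_roots_bound[OF nz])
  also have "\<dots> < d"
  proof -
    have "degree (p - q) \<le> d" using deg by (simp add: d_def degree_diff_le)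
    moreover have "degree (p - q) \<noteq> d"
    proof
      assume "degree (p - q) = d"
      moreover have "coeff q d = coeff p d" using deg lead by (simp add: d_def)
      ultimately have "coeff (p - q) (degree (p - q)) = 0" by (simp only: coeff_diff) simp
      thus False using nz by (simp only: leading_coeff_0_iff)
    qed
    ultimately show ?thesis by simp
  qed
  finally have cardX: "card X < d" .
  obtain w where w: "\<And>x. x \<in> X \<Longrightarrow> poly w x = poly h x" "\<And>i. i \<ge> card X \<Longrightarrow> coeff w i = 0"
    using interpolation_exists[OF finX, of "poly h"] by blast
  \<comment> \<open>The competitors \<open>h - \<epsilon> * w\<close> keep degree and leading
    coefficient, as \<open>card X < d\<close>. Each therefore has modulus at least \<open>M\<close>
    somewhere on \<open>E\<close>, and these points accumulate at some \<open>l\<close>.\<close>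
  define \<epsilon> where "\<epsilon> = (\<lambda>j. inverse (real (Suc j)))"
  define r where "r = (\<lambda>j. h - smult (complex_of_real (\<epsilon> j)) w)"
  have "\<exists>z\<in>E. M \<le> norm (poly (r j) z)" for j
  proof -
    have c: "coeff (r j) d = lead_coeff p"
      using w(2)[of d] cardX deg lead by (simp add: r_def h_def d_def)
    have "degree (r j) \<le> d"
      using w(2) cardX deg by (intro degree_le) (auto simp: r_def h_def d_def coeff_eq_0)
    moreover have "lead_coeff p \<noteq> 0" using cardX by (auto simp: d_def)
    hence "d \<le> degree (r j)" using c by (intro le_degree) simp
    ultimately have "degree (r j) = degree p" by (simp add: d_def)
    thus ?thesis using assms(3) c unfolding extremal_def d_def by metis
  qed
  then obtain \<zeta> where \<zeta>: "\<And>j. \<zeta> j \<in> E" "\<And>j. M \<le> norm (poly (r j) (\<zeta> j))" by metis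
  obtain l s where s: "l \<in> E" "strict_mono (s :: nat \<Rightarrow> nat)" "(\<zeta> \<circ> s) \<longlonglongrightarrow> l"
    using compact_imp_seq_compact[OF assms(1)] \<zeta>(1) unfolding seq_compact_def by metis
  have lim: "(\<lambda>j. poly a (\<zeta> (s j))) \<longlonglongrightarrow> poly a l" for a
    using s(3) by (intro tendsto_intros) (simp add: comp_def)
  have lime: "(\<lambda>j. \<epsilon> (s j)) \<longlonglongrightarrow> 0"
    using LIMSEQ_subseq_LIMSEQ[OF LIMSEQ_inverse_real_of_nat s(2)] by (simp add: comp_def \<epsilon>_def)
  have eps: "\<epsilon> j > 0" for j by (simp add: \<epsilon>_def)
  have M0: "M \<ge> 0" using h_le[OF s(1)] norm_ge_zero order_trans by blast
  have "(\<lambda>j. norm (poly h (\<zeta> (s j)) - of_real (\<epsilon> (s j)) * poly w (\<zeta> (s j)))) \<longlonglongrightarrow>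
      norm (poly h l - of_real 0 * poly w l)"
    by (intro tendsto_intros lim lime)
  hence "M \<le> norm (poly h l - of_real 0 * poly w l)"
    by (rule LIMSEQ_le_const) (use \<zeta>(2) in \<open>auto simp: r_def\<close>)
  hence lX: "l \<in> X" using s(1) by (simp add: X_def)
  \<comment> \<open>\<open>I\<close> is the derivative of the squared modulus of
    \<open>h - \<epsilon> * w\<close> at \<open>\<epsilon> = 0\<close>. It must be nonnegative at
    \<open>l\<close>; but \<open>l \<in> X\<close>, where \<open>w = h\<close> makes it -2 times the
    squared modulus of \<open>h\<close>.\<close>
  define I where "I = (\<lambda>z. - 2 * (poly h z \<bullet> poly w z))"
  have "0 \<le> I (\<zeta> (s j)) + \<epsilon> (s j) * (norm (poly w (\<zeta> (s j))))\<^sup>2" for j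
  proof -
    let ?z = "\<zeta> (s j)" and ?e = "\<epsilon> (s j)"
    have "M\<^sup>2 \<le> (norm (poly h ?z - ?e *\<^sub>R poly w ?z))\<^sup>2"
      using \<zeta>(2)[of "s j"] M0 by (intro power_mono) (auto simp: r_def scaleR_conv_of_real)
    also have "\<dots> = (norm (poly h ?z))\<^sup>2 + ?e * (I ?z + ?e * (norm (poly w ?z))\<^sup>2)"
      by (simp add: I_def power2_norm_eq_inner inner_diff_left inner_diff_right inner_commute algebra_simps)
    also have "(norm (poly h ?z))\<^sup>2 \<le> M\<^sup>2" using h_le[OF \<zeta>(1)] by (intro power_mono) auto
    finally have "0 \<le> ?e * (I ?z + ?e * (norm (poly w ?z))\<^sup>2)" by simp
    thus ?thesis using eps[of "s j"] by (simp add: zero_le_mult_iff)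
  qed
  moreover have "(\<lambda>j. I (\<zeta> (s j)) + \<epsilon> (s j) * (norm (poly w (\<zeta> (s j))))\<^sup>2) \<longlonglongrightarrow> I l + 0 * (norm (poly w l))\<^sup>2"
    unfolding I_def by (intro tendsto_intros lim lime)
  ultimately have "0 \<le> I l + 0 * (norm (poly w l))\<^sup>2"
    by (intro LIMSEQ_le_const) auto
  hence "(norm (poly h l))\<^sup>2 \<le> 0" using w(1)[OF lX] by (simp add: I_def power2_norm_eq_inner)
  hence "M = 0" using lX M0 by (simp add: X_def)
  hence "E \<subseteq> X" by (auto simp: X_def)
  thus False using assms(2) finX finite_subset by blast
qed

lemma norm_sum_mset_less:
  assumes "\<And>z. z \<in># Z \<Longrightarrow> norm (f z) < c" "Z \<noteq> {#}"
  shows "norm (\<Sum>z\<in>#Z. f z) < real (size Z) * c"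
  using assms
proof (induction Z)
  case (add x Z)
  have x: "norm (f x) < c" using add.prems by simp
  show ?case
  proof (cases "Z = {#}")
    case False
    hence "norm (\<Sum>z\<in>#Z. f z) < real (size Z) * c" using add by auto
    thus ?thesis using x norm_triangle_ineq[of "f x" "\<Sum>z\<in>#Z. f z"] by (simp add: algebra_simps)
  qed (use x in simp)
qed simp

text \<open>Averaging a competitor of \<open>p \<circ> f\<close> over the fibres of \<open>f\<close> gives a competitor of \<open>p\<close>.\<close>

lemma extremal_pcompose:
  assumes ext: "extremal K p M" and f: "degree f > 0"
  shows "extremal (poly f -` K) (pcompose p f) M"
  unfolding extremal_def
proof (intro conjI ballI allI impI)
  fix z assume "z \<in> poly f -` K"
  thus "norm (poly (pcompose p f) z) \<le> M" using ext by (simp add: extremal_def poly_pcompose)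
next
  fix q assume q: "degree q = degree (pcompose p f) \<and> lead_coeff q = lead_coeff (pcompose p f)"
  define n where "n = degree f"
  \<comment> \<open>The trace is applied to the difference only: the average of
    \<open>p \<circ> f\<close> is \<open>p\<close>, and since \<open>e\<close> is 0 or of smaller
    degree than \<open>p \<circ> f\<close>, the correction by \<open>r\<close> preserves degree and
    leading coefficient.\<close>
  define e where "e = q - pcompose p f"
  obtain r where r: "\<And>x. (\<Sum>z\<in>#fib f x. poly e z) = poly r x" "degree r * n \<le> degree e"
    unfolding n_def using trace_exists[OF f, of e] by blast
  define p' where "p' = p + smult (1 / of_nat n) r"
  have n: "n > 0" using f by (simp add: n_def)
  have avg: "of_nat n * poly p' x = (\<Sum>z\<in>#fib f x. poly q z)" for x
  proof -
    have "(\<Sum>z\<in>#fib f x. poly q z) = (\<Sum>z\<in>#fib f x. poly p x + poly e z)"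
      by (rule sum_mset_eqI) (use set_fib[OF f] in \<open>auto simp: e_def poly_pcompose\<close>)
    also have "\<dots> = of_nat n * poly p x + poly r x"
      by (simp add: sum_mset.distrib r(1) n_def)
    finally show ?thesis using n by (simp add: p'_def distrib_left)
  qed
  have "r = 0 \<or> degree r < degree p"
  proof (cases "e = 0")
    case True
    hence "poly r x = 0" for x by (simp flip: r(1))
    hence "r = 0" using poly_all_0_iff_0 by blast
    thus ?thesis ..
  next
    case False
    have "degree e \<le> degree p * n" using q by (auto simp: e_def degree_pcompose n_def intro!: degree_diff_le)
    moreover have "degree e \<noteq> degree p * n"
    proof
      assume "degree e = degree p * n"
      moreover have "coeff q (degree p * n) = coeff (pcompose p f) (degree p * n)"
        using q by (metis degree_pcompose n_def)
      ultimately have "coeff e (degree e) = 0" by (simp only: e_def coeff_diff) simp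
      thus False using False by (simp only: leading_coeff_0_iff)
    qed
    ultimately have "degree r * n < degree p * n" using r(2) by linarith
    thus ?thesis by simp
  qed
  hence "degree p' = degree p \<and> lead_coeff p' = lead_coeff p"
  proof
    assume *: "degree r < degree p"
    have "degree p' = degree p" unfolding p'_def
      by (rule degree_add_eq_left) (use * in \<open>simp add: n\<close>)
    thus ?thesis using * by (simp add: p'_def coeff_eq_0)
  qed (simp add: p'_def)
  then obtain x where x: "x \<in> K" "M \<le> norm (poly p' x)" using ext unfolding extremal_def by blast
  show "\<exists>z\<in>poly f -` K. M \<le> norm (poly q z)"
  proof (rule ccontr)
    assume "\<not> ?thesis"
    hence "norm (poly q z) < M" if "z \<in># fib f x" for z
      using that x(1) set_fib[OF f] by force
    moreover have "fib f x \<noteq> {#}" using f by (metis size_empty size_fib less_irrefl)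
    ultimately have "norm (\<Sum>z\<in>#fib f x. poly q z) < real (size (fib f x)) * M"
      by (rule norm_sum_mset_less)
    hence "real n * norm (poly p' x) < real n * M"
      unfolding avg[symmetric] by (simp add: norm_mult n_def)
    thus False using x(2) n by simp
  qed
qed

lemma extremal_smult:
  assumes "extremal E p M" "c \<noteq> 0"
  shows "extremal E (smult c p) (norm c * M)"
  unfolding extremal_def
proof (intro conjI ballI allI impI)
  fix z assume "z \<in> E"
  thus "norm (poly (smult c p) z) \<le> norm c * M"
    using assms by (auto simp: extremal_def norm_mult intro!: mult_left_mono)
next
  fix q assume q: "degree q = degree (smult c p) \<and> lead_coeff q = lead_coeff (smult c p)"
  hence "degree q = degree p" "coeff q (degree p) = c * lead_coeff p"
    using assms(2) by (simp, metis degree_smult_eq lead_coeff_smult)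
  hence "degree (smult (1/c) q) = degree p \<and> lead_coeff (smult (1/c) q) = lead_coeff p"
    using assms(2) by simp
  then obtain z where "z \<in> E" "M \<le> norm (poly (smult (1/c) q) z)"
    using assms(1) unfolding extremal_def by blast
  thus "\<exists>z\<in>E. norm c * M \<le> norm (poly q z)"
    using assms(2) by (intro bexI[of _ z]) (auto simp: norm_mult norm_divide field_simps)
qed

lemma compact_vimage_poly:
  fixes f :: "complex poly"
  assumes "degree f > 0" "compact K"
  shows "compact (poly f -` K)"
  unfolding compact_eq_bounded_closed
proof
  show "closed (poly f -` K)"
    by (intro continuous_closed_vimage compact_imp_closed[OF assms(2)]) simp
  obtain B where B: "\<forall>x\<in>K. norm x \<le> B" using compact_imp_bounded[OF assms(2)] by (auto simp: bounded_iff)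
  have "eventually (\<lambda>z. max B 0 + 1 \<le> norm (poly f z)) at_infinity"
    using filterlim_poly_at_infinity[OF assms(1)] unfolding filterlim_at_infinity[OF order_refl] by force
  then obtain R where R: "\<And>z. R \<le> norm z \<Longrightarrow> max B 0 + 1 \<le> norm (poly f z)"
    unfolding eventually_at_infinity by blast
  have "norm z \<le> R" if "z \<in> poly f -` K" for z
    using R[of z] B that by force
  thus "bounded (poly f -` K)" unfolding bounded_iff by blast
qed

lemma poly_surj: "degree (f :: complex poly) > 0 \<Longrightarrow> \<exists>z. poly f z = x"
proof -
  assume f: "degree f > 0"
  hence "fib f x \<noteq> {#}" by (metis size_empty size_fib less_irrefl)
  then obtain z where "z \<in># fib f x" by blast
  thus ?thesis using set_fib[OF f] by blast
qed

text \<open>Both polynomials are extremal on the common preimage. The condition on \<open>a\<close>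
  and \<open>b\<close> equalises their degrees and the scalars their leading coefficients,
  \<open>T a\<close> and \<open>T b\<close> being monic.\<close>

theorem extremal_relation:
  fixes f g :: "complex poly"
  assumes deg: "degree f > 0" "degree g > 0"
    and K: "compact K" "infinite K" and eq: "poly f -` K = poly g -` K"
  shows "\<exists>T. \<forall>k. degree (T k) = k \<and> lead_coeff (T k) = 1 \<and>
    (\<forall>a b. a * degree f = b * degree g \<longrightarrow>
       smult (lead_coeff g ^ b) (pcompose (T a) f) = smult (lead_coeff f ^ a) (pcompose (T b) g))"
proof -
  have "\<forall>k. \<exists>p M. degree p = k \<and> lead_coeff p = 1 \<and> extremal K p M"
    using extremal_exists[OF K(1)] K(2) by blast
  then obtain T M where T: "\<And>k. degree (T k) = k" "\<And>k. lead_coeff (T k) = 1" "\<And>k. extremal K (T k) (M k)"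
    by metis
  define E where "E = poly f -` K"
  have E: "compact E" "E = poly g -` K" using compact_vimage_poly[OF deg(1) K(1)] eq by (auto simp: E_def)
  have "K \<subseteq> poly f ` E" using poly_surj[OF deg(1)] unfolding E_def by (metis image_vimage_eq rangeI subset_iff Int_iff)
  hence infE: "infinite E" using K(2) finite_subset finite_imageI by blast
  have lead: "lead_coeff (pcompose (T k) h) = lead_coeff h ^ k" if "degree h > 0" for k h
    using lead_coeff_comp[OF that, of "T k"] T by simp
  have "smult (lead_coeff g ^ b) (pcompose (T a) f) = smult (lead_coeff f ^ a) (pcompose (T b) g)"
    if ab: "a * degree f = b * degree g" for a b
  proof (rule extremal_unique[OF E(1) infE])
    have l0: "lead_coeff f ^ a \<noteq> 0" "lead_coeff g ^ b \<noteq> 0"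
      using deg by (metis degree_0 leading_coeff_0_iff less_irrefl power_not_zero)+
    show "extremal E (smult (lead_coeff g ^ b) (pcompose (T a) f)) (norm (lead_coeff g ^ b) * M a)"
      unfolding E_def by (intro extremal_smult extremal_pcompose T deg l0)
    show "extremal E (smult (lead_coeff f ^ a) (pcompose (T b) g)) (norm (lead_coeff f ^ a) * M b)"
      unfolding E(2) by (intro extremal_smult extremal_pcompose T deg l0)
    show "degree (smult (lead_coeff f ^ a) (pcompose (T b) g)) = degree (smult (lead_coeff g ^ b) (pcompose (T a) f))"
      using l0 ab by (simp only: degree_smult_eq if_False degree_pcompose T)
    show "lead_coeff (smult (lead_coeff f ^ a) (pcompose (T b) g)) = lead_coeff (smult (lead_coeff g ^ b) (pcompose (T a) f))"
      by (simp only: lead_coeff_smult lead[OF deg(1)] lead[OF deg(2)] mult.commute)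
  qed
  thus ?thesis using T by blast
qed

section \<open>Common right factors\<close>

lemma degree_eq_1E:
  assumes "degree (p :: 'a::zero poly) = 1"
  obtains a b where "p = [:a, b:]" "b \<noteq> 0"
proof -
  obtain a q where p: "p = pCons a q" by (cases p)
  hence "degree q = 0" "q \<noteq> 0" using assms by (auto split: if_splits)
  then obtain b where "q = [:b:]" "b \<noteq> 0" by (auto elim: degree_eq_zeroE)
  thus ?thesis using that p by blast
qed

lemma poly_factors_through':
  fixes f w :: "complex poly"
  assumes "degree w > 0" "\<And>z0 z. poly w z = poly w z0 \<Longrightarrow> poly f z = poly f z0"
  shows "\<exists>h. f = pcompose h w"
proof (rule poly_factors_through[OF assms(1)])
  have "{z0. \<exists>z. poly w z = poly w z0 \<and> poly f z \<noteq> poly f z0} = {}" using assms(2) by blast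
  thus "finite {z0. \<exists>z. poly w z = poly w z0 \<and> poly f z \<noteq> poly f z0}"
    by (simp only: finite.emptyI)
qed

text \<open>A bivariate polynomial is an element of \<^typ>\<open>complex poly poly\<close> with outer variable \<open>z\<close>
  and inner variable \<open>z\<^sub>0\<close>.\<close>

definition lift :: "complex poly \<Rightarrow> complex poly poly" where
  "lift p = map_poly (\<lambda>a. [:a:]) p"

text \<open>This is f(z) - f(z0), whose zeros are the pairs of points with the same value.\<close>

definition diffq :: "complex poly \<Rightarrow> complex poly poly" where
  "diffq f = lift f - [:f:]"

definition spec :: "complex \<Rightarrow> complex poly poly \<Rightarrow> complex poly" where
  "spec z0 P = map_poly (\<lambda>c. poly c z0) P"

text \<open>The substitution \<open>z\<^sub>0 \<mapsto> s\<close>, \<open>z \<mapsto> \<zeta> s\<close>, with outer variable \<open>s\<close> and inner variable \<open>\<zeta>\<close>;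
  the leading coefficient of the result is the dehomogenised leading form.\<close>

definition homog :: "complex poly poly \<Rightarrow> complex poly poly" where
  "homog P = poly (map_poly lift P) [:0, [:0, 1:]:]"

lemma map_poly_mult_hom:
  fixes h :: "'a::comm_semiring_0 \<Rightarrow> 'b::comm_semiring_0"
  assumes "h 0 = 0" "\<And>a b. h (a + b) = h a + h b" "\<And>a b. h (a * b) = h a * h b"
  shows "map_poly h (p * q) = map_poly h p * map_poly h q"
proof (rule poly_eqI)
  fix n
  have "h (sum g S) = (\<Sum>i\<in>S. h (g i))" if "finite S" for g and S :: "nat set"
    using that by (induction S) (simp_all add: assms)
  thus "coeff (map_poly h (p * q)) n = coeff (map_poly h p * map_poly h q) n"
    by (simp add: coeff_map_poly assms coeff_mult)
qed

lemma map_poly_add_hom: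
  assumes "h 0 = 0" "\<And>a b. h (a + b) = h a + h b"
  shows "map_poly h (p + q) = map_poly h p + map_poly h q"
  by (rule poly_eqI) (simp add: coeff_map_poly assms)

lemma lift_0 [simp]: "lift 0 = 0" by (simp add: lift_def)

lemma lift_add: "lift (p + q) = lift p + lift q"
  unfolding lift_def by (rule map_poly_add_hom) auto

lemma lift_mult: "lift (p * q) = lift p * lift q"
  unfolding lift_def by (rule map_poly_mult_hom) auto

lemma lift_const [simp]: "lift [:a:] = [:[:a:]:]"
  by (simp add: lift_def map_poly_pCons)

lemma coeff_lift: "coeff (lift p) i = [:coeff p i:]"
  by (simp add: lift_def coeff_map_poly)

lemma homog_mult: "homog (P * Q) = homog P * homog Q"
  unfolding homog_def by (subst map_poly_mult_hom) (simp_all add: lift_add lift_mult)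

lemma spec_mult: "spec z0 (P * Q) = spec z0 P * spec z0 Q"
  unfolding spec_def by (rule map_poly_mult_hom) simp_all

lemma coeff_spec: "coeff (spec z0 P) i = poly (coeff P i) z0"
  by (simp add: spec_def coeff_map_poly)

lemma spec_diffq: "spec z0 (diffq f) = f - [:poly f z0:]"
  by (rule poly_eqI) (auto simp: coeff_spec diffq_def coeff_lift coeff_pCons split: nat.splits)

lemma homog_pCons: "homog (pCons c P) = lift c + pCons 0 (smult [:0, 1:] (homog P))"
  by (cases "pCons c P = 0") (auto simp: homog_def map_poly_pCons)

text \<open>The monomial \<open>z^i * z0^j\<close> becomes \<open>s^(i+j) * \<zeta>^i\<close>. So
  nothing cancels, and the outer degree of \<open>homog P\<close> is the total degree of
  \<open>P\<close>.\<close>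

lemma coeff_homog:
  "coeff (coeff (homog P) N) i = (if i \<le> N then coeff (coeff P i) (N - i) else 0)"
proof (induction P arbitrary: N i)
  case (pCons c P)
  show ?case unfolding homog_pCons
    by (cases N; cases i) (auto simp: coeff_lift pCons.IH)
qed (simp add: homog_def)

lemma degree_coeff_homog_le: "degree (coeff (homog P) N) \<le> degree P"
  by (rule degree_le) (auto simp: coeff_homog coeff_eq_0)

lemma homog_nonzero: "P \<noteq> 0 \<Longrightarrow> homog P \<noteq> 0"
proof
  assume "P \<noteq> 0" "homog P = 0"
  then obtain i where "coeff P i \<noteq> 0" by (metis poly_eqI coeff_0)
  then obtain j where "coeff (coeff P i) j \<noteq> 0" by (metis poly_eqI coeff_0)
  moreover have "coeff (coeff (homog P) (i + j)) i = coeff (coeff P i) j" by (simp add: coeff_homog)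
  ultimately show False using \<open>homog P = 0\<close> by simp
qed

lemma le_degree_homog: "coeff P i \<noteq> 0 \<Longrightarrow> i + degree (coeff P i) \<le> degree (homog P)"
proof (rule le_degree)
  assume "coeff P i \<noteq> 0"
  hence "coeff (coeff (homog P) (i + degree (coeff P i))) i \<noteq> 0" by (simp add: coeff_homog)
  thus "coeff (homog P) (i + degree (coeff P i)) \<noteq> 0" by auto
qed

lemma degree_diffq:
  assumes "degree f > 0"
  shows "degree (diffq f) = degree f" "coeff (diffq f) (degree f) = [:lead_coeff f:]"
proof -
  show c: "coeff (diffq f) (degree f) = [:lead_coeff f:]"
    using assms by (auto simp: diffq_def coeff_lift coeff_pCons split: nat.splits)
  have "degree (diffq f) \<le> degree f"
    by (rule degree_le) (auto simp: diffq_def coeff_lift coeff_pCons coeff_eq_0 split: nat.splits)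
  moreover have "degree f \<le> degree (diffq f)"
    by (rule le_degree) (use assms in \<open>auto simp: c\<close>)
  ultimately show "degree (diffq f) = degree f" by simp
qed

text \<open>The leading form of f(z) - f(z0) is a multiple of \<open>z^n - z0^n\<close>;
  dehomogenised, its roots are the n-th roots of unity, all simple.\<close>

lemma homog_diffq:
  assumes "degree f > 0"
  shows "degree (homog (diffq f)) = degree f"
    and "lead_coeff (homog (diffq f)) = smult (lead_coeff f) (monom 1 (degree f) - 1)"
proof -
  have c: "coeff (homog (diffq f)) N = smult (coeff f N) (monom 1 N - 1)" if "N > 0" for N
    using that by (intro poly_eqI)
      (auto simp: coeff_homog diffq_def coeff_lift coeff_pCons coeff_eq_0 split: nat.splits)
  have 1: "degree (homog (diffq f)) \<le> degree f"
    by (rule degree_le) (use assms c in \<open>auto simp: coeff_eq_0\<close>)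
  have ne: "monom 1 (degree f) - 1 \<noteq> (0 :: complex poly)"
  proof
    assume "monom 1 (degree f) - 1 = (0 :: complex poly)"
    hence "coeff (monom 1 (degree f) - 1) 0 = (0 :: complex)" by simp
    thus False using assms by simp
  qed
  have 2: "degree f \<le> degree (homog (diffq f))"
    by (rule le_degree) (use assms ne c[OF assms] in auto)
  show d: "degree (homog (diffq f)) = degree f" using 1 2 by simp
  show "lead_coeff (homog (diffq f)) = smult (lead_coeff f) (monom 1 (degree f) - 1)"
    unfolding d using c[OF assms] .
qed

lemma diffq_dvd_pcompose: "diffq f dvd diffq (pcompose u f)"
proof (induction u)
  case (pCons a u)
  have "diffq (pcompose (pCons a u) f) = lift f * diffq (pcompose u f) + diffq f * [:pcompose u f:]"
    by (simp add: diffq_def pcompose_pCons lift_add lift_mult algebra_simps)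
  also have "diffq f dvd \<dots>"
    by (intro dvd_add dvd_mult pCons.IH dvd_mult2 dvd_refl)
  finally show ?case .
qed (simp add: diffq_def)

lemma double_root_pderiv:
  fixes p q r :: "complex poly"
  assumes "poly p z = 0" "poly q z = 0" "p * q dvd r"
  shows "poly (pderiv r) z = 0"
proof -
  obtain s where "r = p * q * s" using assms(3) by (auto elim: dvdE)
  thus ?thesis using assms(1,2) by (simp add: pderiv_mult)
qed

text \<open>The common factor \<open>D\<close> of \<open>f(z) - f(z\<^sub>0)\<close> and \<open>g(z) - g(z\<^sub>0)\<close> is \<open>w(z) - w(z\<^sub>0)\<close> up to a unit:
  the leading form of \<open>s(z) - s(z\<^sub>0)\<close>, where \<open>s = u \<circ> f = v \<circ> g\<close>, is squarefree, which gives the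
  degree of \<open>D\<close>; and the coefficients of \<open>D\<close> only depend on \<open>(f(z\<^sub>0), g(z\<^sub>0))\<close>, hence are constant
  on the roots of \<open>D\<close>, which for degree reasons leaves only the constant coefficient.\<close>

theorem common_right_factor:
  fixes f g u v :: "complex poly"
  assumes deg: "degree f > 0" "degree g > 0" "degree u > 0"
    and comp: "pcompose u f = pcompose v g"
  obtains w where "gcd (degree f) (degree g) \<le> degree w"
    and "\<And>z0 z. poly w z = poly w z0 \<Longrightarrow> poly f z = poly f z0 \<and> poly g z = poly g z0"
    and "finite {z0. \<exists>z. poly f z = poly f z0 \<and> poly g z = poly g z0 \<and> poly w z \<noteq> poly w z0}"
proof -
  define s where "s = pcompose u f"
  have degs: "degree s > 0" using deg by (simp add: s_def degree_pcompose)
  define D where "D = gcd (diffq f) (diffq g)"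
  have nz: "diffq f \<noteq> 0" "diffq g \<noteq> 0" "diffq s \<noteq> 0"
    using degree_diffq(1)[of f] degree_diffq(1)[of g] degree_diffq(1)[of s] deg degs by auto
  have "D \<noteq> 0" using nz by (simp add: D_def)
  \<comment> \<open>Coprimality of the cofactors is what puts the whole product
    \<open>D * p * q\<close> into \<open>diffq s\<close>.\<close>
  then obtain p q where pq: "diffq f = p * D" "diffq g = q * D" "coprime p q"
    using gcd_coprime_exists[of "diffq f" "diffq g"] unfolding D_def by blast
  have pqnz: "p \<noteq> 0" "q \<noteq> 0" using pq nz by auto
  have dvds: "diffq f dvd diffq s" "diffq g dvd diffq s"
    using diffq_dvd_pcompose[of f u] diffq_dvd_pcompose[of g v] comp by (auto simp: s_def)
  then obtain r0 where r0: "diffq s = D * r0"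
    using pq by (metis dvdE dvd_mult_right)
  have "p dvd r0" "q dvd r0"
    using dvds \<open>D \<noteq> 0\<close> unfolding pq r0 by (auto simp: mult.commute[of _ D])
  hence "p * q dvd r0" using pq(3) by (rule divides_mult)
  then obtain r where "r0 = p * q * r" by (rule dvdE)
  hence r: "diffq s = D * p * q * r" unfolding r0 by (simp only: mult.assoc)
  have rnz: "r \<noteq> 0" using r nz by auto
  define \<delta> where "\<delta> = degree D"
  define L where "L = (\<lambda>P. lead_coeff (homog P))"
  have L_mult: "L (P * Q) = L P * L Q" for P Q by (simp add: L_def homog_mult lead_coeff_mult)
  have Lf: "L p * L D = smult (lead_coeff f) (monom 1 (degree f) - 1)"
    and Lg: "L q * L D = smult (lead_coeff g) (monom 1 (degree g) - 1)"
    and Ls: "L D * L p * L q * L r = smult (lead_coeff s) (monom 1 (degree s) - 1)"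
    using homog_diffq(2)[OF deg(1)] homog_diffq(2)[OF deg(2)] homog_diffq(2)[OF degs]
    unfolding pq(1,2) r L_def homog_mult lead_coeff_mult by simp_all
  \<comment> \<open>At such a \<open>\<zeta>\<close> the leading forms of \<open>p * D\<close> and
    \<open>q * D\<close> both vanish. If that of \<open>D\<close> did not, those of \<open>p\<close>
    and \<open>q\<close> would, giving a double root of
    \<open>\<zeta> ^ degree s - 1\<close>.\<close>
  have rootD: "poly (L D) \<zeta> = 0" if "\<zeta> ^ gcd (degree f) (degree g) = 1" for \<zeta>
  proof (rule ccontr)
    assume *: "poly (L D) \<zeta> \<noteq> 0"
    have 1: "\<zeta> ^ degree f = 1" "\<zeta> ^ degree g = 1"
      using that by (metis gcd_dvd1 gcd_dvd2 dvdE power_mult power_one)+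
    have "poly (L p * L D) \<zeta> = 0" "poly (L q * L D) \<zeta> = 0"
      unfolding Lf Lg using 1 by (simp_all add: poly_monom)
    hence "poly (L p) \<zeta> = 0" "poly (L q) \<zeta> = 0" using * by auto
    hence "poly (pderiv (L D * L p * L q * L r)) \<zeta> = 0"
      by (rule double_root_pderiv) (simp add: mult_ac)
    hence "poly (pderiv (monom 1 (degree s) - 1 :: complex poly)) \<zeta> = 0"
      unfolding Ls using degs by (auto simp: pderiv_smult)
    hence "\<zeta> ^ (degree s - 1) = 0" using degs by (simp add: pderiv_diff pderiv_monom poly_monom)
    hence "\<zeta> = 0" by simp
    thus False using 1(1) deg(1) by (simp add: zero_power)
  qed
  have LD: "L D \<noteq> 0" using homog_nonzero[OF \<open>D \<noteq> 0\<close>] by (simp add: L_def)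
  have gcd_le: "gcd (degree f) (degree g) \<le> \<delta>"
  proof -
    let ?d = "gcd (degree f) (degree g)"
    have d: "?d > 0" using deg by simp
    have "?d = card {z::complex. z ^ ?d = 1}" using card_roots_unity_eq[OF d] by simp
    also have "\<dots> \<le> card {z. poly (L D) z = 0}"
      by (rule card_mono) (use rootD poly_roots_finite[OF LD] in auto)
    also have "\<dots> \<le> degree (L D)" by (rule card_poly_roots_bound[OF LD])
    also have "\<dots> \<le> \<delta>" unfolding L_def \<delta>_def by (rule degree_coeff_homog_le)
    finally show ?thesis .
  qed
  \<comment> \<open>The top coefficient of \<open>D\<close> in \<open>z\<close> divides the constant
    leading coefficient of \<open>f\<close>, so it does not involve \<open>z0\<close>.\<close>
  have lead: "coeff D \<delta> * coeff p (degree p) = [:lead_coeff f:]"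
    using degree_diffq[OF deg(1)] unfolding pq(1) \<delta>_def
    by (metis lead_coeff_mult mult.commute)
  have "degree (coeff D \<delta>) = 0"
  proof -
    have "coeff D \<delta> \<noteq> 0" "coeff p (degree p) \<noteq> 0" using \<open>D \<noteq> 0\<close> pqnz by (auto simp: \<delta>_def)
    hence "degree (coeff D \<delta>) + degree (coeff p (degree p)) = degree (coeff D \<delta> * coeff p (degree p))"
      by (simp add: degree_mult_eq)
    also have "\<dots> = 0" unfolding lead by simp
    finally show ?thesis by simp
  qed
  then obtain l where l: "coeff D \<delta> = [:l:]" by (metis degree_eq_zeroE)
  have l0: "l \<noteq> 0" using l \<open>D \<noteq> 0\<close> by (auto simp: \<delta>_def)
  \<comment> \<open>For \<open>p\<close> and \<open>D\<close> the total degrees add up to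
    \<open>degree f\<close>, and so do the degrees in \<open>z\<close>. The total degree of
    \<open>p\<close> is at least its degree in \<open>z\<close>, so that of \<open>D\<close> is at
    most \<open>\<delta>\<close>.\<close>
  have hD: "degree (homog D) \<le> \<delta>"
  proof -
    have "degree (homog p) + degree (homog D) = degree f"
      using homog_diffq(1)[OF deg(1)] homog_nonzero[OF \<open>D \<noteq> 0\<close>] homog_nonzero[OF pqnz(1)]
      by (simp add: pq(1) homog_mult degree_mult_eq)
    moreover have "degree p + \<delta> = degree f"
      using degree_diffq(1)[OF deg(1)] \<open>D \<noteq> 0\<close> pqnz by (simp add: pq(1) degree_mult_eq \<delta>_def)
    moreover have "degree p \<le> degree (homog p)"
      using le_degree_homog[of p "degree p"] pqnz by simp
    ultimately show ?thesis by simp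
  qed
  have deg_coeff: "degree (coeff D i) \<le> \<delta> - i" for i
    using le_degree_homog[of D i] hD by (cases "coeff D i = 0") auto
  \<comment> \<open>Outside this finite set the fibre of \<open>s\<close> through \<open>z0\<close>
    is unramified, so that \<open>spec z0 D\<close> has only simple roots.\<close>
  define Crit where "Crit = {z0. poly s z0 \<in> poly s ` {z. poly (pderiv s) z = 0}}"
  have finC: "finite Crit"
    unfolding Crit_def by (intro finite_vimage_poly degs finite_imageI poly_roots_finite pderiv_nonzero)
  have spec_s: "spec z0 D * spec z0 p * spec z0 q * spec z0 r = s - [:poly s z0:]" for z0
    by (simp add: spec_mult[symmetric] r[symmetric] spec_diffq)
  have spec_f: "spec z0 p * spec z0 D = f - [:poly f z0:]" for z0
    by (simp add: spec_mult[symmetric] pq(1)[symmetric] spec_diffq)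
  have spec_g: "spec z0 q * spec z0 D = g - [:poly g z0:]" for z0
    by (simp add: spec_mult[symmetric] pq(2)[symmetric] spec_diffq)
  have s_common: "poly s z = poly s z0" if "poly f z = poly f z0" for z z0
    using that by (simp add: s_def poly_pcompose)
  have simple: "poly (pderiv s) z \<noteq> 0" if "poly s z = poly s z0" "z0 \<notin> Crit" for z z0
  proof
    assume "poly (pderiv s) z = 0"
    hence "poly s z \<in> poly s ` {z. poly (pderiv s) z = 0}" by blast
    thus False using that by (simp add: Crit_def)
  qed
  have roots: "poly (spec z0 D) z = 0 \<longleftrightarrow> poly f z = poly f z0 \<and> poly g z = poly g z0"
    if "z0 \<notin> Crit" for z z0
  proof
    assume "poly (spec z0 D) z = 0"
    hence "poly (f - [:poly f z0:]) z = 0" "poly (g - [:poly g z0:]) z = 0"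
      unfolding spec_f[symmetric] spec_g[symmetric] by auto
    thus "poly f z = poly f z0 \<and> poly g z = poly g z0" by simp
  next
    assume *: "poly f z = poly f z0 \<and> poly g z = poly g z0"
    show "poly (spec z0 D) z = 0"
    proof (rule ccontr)
      assume D: "poly (spec z0 D) z \<noteq> 0"
      have "poly (spec z0 p * spec z0 D) z = 0" "poly (spec z0 q * spec z0 D) z = 0"
        unfolding spec_f spec_g using * by auto
      hence "poly (spec z0 p) z = 0" "poly (spec z0 q) z = 0" using D by auto
      hence "poly (pderiv (s - [:poly s z0:])) z = 0"
        by (rule double_root_pderiv) (simp add: spec_s[symmetric] mult_ac)
      thus False using simple[OF s_common that] * by (simp add: pderiv_diff pderiv_pCons)
    qed
  qed
  have deg_spec: "degree (spec z0 D) = \<delta>" "lead_coeff (spec z0 D) = l" for z0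
  proof -
    have "degree (spec z0 D) \<le> \<delta>" by (rule degree_le) (auto simp: coeff_spec \<delta>_def coeff_eq_0)
    moreover have "\<delta> \<le> degree (spec z0 D)" by (rule le_degree) (simp add: coeff_spec l l0)
    ultimately show "degree (spec z0 D) = \<delta>" by simp
    thus "lead_coeff (spec z0 D) = l" by (simp add: coeff_spec l)
  qed
  have rsq: "rsquarefree (spec z0 D)" if "z0 \<notin> Crit" for z0
  proof (rule rsquarefree_roots[THEN iffD2], intro allI notI)
    fix z assume *: "poly (spec z0 D) z = 0 \<and> poly (pderiv (spec z0 D)) z = 0"
    obtain h where h: "s - [:poly s z0:] = spec z0 D * h"
      using spec_s[of z0] by (metis mult.assoc)
    have "poly (pderiv (s - [:poly s z0:])) z = 0"
      unfolding h using * by (simp add: pderiv_mult)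
    thus False using * roots[OF that] simple[OF s_common that, of z]
      by (simp add: pderiv_diff pderiv_pCons)
  qed
  have same: "spec z1 D = spec z0 D"
    if "z0 \<notin> Crit" "poly f z1 = poly f z0" "poly g z1 = poly g z0" for z0 z1
  proof -
    have z1: "z1 \<notin> Crit" using that s_common[OF that(2)] by (simp add: Crit_def)
    have "{z. poly (spec z1 D) z = 0} = {z. poly (spec z0 D) z = 0}"
      using roots[OF z1] roots[OF that(1)] that by auto
    moreover have "spec z D = smult l (\<Prod>u | poly (spec z D) u = 0. [:-u, 1:])" if "z \<notin> Crit" for z
      using complex_poly_decompose_rsquarefree[OF rsq[OF that]] unfolding deg_spec(2) by (rule sym)
    ultimately show ?thesis using z1 that(1) by metis
  qed
  have card_roots: "card {z. poly (spec z0 D) z = 0} = \<delta>" if "z0 \<notin> Crit" for z0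
  proof -
    have eq: "spec z0 D = smult l (\<Prod>u | poly (spec z0 D) u = 0. [:-u, 1:])"
      using complex_poly_decompose_rsquarefree[OF rsq[OF that]] unfolding deg_spec(2) by (rule sym)
    have "\<delta> = degree (smult l (\<Prod>u | poly (spec z0 D) u = 0. [:-u, 1:]))"
      unfolding eq[symmetric] by (simp add: deg_spec)
    also have "\<dots> = card {z. poly (spec z0 D) z = 0}" using l0 by (simp add: degree_prod_sum_eq)
    finally show ?thesis ..
  qed
  obtain z0 where z0: "z0 \<notin> Crit" using finC infinite_UNIV_char_0 by (metis ex_new_if_finite)
  \<comment> \<open>The coefficient of \<open>z^i\<close> has degree at most
    \<open>\<delta> - i\<close> in \<open>z0\<close>, yet takes one and the same value at the
    \<open>\<delta>\<close> roots of \<open>spec z0 D\<close>.\<close>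
  have const: "coeff D i = [:poly (coeff D i) z0:]" if "i > 0" for i
  proof (cases "i \<le> \<delta>")
    case True
    define h where "h = coeff D i - [:poly (coeff D i) z0:]"
    have "h = 0"
    proof (rule ccontr)
      assume "h \<noteq> 0"
      have "{z. poly (spec z0 D) z = 0} \<subseteq> {z. poly h z = 0}"
      proof
        fix z assume "z \<in> {z. poly (spec z0 D) z = 0}"
        hence "poly f z = poly f z0 \<and> poly g z = poly g z0" using roots[OF z0] by blast
        hence "spec z D = spec z0 D" using same[OF z0] by blast
        hence "poly (coeff D i) z = poly (coeff D i) z0" by (metis coeff_spec)
        thus "z \<in> {z. poly h z = 0}" by (simp add: h_def)
      qed
      hence "\<delta> \<le> card {z. poly h z = 0}"
        unfolding card_roots[OF z0, symmetric] by (intro card_mono poly_roots_finite[OF \<open>h \<noteq> 0\<close>])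
      also have "\<dots> \<le> degree h" by (rule card_poly_roots_bound[OF \<open>h \<noteq> 0\<close>])
      also have "\<dots> \<le> \<delta> - i" using deg_coeff[of i] by (simp add: h_def)
      finally show False using that True by simp
    qed
    thus ?thesis by (simp add: h_def)
  next
    case False
    hence "coeff D i = 0" by (simp add: \<delta>_def coeff_eq_0)
    thus ?thesis by simp
  qed
  define w where "w = spec z0 D"
  have w: "spec z1 D = w - [:poly w z1:]" if "z1 \<notin> Crit" for z1
  proof -
    define k where "k = poly (coeff D 0) z1 - poly (coeff D 0) z0"
    have eq: "spec z1 D = w + [:k:]"
    proof (rule poly_eqI)
      fix i show "coeff (spec z1 D) i = coeff (w + [:k:]) i"
      proof (cases i)
        case (Suc j)
        hence "poly (coeff D i) z1 = poly (coeff D i) z0"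
          using const[of i] by (metis poly_const_conv zero_less_Suc)
        thus ?thesis by (simp add: w_def coeff_spec Suc)
      qed (simp add: w_def coeff_spec k_def)
    qed
    have "poly (spec z1 D) z1 = 0" using roots[OF that] by simp
    hence "k = - poly w z1" unfolding eq by (simp add: add_eq_0_iff)
    thus ?thesis using eq by simp
  qed
  have degw: "degree w = \<delta>" by (simp add: w_def deg_spec)
  have diffq_w: "D = diffq w"
  proof -
    have "poly (coeff D i - coeff (diffq w) i) x = poly 0 x" if "x \<notin> Crit" for i x
      using arg_cong[OF w[OF that], of "\<lambda>p. coeff p i"]
      by (simp flip: spec_diffq add: coeff_spec)
    hence "coeff D i - coeff (diffq w) i = 0" for i
      by (rule poly_eqI_infinite[OF finC])
    thus ?thesis by (intro poly_eqI) simp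
  qed
  show ?thesis
  proof (rule that)
    show "gcd (degree f) (degree g) \<le> degree w" using gcd_le degw by simp
    show "poly f z = poly f z0 \<and> poly g z = poly g z0" if "poly w z = poly w z0" for z0 z
    proof -
      have 0: "poly (spec z0 D) z = 0" using that by (simp add: diffq_w spec_diffq)
      have "poly (f - [:poly f z0:]) z = 0" "poly (g - [:poly g z0:]) z = 0"
        unfolding spec_f[symmetric] spec_g[symmetric] using 0 by auto
      thus ?thesis by simp
    qed
    show "finite {z0. \<exists>z. poly f z = poly f z0 \<and> poly g z = poly g z0 \<and> poly w z \<noteq> poly w z0}"
    proof (rule finite_subset[OF _ finC], safe, rule ccontr)
      fix z0 z assume *: "poly f z = poly f z0" "poly g z = poly g z0" "poly w z \<noteq> poly w z0" "z0 \<notin> Crit"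
      hence "poly (spec z0 D) z = 0" using roots[OF *(4)] by simp
      thus False using * by (simp add: diffq_w spec_diffq)
    qed
  qed
qed

corollary decompose_coprime:
  fixes f g u v :: "complex poly"
  assumes deg: "degree f > 0" "degree g > 0" "degree u > 0"
    and comp: "pcompose u f = pcompose v g"
  obtains w F G where "f = pcompose F w" "g = pcompose G w"
    "degree w > 0" "coprime (degree F) (degree G)"
proof -
  obtain w where w: "gcd (degree f) (degree g) \<le> degree w"
    "\<And>z0 z. poly w z = poly w z0 \<Longrightarrow> poly f z = poly f z0 \<and> poly g z = poly g z0"
    by (rule common_right_factor[OF assms], rule that, assumption+)
  have "gcd (degree f) (degree g) > 0" using deg by simp
  hence degw: "degree w > 0" using w(1) by (rule less_le_trans)
  obtain F where F: "f = pcompose F w"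
    using poly_factors_through'[OF degw, of f] w(2) by blast
  obtain G where G: "g = pcompose G w"
    using poly_factors_through'[OF degw, of g] w(2) by blast
  have "gcd (degree F) (degree G) * degree w \<le> degree w"
    using w(1) unfolding F G degree_pcompose
    by (metis gcd_mult_distrib_nat mult.commute)
  hence "gcd (degree F) (degree G) \<le> 1" using degw by simp
  moreover have "gcd (degree F) (degree G) \<noteq> 0" using deg F by (auto simp: degree_pcompose)
  ultimately have "gcd (degree F) (degree G) = 1" by linarith
  hence "coprime (degree F) (degree G)" by (simp only: coprime_iff_gcd_eq_1)
  thus ?thesis using that F G degw by blast
qed

text \<open>The degree of the common right factor divides two coprime numbers, so \<open>w\<close>
  is affine and the pair \<open>(f, g)\<close> separates generic points. This supplies the
  assumption \<open>inj\<close> of \<open>image_fib_eq_fib\<close>.\<close>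

corollary coprime_generic_injective:
  fixes f g u v :: "complex poly"
  assumes deg: "degree f > 0" "degree g > 0" "degree u > 0"
    and comp: "pcompose u f = pcompose v g" and cop: "coprime (degree f) (degree g)"
  shows "finite {z0. \<exists>z. poly f z = poly f z0 \<and> poly g z = poly g z0 \<and> z \<noteq> z0}"
proof -
  obtain w where w: "gcd (degree f) (degree g) \<le> degree w"
    "\<And>z0 z. poly w z = poly w z0 \<Longrightarrow> poly f z = poly f z0 \<and> poly g z = poly g z0"
    "finite {z0. \<exists>z. poly f z = poly f z0 \<and> poly g z = poly g z0 \<and> poly w z \<noteq> poly w z0}"
    by (rule common_right_factor[OF deg comp], rule that, assumption+)
  have degw: "degree w > 0" using w(1) cop by (simp add: coprime_iff_gcd_eq_1)
  obtain F where F: "f = pcompose F w"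
    using poly_factors_through'[OF degw, of f] w(2) by blast
  obtain G where G: "g = pcompose G w"
    using poly_factors_through'[OF degw, of g] w(2) by blast
  have "degree w dvd degree f" "degree w dvd degree g" unfolding F G by (simp_all add: degree_pcompose)
  hence "degree w = 1" using cop by (metis coprime_common_divisor_nat nat_dvd_1_iff_1)
  then obtain a b where ab: "w = [:a, b:]" "b \<noteq> 0"
    by (elim degree_eq_1E)
  hence "poly w z \<noteq> poly w z0 \<longleftrightarrow> z \<noteq> z0" for z z0 by simp
  thus ?thesis using w(3) by simp
qed

section \<open>Squares of coprime degrees\<close>

lemma poly_ext: "(\<And>x. poly p x = poly q x) \<Longrightarrow> p = q" for p q :: "complex poly"
  using poly_eqI_infinite[of "{}"] by auto

definition pure :: "complex poly \<Rightarrow> complex \<Rightarrow> complex \<Rightarrow> bool" where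
  "pure p e x \<longleftrightarrow> (\<exists>c. p = smult c ([:-e, 1:] ^ degree p) + [:x:])"

text \<open>For nonconstant \<open>p\<close> this says that \<open>p\<close> is a Chebyshev
  polynomial up to affine changes on both sides; \<open>cheb_form\<close> extracts them.\<close>

definition cheb :: "complex poly \<Rightarrow> complex set \<Rightarrow> bool" where
  "cheb p X \<longleftrightarrow> card X = 2 \<and> card (odd_fib p X) = 2"

lemma fibre_pure:
  fixes p :: "complex poly"
  assumes deg: "degree p > 0" and c: "p = smult c ([:-e, 1:] ^ degree p) + [:x:]"
  shows "{z. poly p z = x} = {e}"
proof -
  have "c \<noteq> 0"
  proof
    assume "c = 0"
    hence "p = [:x:]" using c by simp
    thus False using deg by simp
  qed
  have "poly p z = c * (z - e) ^ degree p + x" for z by (subst c) simp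
  thus ?thesis using \<open>c \<noteq> 0\<close> deg by auto
qed

lemma pure_iff:
  assumes "degree p > 0"
  shows "pure p e x \<longleftrightarrow> {z. poly p z = x} = {e}"
proof
  assume "pure p e x"
  thus "{z. poly p z = x} = {e}" using fibre_pure[OF assms] unfolding pure_def by blast
next
  assume f: "{z. poly p z = x} = {e}"
  define q where "q = p - [:x:]"
  have m: "set_mset (fib p x) = {e}" using set_fib[OF assms, of x] f by simp
  hence "fib p x = replicate_mset (degree p) e" by (metis set_mset_subset_singletonD size_fib subset_refl)
  hence "(\<Prod>z\<in>#fib p x. [:-z, 1:]) = [:-e, 1:] ^ degree p"
    by simp
  hence "q = smult (lead_coeff q) ([:-e, 1:] ^ degree p)"
    using complex_poly_decompose_multiset[of q] by (simp add: fib_def q_def)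
  hence "p = smult (lead_coeff q) ([:-e, 1:] ^ degree p) + [:x:]" by (simp add: q_def algebra_simps)
  thus "pure p e x" unfolding pure_def by blast
qed

lemma ramif_single_fibre:
  assumes "degree p > 0" "{z. poly p z = x} = {e}"
  shows "ramif p e = degree p"
  using sum_ramif_fibre[OF assms(1), of x] by (simp add: assms(2))

lemma ramif_le_degree: "degree p > 0 \<Longrightarrow> ramif p z \<le> degree p"
  using order_degree[OF minus_const_nonzero[of p "poly p z"]] by (simp add: ramif_def)

text \<open>\<open>n\<close> stays fixed, while \<open>N\<close> is either \<open>m\<close>, when
  properties are passed down the tower, or a high power of \<open>m\<close>, when they are found at
  its top.\<close>

locale coprime_square =
  fixes A p B q :: "complex poly" and n N :: nat
  assumes comp: "pcompose A p = pcompose B q"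
    and deg: "degree p = n" "degree B = n" "degree q = N" "degree A = N"
    and n: "n > 0" and N: "N > 0" and cop: "coprime n N"
begin

lemma degs: "degree p > 0" "degree B > 0" "degree q > 0" "degree A > 0"
  using deg n N by auto

lemma fib_relation: "image_mset (poly q) (fib p x) = fib B (poly A x)"
proof (rule image_fib_eq_fib[OF comp])
  show "finite {z0. \<exists>z. poly p z = poly p z0 \<and> poly q z = poly q z0 \<and> z \<noteq> z0}"
    by (rule coprime_generic_injective[OF degs(1,3,4) comp]) (use deg cop in simp)
qed (use deg n in auto)

lemma poly_comp: "poly A (poly p z) = poly B (poly q z)"
  using arg_cong[OF comp, of "\<lambda>p. poly p z"] by (simp add: poly_pcompose)

lemma ramif_comp: "ramif A (poly p z) * ramif p z = ramif B (poly q z) * ramif q z"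
  using ramif_pcompose[OF degs(4,1), of z] ramif_pcompose[OF degs(2,3), of z] comp by simp

lemma lift_point:
  assumes "poly B y = poly A x"
  obtains z where "poly p z = x" "poly q z = y"
proof -
  have "y \<in># fib B (poly A x)" using assms by (simp add: set_fib[OF degs(2)])
  hence "y \<in># image_mset (poly q) (fib p x)" by (simp add: fib_relation)
  thus ?thesis using that set_fib[OF degs(1)] by auto
qed

text \<open>Where \<open>B\<close> is unramified, \<open>poly q z\<close> occurs only once in the
  fibre of \<open>B\<close>; by \<open>fib_relation\<close> only one point of the fibre of
  \<open>p\<close> can map to it.\<close>

lemma unique_lift_point:
  assumes "ramif B (poly q z) = 1" "poly p z = poly p z'" "poly q z = poly q z'"
  shows "z = z'"
proof (rule ccontr)
  assume "z \<noteq> z'"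
  let ?x = "poly p z" and ?y = "poly q z"
  have "mset_set {z, z'} \<subseteq># mset_set (set_mset (fib p ?x))"
    by (rule subset_imp_msubset_mset_set) (use assms set_fib[OF degs(1)] finite_fibre[OF degs(1)] in auto)
  also have "\<dots> \<subseteq># fib p ?x" by (rule mset_set_set_mset_msubset)
  finally have "image_mset (poly q) (mset_set {z, z'}) \<subseteq># image_mset (poly q) (fib p ?x)"
    by (rule image_mset_subseteq_mono)
  hence "count (image_mset (poly q) (mset_set {z, z'})) ?y \<le> count (fib B (poly A ?x)) ?y"
    unfolding fib_relation by (rule mset_subset_eq_count)
  moreover have "count (image_mset (poly q) (mset_set {z, z'})) ?y = 2"
    using \<open>z \<noteq> z'\<close> assms(3) by simp
  moreover have "count (fib B (poly A ?x)) ?y = 1"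
    by (simp add: count_fib[OF degs(2)] poly_comp assms(1))
  ultimately show False by simp
qed

text \<open>Each \<open>x\<close> over the value lifts to a point \<open>z\<close> with
  \<open>poly q z = y\<close>. If \<open>p\<close> is unramified there, \<open>ramif A x\<close> is
  a multiple of \<open>ramif B y\<close>. The exceptions are critical values of \<open>p\<close>,
  and the indices of \<open>A\<close> over the value add up to \<open>N\<close>.\<close>

lemma card_fibre_A_le:
  assumes "k \<le> ramif B y"
  shows "k * card {x. poly A x = poly B y} \<le> N + k * (n - 1)"
proof -
  let ?S = "{x. poly A x = poly B y}"
  define Ex where "Ex = ?S \<inter> poly p ` {z. poly (pderiv p) z = 0}"
  have fin: "finite ?S" by (rule finite_fibre[OF degs(4)])
  have finp: "finite {z. poly (pderiv p) z = 0}" by (rule poly_roots_finite[OF pderiv_nonzero[OF degs(1)]])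
  have "card Ex \<le> card (poly p ` {z. poly (pderiv p) z = 0})"
    unfolding Ex_def by (rule card_mono) (use finp in auto)
  also have "\<dots> \<le> card {z. poly (pderiv p) z = 0}" by (rule card_image_le[OF finp])
  also have "\<dots> \<le> degree (pderiv p)" by (rule card_poly_roots_bound[OF pderiv_nonzero[OF degs(1)]])
  also have "\<dots> = n - 1" by (simp add: degree_pderiv deg)
  finally have Ex: "card Ex \<le> n - 1" .
  have "k \<le> ramif A x" if x: "x \<in> ?S - Ex" for x
  proof -
    obtain z where z: "poly p z = x" "poly q z = y" using lift_point[of y x] x by auto
    hence "poly (pderiv p) z \<noteq> 0" using x unfolding Ex_def by blast
    hence "ramif p z = 1" using ramif_eq_1_iff[OF degs(1)] by blast
    hence "ramif A x = ramif B y * ramif q z" using ramif_comp[of z] z by simp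
    moreover have "ramif q z > 0" by (rule ramif_pos[OF degs(3)])
    ultimately have "ramif B y \<le> ramif A x" by simp
    thus ?thesis using assms by simp
  qed
  hence "k * card (?S - Ex) \<le> (\<Sum>x\<in>?S - Ex. ramif A x)"
    by (metis (no_types, lifting) sum_bounded_below mult.commute of_nat_id)
  also have "\<dots> \<le> (\<Sum>x\<in>?S. ramif A x)" by (rule sum_mono2[OF fin]) auto
  also have "\<dots> = N" using sum_ramif_fibre[OF degs(4), of "poly B y"] deg by simp
  finally have "k * card (?S - Ex) \<le> N" .
  moreover have "card ?S = card Ex + card (?S - Ex)"
  proof -
    have "?S \<inter> Ex = Ex" unfolding Ex_def by blast
    thus ?thesis using card_Int_Diff[OF fin, of Ex] by (simp only: )
  qed
  moreover have "k * card Ex \<le> k * (n - 1)" using Ex by simp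
  ultimately show ?thesis by (simp add: algebra_simps)
qed

text \<open>Riemann-Hurwitz for \<open>A\<close> requires \<open>N + 1\<close> points over two
  values; the two upper bounds are combined after multiplying by \<open>k1 * k2\<close>, which
  avoids fractions.\<close>

lemma card_vimage_two_le:
  assumes "poly B y1 \<noteq> poly B y2" "k1 \<le> ramif B y1" "k2 \<le> ramif B y2"
  shows "k1 * k2 * (N + 1) \<le> k2 * (N + k1 * (n - 1)) + k1 * (N + k2 * (n - 1))"
proof -
  let ?a = "card {x. poly A x = poly B y1}" and ?b = "card {x. poly A x = poly B y2}"
  have "{z. poly A z \<in> {poly B y1, poly B y2}} = {x. poly A x = poly B y1} \<union> {x. poly A x = poly B y2}"
    by auto
  hence "card {z. poly A z \<in> {poly B y1, poly B y2}} \<le> ?a + ?b"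
    by (metis card_Un_le)
  hence "N + 1 \<le> ?a + ?b"
    using card_vimage_lower(1)[OF degs(4), of "{poly B y1, poly B y2}"] assms(1) deg N by simp
  hence "k1 * k2 * (N + 1) \<le> k1 * k2 * (?a + ?b)" by (rule mult_le_mono2)
  also have "\<dots> = k2 * (k1 * ?a) + k1 * (k2 * ?b)" by (simp add: algebra_simps)
  also have "\<dots> \<le> k2 * (N + k1 * (n - 1)) + k1 * (N + k2 * (n - 1))"
    by (intro add_mono mult_le_mono2 card_fibre_A_le assms)
  finally show ?thesis .
qed

text \<open>Over a critical value of \<open>B\<close>, all but \<open>n - 1\<close> points of the fibre of \<open>A\<close> have at least the
  ramification index of a given point of the fibre of \<open>B\<close>; for large \<open>N\<close>, Riemann-Hurwitz for \<open>A\<close>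
  therefore bounds the sum of \<open>1 - 1 / e\<close> over the critical values by \<open>1\<close>.\<close>

lemma pure_or_cheb:
  assumes "n \<ge> 2" "N \<ge> 12 * n"
  shows "(\<exists>e x. pure B e x) \<or> (\<exists>X. cheb B X)"
proof -
  define R where "R = {y. poly (pderiv B) y = 0}"
  define C where "C = poly B ` R"
  have finR: "finite R" unfolding R_def by (rule poly_roots_finite[OF pderiv_nonzero[OF degs(2)]])
  hence finC: "finite C" by (simp add: C_def)
  have crit: "poly (pderiv B) z = 0 \<Longrightarrow> poly B z \<in> C" for z by (auto simp: C_def R_def)
  have critmul: "\<exists>y. poly B y = t \<and> 2 \<le> ramif B y" if t: "t \<in> C" for t
  proof -
    obtain y where y: "poly B y = t" "poly (pderiv B) y = 0" using t by (auto simp: C_def R_def)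
    hence "ramif B y \<noteq> 1" "ramif B y > 0" using ramif_eq_1_iff[OF degs(2), of y] ramif_pos[OF degs(2), of y] by auto
    thus ?thesis using y by (intro exI[of _ y]) auto
  qed
  have "degree (pderiv B) > 0" using assms(1) by (simp add: degree_pderiv deg)
  hence "R \<noteq> {}" using poly_surj[of "pderiv B" 0] by (auto simp: R_def)
  hence "card C \<noteq> 0" using finC by (simp add: C_def)
  have vim: "card C * n = card {z. poly B z \<in> C} + (n - 1)"
    using card_vimage_lower(2)[OF degs(2) finC] crit deg by simp
  consider "card C = 1" | "card C = 2" | "card C \<ge> 3" using \<open>card C \<noteq> 0\<close> by linarith
  thus ?thesis
  proof cases
    case 1
    then obtain t where t: "C = {t}" by (auto simp: card_1_singleton_iff)
    hence "card {z. poly B z = t} = 1" using vim n by simp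
    then obtain e where "{z. poly B z = t} = {e}" by (auto simp: card_1_singleton_iff)
    thus ?thesis using pure_iff[OF degs(2)] by blast
  next
    case 2
    then obtain t1 t2 where t: "C = {t1, t2}" "t1 \<noteq> t2" by (auto simp: card_2_iff)
    let ?S = "{z. poly B z \<in> C}"
    have finS: "finite ?S" by (rule finite_vimage_poly[OF degs(2) finC])
    have le2: "ramif B y \<le> 2" if y: "y \<in> ?S" for y
    proof (rule ccontr)
      assume "\<not> ramif B y \<le> 2"
      hence 3: "3 \<le> ramif B y" by simp
      obtain t' where t': "t' \<in> C" "t' \<noteq> poly B y" using t by auto
      then obtain y' where y': "poly B y' = t'" "2 \<le> ramif B y'" using critmul by blast
      \<comment> \<open>With indices 3 and 2 the inequality becomes
        \<open>N + 6 \<le> 12 * (n - 1)\<close>; this is the origin of the bound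
        \<open>12 * n\<close>.\<close>
      show False
        using card_vimage_two_le[of y y' 3 2] t' y' 3 assms by simp
    qed
    have m12: "ramif B y + (if odd (ramif B y) then 1 else 0) = 2" if y: "y \<in> ?S" for y
    proof -
      have "ramif B y = 1 \<or> ramif B y = 2" using le2[OF y] ramif_pos[OF degs(2), of y] by linarith
      thus ?thesis by auto
    qed
    have "(\<Sum>z\<in>?S. ramif B z) + card (odd_fib B C) = (\<Sum>z\<in>?S. ramif B z + (if odd (ramif B z) then 1 else 0))"
      by (simp add: sum.distrib sum.If_cases[OF finS] odd_fib_def Collect_conj_eq Int_commute)
    also have "\<dots> = 2 * card ?S" using m12 by simp
    finally have "2 * n + card (odd_fib B C) = 2 * card ?S"
      using sum_ramif_vimage[OF degs(2) finC] 2 deg by simp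
    hence "card (odd_fib B C) = 2" using vim 2 n by simp
    thus ?thesis using 2 by (auto simp: cheb_def)
  next
    case 3
    \<comment> \<open>Three critical values, each with an index of at least 2, would give
      \<open>N + 2 \<le> 6 * (n - 1)\<close>.\<close>
    then obtain T where T: "T \<subseteq> C" "card T = 3" by (meson obtain_subset_with_card_n)
    have finT: "finite T" using T finC finite_subset by blast
    have "2 * card {z. poly A z \<in> T} = 2 * (\<Sum>t\<in>T. card {z. poly A z = t})"
      using sum_vimage[OF degs(4) finT, of "\<lambda>_. 1::nat"] by simp
    also have "\<dots> = (\<Sum>t\<in>T. 2 * card {z. poly A z = t})" by (rule sum_distrib_left)
    also have "\<dots> \<le> (\<Sum>t\<in>T. N + 2 * (n - 1))"
    proof (rule sum_mono)
      fix t assume "t \<in> T"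
      then obtain y where "poly B y = t" "2 \<le> ramif B y" using critmul T by blast
      thus "2 * card {z. poly A z = t} \<le> N + 2 * (n - 1)" using card_fibre_A_le[of 2 y] by simp
    qed
    also have "\<dots> = 3 * (N + 2 * (n - 1))" using T by simp
    finally show ?thesis
      using card_vimage_lower(1)[OF degs(4) finT] T deg assms N by simp
  qed
qed

text \<open>\<open>B\<close> has index \<open>n\<close> at \<open>y1\<close>, so \<open>n\<close>
  divides \<open>ramif A x * ramif p z\<close> at all points over \<open>t\<close>. As
  \<open>ramif A x \<le> N < n\<close>, the map \<open>p\<close> is ramified at each of them; by
  Riemann-Hurwitz for \<open>p\<close> this can happen over one \<open>x\<close> only. There
  \<open>ramif A x = N\<close> is coprime to \<open>n\<close>, so \<open>p\<close> takes the whole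
  index \<open>n\<close>.\<close>

lemma pure_descends:
  assumes "pure B y1 t" "N < n"
  shows "\<exists>x1 e. pure A x1 t \<and> pure p e x1 \<and> pure q e y1"
proof -
  have fB: "{y. poly B y = t} = {y1}" using assms(1) pure_iff[OF degs(2)] by simp
  have mB: "ramif B y1 = n" using ramif_single_fibre[OF degs(2) fB] deg by simp
  have qz: "poly q z = y1" if "poly A (poly p z) = t" for z
    using that fB unfolding poly_comp by blast
  have rel: "n dvd ramif A x * ramif p z" if "poly p z = x" "poly A x = t" for x z
    using ramif_comp[of z] qz[of z] that mB by simp
  have m2: "2 \<le> ramif p z" if "poly p z = x" "poly A x = t" for x z
  proof (rule ccontr)
    assume "\<not> 2 \<le> ramif p z"
    hence "ramif p z = 1" using ramif_pos[OF degs(1), of z] by simp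
    hence "n dvd ramif A x" using rel[OF that] by simp
    hence "n \<le> ramif A x" using ramif_pos[OF degs(4), of x] by (simp add: dvd_imp_le)
    thus False using ramif_le_degree[OF degs(4), of x] deg assms(2) by simp
  qed
  obtain x1 where x1: "poly A x1 = t" using poly_surj[OF degs(4)] by blast
  have "x = x1" if x: "poly A x = t" for x
  proof (rule ccontr)
    assume "x \<noteq> x1"
    let ?S = "{z. poly p z \<in> {x, x1}}"
    have "2 * card ?S \<le> (\<Sum>z\<in>?S. ramif p z)"
      by (rule order_trans[OF _ sum_mono[of ?S "\<lambda>_. 2"]]) (use m2 x x1 in auto)
    also have "\<dots> = 2 * n" using sum_ramif_vimage[OF degs(1), of "{x, x1}"] \<open>x \<noteq> x1\<close> deg by simp
    finally show False
      using card_vimage_lower(1)[OF degs(1), of "{x, x1}"] \<open>x \<noteq> x1\<close> deg n by simp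
  qed
  hence fA: "{x. poly A x = t} = {x1}" using x1 by blast
  have mA: "ramif A x1 = N" using ramif_single_fibre[OF degs(4) fA] deg by simp
  obtain e where e: "poly p e = x1" using poly_surj[OF degs(1)] by blast
  have "n dvd ramif p e" using rel[OF e x1] cop by (simp add: mA coprime_dvd_mult_right_iff)
  hence "n \<le> ramif p e" using ramif_pos[OF degs(1), of e] by (simp add: dvd_imp_le)
  have fp: "{z. poly p z = x1} = {e}"
  proof -
    have "z = e" if z: "poly p z = x1" for z
    proof (rule ccontr)
      assume "z \<noteq> e"
      have "(\<Sum>z\<in>{z, e}. ramif p z) \<le> (\<Sum>z | poly p z = x1. ramif p z)"
        by (rule sum_mono2[OF finite_fibre[OF degs(1)]]) (use z e in auto)
      hence "ramif p z + ramif p e \<le> n"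
        using sum_ramif_fibre[OF degs(1), of x1] \<open>z \<noteq> e\<close> deg by simp
      thus False using \<open>n \<le> ramif p e\<close> ramif_pos[OF degs(1), of z] by linarith
    qed
    thus ?thesis using e by blast
  qed
  have "{z. poly q z = y1} = {e}"
  proof -
    have "poly q z = y1 \<longleftrightarrow> poly p z = x1" for z
    proof -
      have "poly q z = y1 \<longleftrightarrow> poly B (poly q z) = t" using fB by blast
      also have "\<dots> \<longleftrightarrow> poly A (poly p z) = t" by (simp only: poly_comp)
      also have "\<dots> \<longleftrightarrow> poly p z = x1" using fA by blast
      finally show ?thesis .
    qed
    thus ?thesis using fp by simp
  qed
  thus ?thesis using fA fp pure_iff degs by blast
qed

text \<open>Let \<open>k = card X\<close>. The odd points \<open>Z\<close> of the composite satisfy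
  \<open>k * n \<le> card Z + 2 * (n - 1)\<close>. Since \<open>B\<close> has index 1 at its odd
  points over \<open>X0\<close>, the points of \<open>Z\<close> over one \<open>x\<close> embed into
  the odd points of \<open>B\<close> over \<open>poly A x\<close>; parity then gives
  \<open>card Z \<le> 2 * (k - 1)\<close>. Together \<open>(k - 2) * n \<le> 2 * (k - 2)\<close>, so
  \<open>k = 2\<close> as \<open>n \<ge> 3\<close>.\<close>

lemma cheb_descends:
  assumes "cheb B X0" "n \<ge> 3"
  shows "cheb A X0 \<and> cheb p (odd_fib A X0) \<and> cheb q (odd_fib B X0) \<and>
     odd_fib p (odd_fib A X0) = odd_fib q (odd_fib B X0)"
proof -
  obtain t1 t2 where t: "X0 = {t1, t2}" "t1 \<noteq> t2" using assms(1) by (auto simp: cheb_def card_2_iff)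
  define Y where "Y = odd_fib B X0"
  define X where "X = odd_fib A X0"
  define Z where "Z = odd_fib p X"
  have cY: "card Y = 2" using assms(1) by (simp add: cheb_def Y_def)
  have finX0: "finite X0" "card X0 = 2" using t by auto
  have finX: "finite X" and finY: "finite Y"
    using finite_odd_fib degs finX0 by (auto simp: X_def Y_def)
  have finZ: "finite Z" using finite_odd_fib degs finX by (auto simp: Z_def)
  have Zq: "Z = odd_fib q Y"
    unfolding Z_def X_def Y_def odd_fib_pcompose[OF degs(4,1), symmetric]
      odd_fib_pcompose[OF degs(2,3), symmetric] comp ..
  have k2: "2 \<le> card X"
    using card_odd_fib_lower[OF degs(4) finX0(1)] finX0(2) deg N by (simp add: X_def)
  have low: "card X * n \<le> card Z + 2 * (n - 1)"
    using card_odd_fib_lower[OF degs(1) finX] deg by (simp add: Z_def)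
  define c where "c = (\<lambda>t. card (odd_fib B {t}))"
  define d where "d = (\<lambda>t. card (odd_fib A {t}))"
  have split: "card (odd_fib h X0) = card (odd_fib h {t1}) + card (odd_fib h {t2})"
    if "degree h > 0" for h
  proof -
    have "odd_fib h X0 = odd_fib h {t1} \<union> odd_fib h {t2}" "odd_fib h {t1} \<inter> odd_fib h {t2} = {}"
      using t by (auto simp: odd_fib_def)
    thus ?thesis using finite_odd_fib[OF that] by (simp add: card_Un_disjoint)
  qed
  have c2: "c t1 + c t2 = 2" using split[OF degs(2)] cY by (simp add: c_def Y_def)
  have dX: "card X = d t1 + d t2" using split[OF degs(4)] by (simp add: d_def X_def)
  have cpar: "even (c t) \<longleftrightarrow> even n" for t
    using card_odd_fib_parity[OF degs(2), of "{t}"] deg by (simp add: c_def)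
  have dpar: "even (d t) \<longleftrightarrow> even N" for t
    using card_odd_fib_parity[OF degs(4), of "{t}"] deg by (simp add: d_def)
  have fibZ: "card {z \<in> Z. poly p z = x} \<le> c (poly A x)" if "x \<in> X" for x
    unfolding c_def
  proof (rule card_inj_on_le[of "poly q"])
    have qY: "poly q z \<in> Y" if "z \<in> Z" for z using that by (simp add: Zq odd_fib_def)
    have m1: "ramif B (poly q z) = 1" if "z \<in> Z" for z
      using card_odd_fib_2(1)[OF degs(2) t(2), of "poly q z"] cY qY[OF that] t
      by (auto simp: Y_def odd_fib_def)
    show "inj_on (poly q) {z \<in> Z. poly p z = x}"
      by (rule inj_onI) (use unique_lift_point m1 in auto)
    show "poly q ` {z \<in> Z. poly p z = x} \<subseteq> odd_fib B {poly A x}"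
    proof
      fix y assume "y \<in> poly q ` {z \<in> Z. poly p z = x}"
      then obtain z where z: "z \<in> Z" "poly p z = x" "y = poly q z" by auto
      have "odd (ramif B y)" using qY[OF z(1)] z(3) by (simp add: Y_def odd_fib_def)
      moreover have "poly B y = poly A x" using poly_comp[of z] z by simp
      ultimately show "y \<in> odd_fib B {poly A x}" by (simp add: odd_fib_def)
    qed
    show "finite (odd_fib B {poly A x})" by (rule finite_odd_fib[OF degs(2)]) simp
  qed
  have "card Z = (\<Sum>x\<in>X. card {z \<in> Z. poly p z = x})"
  proof -
    have "Z = (\<Union>x\<in>X. {z \<in> Z. poly p z = x})" by (auto simp: Z_def odd_fib_def)
    moreover have "card (\<Union>x\<in>X. {z \<in> Z. poly p z = x}) = (\<Sum>x\<in>X. card {z \<in> Z. poly p z = x})"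
      by (rule card_UN_disjoint) (use finX finZ in auto)
    ultimately show ?thesis by metis
  qed
  also have "\<dots> \<le> (\<Sum>x\<in>X. c (poly A x))" by (rule sum_mono) (rule fibZ)
  also have "\<dots> = d t1 * c t1 + d t2 * c t2"
  proof -
    have "X = odd_fib A {t1} \<union> odd_fib A {t2}" "odd_fib A {t1} \<inter> odd_fib A {t2} = {}"
      using t by (auto simp: odd_fib_def X_def)
    moreover have "finite (odd_fib A {t})" for t by (rule finite_odd_fib[OF degs(4)]) simp
    moreover have "(\<Sum>x\<in>odd_fib A {t}. c (poly A x)) = d t * c t" for t
    proof -
      have "(\<Sum>x\<in>odd_fib A {t}. c (poly A x)) = (\<Sum>x\<in>odd_fib A {t}. c t)"
        by (intro sum.cong) (auto simp: odd_fib_def)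
      thus ?thesis by (simp add: d_def)
    qed
    ultimately show ?thesis by (simp add: sum.union_disjoint)
  qed
  finally have up: "card Z \<le> d t1 * c t1 + d t2 * c t2" .
  \<comment> \<open>If \<open>n\<close> is odd, \<open>B\<close> has one odd point over each of the
    two values. If \<open>n\<close> is even, both lie over one value; but then \<open>N\<close> is
    odd, and \<open>A\<close> has an odd point over the other value, which contributes nothing to
    \<open>Z\<close>.\<close>
  have up2: "card Z \<le> 2 * (card X - 1) \<and> (card X = 2 \<longrightarrow> card Z \<le> 2)"
  proof (cases "even n")
    case False
    hence "odd (c t1)" "odd (c t2)" using cpar by auto
    hence "c t1 = 1 \<and> c t2 = 1" using c2 by presburger
    thus ?thesis using up dX k2 by simp
  next
    case True
    hence "odd N" using cop coprime_common_divisor_nat[of n N 2] by auto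
    hence "odd (d t1)" "odd (d t2)" using dpar by auto
    hence d1: "d t1 \<ge> 1" "d t2 \<ge> 1" using odd_pos[of "d t1"] odd_pos[of "d t2"] by simp_all
    have "c t1 = 0 \<and> c t2 = 2 \<or> c t1 = 2 \<and> c t2 = 0"
      using c2 cpar[of t1] True by presburger
    thus ?thesis using up dX d1 by auto
  qed
  have kX: "card X = 2"
  proof (rule ccontr)
    assume "card X \<noteq> 2"
    then obtain j where j: "card X = j + 3" using k2 by (metis add.commute le_Suc_ex numeral_3_eq_3 Suc_leI le_neq_implies_less numeral_2_eq_2)
    have "(j + 3) * n \<le> 2 * (j + 2) + 2 * (n - 1)" using low up2 j by simp
    hence "(j + 1) * n + 2 * n \<le> 2 * (j + 1) + 2 * n" using assms(2) by (simp add: algebra_simps)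
    hence "(j + 1) * n \<le> (j + 1) * 2" by simp
    hence "n \<le> 2" by (simp only: mult_le_cancel1)
    thus False using assms(2) by simp
  qed
  have "card Z = 2" using low up2 kX n by simp
  thus ?thesis using kX cY Zq finX0 unfolding cheb_def Z_def X_def Y_def by auto
qed

end

section \<open>Towers of compatible polynomials\<close>

lemma pcompose_power: "pcompose (p ^ k) q = pcompose p q ^ k"
  by (induction k) (simp_all add: pcompose_mult pcompose_1)

text \<open>Both degrees divide \<open>degree X\<close>, hence by coprimality so does their product
  \<open>degree S\<close>. Subtracting a multiple of a power of \<open>S\<close> lowers the degree,
  and induction applies.\<close>

lemma common_composite:
  fixes F G S :: "complex poly"
  assumes cop: "coprime (degree F) (degree G)" and deg: "degree F > 0" "degree G > 0"
    and S: "S = pcompose A F" "S = pcompose B G" "degree S = degree F * degree G"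
    and X: "X = pcompose a F" "X = pcompose b G"
  shows "\<exists>U. X = pcompose U S"
  using X
proof (induction "degree X" arbitrary: X a b rule: less_induct)
  case less
  show ?case
  proof (cases "degree X = 0")
    case True
    then obtain c where "X = [:c:]" by (elim degree_eq_zeroE)
    thus ?thesis by (intro exI[of _ "[:c:]"]) simp
  next
    case False
    have "degree F dvd degree X" "degree G dvd degree X"
      using less.prems by (metis degree_pcompose dvd_triv_right)+
    hence "degree F * degree G dvd degree X" using cop by (simp add: divides_mult)
    then obtain k where k: "degree X = degree S * k" using S(3) by (auto elim: dvdE)
    have S0: "lead_coeff S \<noteq> 0" using S(3) deg by (metis degree_0 leading_coeff_0_iff mult_eq_0_iff less_irrefl)
    define c where "c = lead_coeff X / lead_coeff S ^ k"
    define X' where "X' = X - smult c (S ^ k)"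
    have dS: "degree (S ^ k) = degree X" using k S0 by (auto simp: degree_power_eq mult.commute)
    have "degree X' \<le> degree X" unfolding X'_def using dS by (intro degree_diff_le) auto
    moreover have "coeff X' (degree X) = 0"
    proof -
      have "coeff (S ^ k) (degree X) = lead_coeff S ^ k"
        unfolding dS[symmetric] by (simp add: lead_coeff_power)
      thus ?thesis using S0 by (simp add: X'_def c_def)
    qed
    ultimately have "degree X' < degree X"
      using False by (metis degree_0 eq_zero_or_degree_less gr0I)
    moreover have "X' = pcompose (a - smult c (A ^ k)) F" "X' = pcompose (b - smult c (B ^ k)) G"
      unfolding X'_def using less.prems S by (simp_all add: pcompose_diff pcompose_smult pcompose_power)
    ultimately obtain U where U: "X' = pcompose U S" using less.hyps by blast
    have "X = pcompose (U + smult c (monom 1 k)) S"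
    proof (rule poly_ext)
      fix x
      have "poly X x = poly X' x + c * poly S x ^ k" by (simp add: X'_def)
      thus "poly X x = poly (pcompose (U + smult c (monom 1 k)) S) x"
        by (simp add: U poly_pcompose poly_monom)
    qed
    thus ?thesis by blast
  qed
qed

definition compatible ::
    "nat \<Rightarrow> nat \<Rightarrow> complex poly \<Rightarrow> complex poly \<Rightarrow> (nat \<Rightarrow> complex poly) \<Rightarrow> bool" where
  "compatible n m F G T \<longleftrightarrow> degree F = n \<and> degree G = m \<and> (\<forall>k. degree (T k) = k) \<and>
     (\<forall>k. pcompose (T (m * k)) F = pcompose (T (n * k)) G)"

text \<open>By \<open>common_composite\<close> the composites are polynomials in \<open>S\<close>,
  and \<open>F\<close> and \<open>G\<close> can be cancelled on the right. The relation one level up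
  comes from writing \<open>T (n * m * k)\<close> in two ways.\<close>

lemma compatible_step:
  assumes comp: "compatible n m F G T" and cop: "coprime n m" and pos: "n > 0" "m > 0"
  obtains U where "compatible n m (T n) (T m) U"
    "\<And>k. T (m * k) = pcompose (U k) (T m)" "\<And>k. T (n * k) = pcompose (U k) (T n)"
proof -
  have deg: "degree F = n" "degree G = m" "\<And>k. degree (T k) = k"
    and rel: "\<And>k. pcompose (T (m * k)) F = pcompose (T (n * k)) G"
    using comp by (auto simp: compatible_def)
  define S where "S = pcompose (T m) F"
  have S2: "S = pcompose (T n) G" using rel[of 1] by (simp add: S_def)
  have degS: "degree S = n * m" by (simp add: S_def degree_pcompose deg)
  have "\<exists>U. pcompose (T (m * k)) F = pcompose U S" for k
    by (rule common_composite[of F G S "T m" "T n" _ "T (m * k)" "T (n * k)"])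
       (use deg pos cop S_def S2 degS rel in auto)
  then obtain U where U: "\<And>k. pcompose (T (m * k)) F = pcompose (U k) S" by metis
  have Um: "T (m * k) = pcompose (U k) (T m)" for k
    by (rule poly_eq_of_eq_on_vimage[of F])
       (use U[of k] deg pos in \<open>auto simp: S_def pcompose_assoc\<close>)
  have Un: "T (n * k) = pcompose (U k) (T n)" for k
    by (rule poly_eq_of_eq_on_vimage[of G])
       (use U[of k] deg pos rel[of k] in \<open>auto simp: S2 pcompose_assoc\<close>)
  have degU: "degree (U k) = k" for k
  proof -
    have "m * k = degree (U k) * m" using arg_cong[OF Um[of k], of degree] by (simp add: degree_pcompose deg)
    thus ?thesis using pos by simp
  qed
  have "pcompose (U (m * k)) (T n) = pcompose (U (n * k)) (T m)" for k
    using Un[of "m * k"] Um[of "n * k"] by (simp add: mult.left_commute)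
  hence "compatible n m (T n) (T m) U" using deg degU by (auto simp: compatible_def)
  thus ?thesis using that Um Un by blast
qed

lemma compatible_square:
  assumes "compatible n m F G T" "coprime n m" "n > 0" "m > 0"
  shows "coprime_square (T m) F (T n) G n m"
proof
  show "pcompose (T m) F = pcompose (T n) G" using assms(1) unfolding compatible_def by (metis mult_1_right)
qed (use assms in \<open>auto simp: compatible_def\<close>)

text \<open>\<open>R\<close> is the composite of the \<open>b\<close> sides of degree
  \<open>m\<close> passed on the way up. Each level contributes one square, along which
  \<open>pure\<close> and \<open>cheb\<close> are carried down.\<close>

lemma compatible_levels:
  assumes "compatible n m F G T" and cop: "coprime n m" and nm: "m < n" "2 \<le> m"
  shows "\<exists>U F' G' R. compatible n m F' G' U \<and> degree R = m ^ b \<and>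
     (\<forall>k. T (m ^ b * k) = pcompose (U k) R) \<and>
     ((\<exists>e x. pure (U n) e x) \<longrightarrow> (\<exists>e x. pure (T n) e x)) \<and>
     ((\<exists>X. cheb (U n) X) \<longrightarrow> (\<exists>X. cheb (T n) X))"
proof (induction b)
  case 0
  show ?case
    by (rule exI[of _ T], rule exI[of _ F], rule exI[of _ G], rule exI[of _ "[:0, 1:]"])
       (use assms(1) in simp)
next
  case (Suc b)
  then obtain U F' G' R where U: "compatible n m F' G' U" "degree R = m ^ b"
    "\<And>k. T (m ^ b * k) = pcompose (U k) R"
    "(\<exists>e x. pure (U n) e x) \<longrightarrow> (\<exists>e x. pure (T n) e x)"
    "(\<exists>X. cheb (U n) X) \<longrightarrow> (\<exists>X. cheb (T n) X)" by blast
  have pos: "n > 0" "m > 0" using nm by auto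
  obtain V where V: "compatible n m (U n) (U m) V" "\<And>k. U (m * k) = pcompose (V k) (U m)"
    by (rule compatible_step[OF U(1) cop pos], rule that, assumption+)
  interpret coprime_square "V m" "U n" "V n" "U m" n m
    by (rule compatible_square[OF V(1) cop pos])
  have "T (m ^ Suc b * k) = pcompose (V k) (pcompose (U m) R)" for k
    using U(3)[of "m * k"] V(2)[of k] by (simp add: pcompose_assoc mult.assoc mult.left_commute)
  moreover have "degree (pcompose (U m) R) = m ^ Suc b"
    using U(1,2) by (simp add: degree_pcompose compatible_def)
  moreover have "(\<exists>e x. pure (V n) e x) \<longrightarrow> (\<exists>e x. pure (T n) e x)"
    using pure_descends nm U(4) by blast
  moreover have "(\<exists>X. cheb (V n) X) \<longrightarrow> (\<exists>X. cheb (T n) X)"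
    using cheb_descends nm U(5) by fastforce
  ultimately show ?case using V(1) by blast
qed

lemma compatible_pure_or_cheb:
  assumes "compatible n m F G T" and cop: "coprime n m" and nm: "m < n" "2 \<le> m"
  shows "(\<exists>e x. pure (T n) e x) \<or> (\<exists>X. cheb (T n) X)"
proof -
  have pos: "n > 0" "m > 0" using nm by auto
  \<comment> \<open>Chosen so that \<open>m ^ b\<close> reaches the bound required by
    \<open>pure_or_cheb\<close>.\<close>
  define b where "b = 12 * n"
  have "b < 2 ^ b" by (rule less_exp)
  also have "\<dots> \<le> m ^ b" using nm by (intro power_mono) auto
  finally have b: "m ^ b \<ge> 12 * n" by (simp add: b_def)
  obtain U F' G' R where U: "compatible n m F' G' U" "degree R = m ^ b"
    "\<And>k. T (m ^ b * k) = pcompose (U k) R"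
    "(\<exists>e x. pure (U n) e x) \<longrightarrow> (\<exists>e x. pure (T n) e x)"
    "(\<exists>X. cheb (U n) X) \<longrightarrow> (\<exists>X. cheb (T n) X)" using compatible_levels[OF assms] by blast
  obtain V where V: "compatible n m (T n) (T m) V" "\<And>k. T (n * k) = pcompose (V k) (T n)"
    by (rule compatible_step[OF assms(1) cop pos], rule that, assumption+)
  \<comment> \<open>Both composites are \<open>T (n * m ^ b)\<close>: one factorisation splits off
    \<open>T n\<close>, the other splits off \<open>R\<close>.\<close>
  interpret coprime_square "V (m ^ b)" "T n" "U n" R n "m ^ b"
  proof
    show "pcompose (V (m ^ b)) (T n) = pcompose (U n) R"
      using V(2)[of "m ^ b"] U(3)[of n] by (simp add: mult.commute)
  qed (use assms(1) U V pos cop in \<open>auto simp: compatible_def\<close>)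
  show ?thesis using pure_or_cheb U(4,5) nm b by fastforce
qed

section \<open>Recognising Chebyshev polynomials\<close>

text \<open>Differentiate the defining relation and square it: the sines then occur only squared and
  can be expressed through cosines.\<close>

lemma chebyshev_pell:
  "[:-1, 0, 1:] * pderiv (chebyshev_T n) ^ 2 = smult (of_nat n ^ 2) (chebyshev_T n ^ 2 - 1)"
proof (rule poly_ext)
  fix z :: complex
  define C where "C = chebyshev_T n"
  define u where "u = Arccos z"
  have z: "z = cos u" by (simp add: u_def)
  have "((\<lambda>u. poly C (cos u)) has_field_derivative poly (pderiv C) (cos u) * (- sin u)) (at u)"
    by (auto intro!: derivative_eq_intros DERIV_chain2[OF poly_DERIV])
  moreover have "((\<lambda>u. poly C (cos u)) has_field_derivative - sin (of_nat n * u) * of_nat n) (at u)"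
    unfolding C_def poly_chebyshev_T_cos by (auto intro!: derivative_eq_intros)
  ultimately have "poly (pderiv C) (cos u) * (- sin u) = - sin (of_nat n * u) * of_nat n"
    by (rule DERIV_unique)
  hence "(poly (pderiv C) (cos u) * sin u)\<^sup>2 = (sin (of_nat n * u) * of_nat n)\<^sup>2" by simp
  hence *: "(poly (pderiv C) (cos u))\<^sup>2 * (sin u)\<^sup>2 = (sin (of_nat n * u))\<^sup>2 * of_nat n ^ 2"
    by (simp add: power_mult_distrib)
  have "poly ([:-1, 0, 1:] * pderiv C ^ 2) z = ((cos u)\<^sup>2 - 1) * (poly (pderiv C) (cos u))\<^sup>2"
    by (simp add: z power2_eq_square algebra_simps)
  also have "(cos u)\<^sup>2 - 1 = - (sin u)\<^sup>2" by (simp add: sin_squared_eq)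
  also have "- (sin u)\<^sup>2 * (poly (pderiv C) (cos u))\<^sup>2 = - ((poly (pderiv C) (cos u))\<^sup>2 * (sin u)\<^sup>2)"
    by simp
  also have "\<dots> = of_nat n ^ 2 * ((cos (of_nat n * u))\<^sup>2 - 1)"
    unfolding * by (simp add: sin_squared_eq algebra_simps)
  also have "cos (of_nat n * u) = poly C z" by (simp add: C_def z poly_chebyshev_T_cos)
  finally show "poly ([:-1, 0, 1:] * pderiv C ^ 2) z = poly (smult (of_nat n ^ 2) (C ^ 2 - 1)) z"
    by simp
qed

text \<open>Differentiate the Pell equation and cancel \<open>2 * pderiv p\<close>.\<close>

lemma pell_linear:
  fixes p :: "complex poly"
  assumes "[:-1, 0, 1:] * pderiv p ^ 2 = smult c (p ^ 2 - 1)" "degree p > 0"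
  shows "[:-1, 0, 1:] * pderiv (pderiv p) + [:0, 1:] * pderiv p = smult c p"
proof -
  let ?d = "pderiv p"
  have "pderiv ([:-1, 0, 1:] * ?d ^ 2) = pderiv (smult c (p ^ 2 - 1))" using assms(1) by simp
  hence *: "poly (pderiv ([:-1, 0, 1:] * ?d ^ 2)) x = poly (pderiv (smult c (p ^ 2 - 1))) x" for x
    by simp
  have "2 * ?d * ([:-1, 0, 1:] * pderiv ?d + [:0, 1:] * ?d) = 2 * ?d * smult c p"
  proof (rule poly_ext)
    fix x
    have "(x ^ 2 - 1) * (2 * poly ?d x * poly (pderiv ?d) x) + 2 * x * poly ?d x ^ 2
       = c * (2 * poly p x * poly ?d x)"
      using *[of x] unfolding power2_eq_square pderiv_mult pderiv_smult pderiv_diff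
      by (simp add: pderiv_pCons algebra_simps)
    thus "poly (2 * ?d * ([:-1, 0, 1:] * pderiv ?d + [:0, 1:] * ?d)) x = poly (2 * ?d * smult c p) x"
      by (simp add: power2_eq_square algebra_simps)
  qed
  moreover have "2 * ?d \<noteq> 0" using pderiv_nonzero[OF assms(2)] by simp
  ultimately show ?thesis using mult_left_cancel by blast
qed

text \<open>The operator on the left multiplies a leading coefficient in degree \<open>d\<close> by
  \<open>d * (d - 1) + d = d ^ 2\<close>.\<close>

lemma linear_ode_degree:
  fixes p :: "complex poly"
  assumes "[:-1, 0, 1:] * pderiv (pderiv p) + [:0, 1:] * pderiv p = smult (of_nat n ^ 2) p" "p \<noteq> 0"
  shows "degree p = n"
proof -
  define d where "d = degree p"
  have hi: "coeff p i = 0" if "i > d" for i using that by (simp add: d_def coeff_eq_0)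
  have "coeff ([:-1, 0, 1:] * pderiv (pderiv p) + [:0, 1:] * pderiv p) d = of_nat d ^ 2 * coeff p d"
  proof (cases d)
    case 0
    thus ?thesis using hi by (simp add: coeff_pderiv)
  next
    case (Suc d')
    thus ?thesis using hi
      by (cases d') (simp_all add: coeff_pderiv power2_eq_square algebra_simps)
  qed
  also have "coeff ([:-1, 0, 1:] * pderiv (pderiv p) + [:0, 1:] * pderiv p) d = of_nat n ^ 2 * coeff p d"
    by (simp only: assms(1) coeff_smult)
  finally have "(of_nat d :: complex) ^ 2 = of_nat n ^ 2" using assms(2) by (simp add: d_def)
  hence "d ^ 2 = n ^ 2" by (metis of_nat_eq_iff of_nat_power)
  thus ?thesis by (simp add: d_def)
qed

lemma degree_chebyshev_T: "degree (chebyshev_T n) = n"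
proof (cases "degree (chebyshev_T n) = 0")
  case True
  then obtain c where c: "chebyshev_T n = [:c:]" by (elim degree_eq_zeroE)
  have "cos (of_nat n * z) = c" for z
    using poly_chebyshev_T_cos[of n z] by (simp add: c)
  from this[of 0] have c1: "cos (of_nat n * z) = 1" for z :: complex
    using \<open>\<And>z. cos (of_nat n * z) = c\<close> by simp
  have "n = 0"
  proof (rule ccontr)
    assume "n \<noteq> 0"
    hence "of_nat n * (of_real pi / of_nat n) = (of_real pi :: complex)" by simp
    hence "cos (of_real pi :: complex) = 1" using c1[of "of_real pi / of_nat n"] by simp
    moreover have "cos (of_real pi :: complex) = -1" by (simp flip: cos_of_real)
    ultimately show False by simp
  qed
  thus ?thesis using True by simp
next
  case False
  thus ?thesis
    by (intro linear_ode_degree pell_linear chebyshev_pell) auto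
qed

lemma chebyshev_linear:
  assumes "n > 0"
  shows "[:-1, 0, 1:] * pderiv (pderiv (chebyshev_T n)) + [:0, 1:] * pderiv (chebyshev_T n)
    = smult (of_nat n ^ 2) (chebyshev_T n)"
  by (rule pell_linear[OF chebyshev_pell]) (use assms in \<open>simp add: degree_chebyshev_T\<close>)

text \<open>A solution of the linear equation has degree \<open>n\<close> or is 0, so subtracting
  the multiple of \<open>chebyshev_T n\<close> with the same leading coefficient leaves 0. The Pell
  equation at 1 fixes the factor up to sign.\<close>

lemma pell_unique:
  fixes p :: "complex poly"
  assumes "[:-1, 0, 1:] * pderiv p ^ 2 = smult (of_nat n ^ 2) (p ^ 2 - 1)" "degree p > 0" "n > 0"
  shows "p = chebyshev_T n \<or> p = - chebyshev_T n"
proof -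
  define C where "C = chebyshev_T n"
  have C0: "degree C = n" by (simp add: C_def degree_chebyshev_T)
  have lin: "[:-1, 0, 1:] * pderiv (pderiv p) + [:0, 1:] * pderiv p = smult (of_nat n ^ 2) p"
    by (rule pell_linear[OF assms(1,2)])
  have linC: "[:-1, 0, 1:] * pderiv (pderiv C) + [:0, 1:] * pderiv C = smult (of_nat n ^ 2) C"
    unfolding C_def by (rule chebyshev_linear[OF assms(3)])
  have degp: "degree p = n" by (rule linear_ode_degree[OF lin]) (use assms(2) in auto)
  define c where "c = lead_coeff p / lead_coeff C"
  define r where "r = p - smult c C"
  have "coeff C n \<noteq> 0" using C0 assms(3) by (metis degree_0 leading_coeff_0_iff less_irrefl)
  hence "coeff r n = 0" using degp C0 by (simp add: r_def c_def)
  moreover have "[:-1, 0, 1:] * pderiv (pderiv r) + [:0, 1:] * pderiv r = smult (of_nat n ^ 2) r"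
  proof -
    have "[:-1, 0, 1:] * pderiv (pderiv r) + [:0, 1:] * pderiv r =
      ([:-1, 0, 1:] * pderiv (pderiv p) + [:0, 1:] * pderiv p) -
      smult c ([:-1, 0, 1:] * pderiv (pderiv C) + [:0, 1:] * pderiv C)"
      unfolding r_def by (simp only: pderiv_diff pderiv_smult right_diff_distrib mult_smult_right smult_add_right) simp
    thus ?thesis unfolding lin linC by (simp add: r_def smult_diff_right mult.commute)
  qed
  ultimately have "r = 0" using linear_ode_degree[of r n] by (metis leading_coeff_0_iff)
  hence p: "p = smult c C" by (simp add: r_def)
  have "poly C 1 = 1" using poly_chebyshev_T_cos[of n 0] by (simp add: C_def)
  moreover have "poly p 1 ^ 2 = 1"
    using arg_cong[OF assms(1), of "\<lambda>p. poly p 1"] assms(3) by simp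
  ultimately have "c ^ 2 = 1" by (simp add: p)
  hence "c = 1 \<or> c = -1" by (simp add: power2_eq_1_iff)
  thus ?thesis using p by (auto simp: C_def)
qed

text \<open>By \<open>card_odd_fib_2\<close> the left-hand side vanishes to order 1 at
  \<open>e1\<close> and \<open>e2\<close>, and to order 2 at the other points over \<open>x1\<close>
  and \<open>x2\<close>, where \<open>pderiv p\<close> has order 1. The product on the right has at
  least these orders and the same degree.\<close>

lemma cheb_pell_like:
  assumes deg: "degree p > 0" and X: "cheb p {x1, x2}" "odd_fib p {x1, x2} = {e1, e2}"
  shows "\<exists>k. (p - [:x1:]) * (p - [:x2:]) = smult k ([:-e1, 1:] * [:-e2, 1:] * pderiv p ^ 2)"
proof -
  define P where "P = (p - [:x1:]) * (p - [:x2:])"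
  define Q where "Q = [:-e1, 1:] * [:-e2, 1:] * pderiv p ^ 2"
  have x: "x1 \<noteq> x2" "card (odd_fib p {x1, x2}) = 2" using X(1) by (auto simp: cheb_def card_2_iff doubleton_eq_iff)
  hence e: "e1 \<noteq> e2" using X(2) by auto
  have nz: "p - [:x1:] \<noteq> 0" "p - [:x2:] \<noteq> 0" using minus_const_nonzero[OF deg] by auto
  have d: "pderiv p \<noteq> 0" by (rule pderiv_nonzero[OF deg])
  have PQ: "P \<noteq> 0" "Q \<noteq> 0" using nz d by (auto simp: P_def Q_def simp del: mult_pCons_left mult_pCons_right)
  have ordQ: "order z Q = (if z = e1 then 1 else 0) + (if z = e2 then 1 else 0) + 2 * order z (pderiv p)" for z
  proof -
    have "order z [:-a, 1:] = (if z = a then 1 else 0)" for a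
      using order_power_n_n[of a 1] by (auto intro: order_0I)
    moreover have "order z (pderiv p ^ 2) = 2 * order z (pderiv p)"
      using d by (simp add: power2_eq_square order_mult)
    moreover have "order z Q = order z [:-e1, 1:] + order z [:-e2, 1:] + order z (pderiv p ^ 2)"
      using PQ(2) unfolding Q_def by (metis mult_eq_0_iff order_mult)
    ultimately show ?thesis by simp
  qed
  have "order z P \<le> order z Q" for z
  proof (cases "poly p z \<in> {x1, x2}")
    case True
    have "order z P = order z (p - [:x1:]) + order z (p - [:x2:])"
      using PQ(1) unfolding P_def by (rule order_mult)
    also have "\<dots> = ramif p z" using True x(1) by (auto simp: ramif_def order_0I)
    finally have "order z P = ramif p z" .
    moreover have "ramif p z = (if z \<in> {e1, e2} then 1 else 2)"
      using card_odd_fib_2(1)[OF deg x True] X(2) by simp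
    moreover have "ramif p z = Suc (order z (pderiv p))" by (rule ramif_eq_Suc_order_pderiv[OF deg])
    ultimately show ?thesis using e unfolding ordQ by (auto split: if_splits)
  next
    case False
    hence "order z P = 0" by (intro order_0I) (auto simp: P_def)
    thus ?thesis by simp
  qed
  hence "proots P \<subseteq># proots Q" using PQ by (simp add: mset_subset_eq_count subseteq_mset_def)
  moreover have "size (proots P) = size (proots Q)"
  proof -
    have "degree Q = 2 + 2 * degree (pderiv p)"
      unfolding Q_def using d by (simp add: degree_mult_eq degree_power_eq del: mult_pCons_left mult_pCons_right)
    moreover have "degree P = 2 * degree p" unfolding P_def using nz by (simp add: degree_mult_eq)
    ultimately show ?thesis using deg by (simp add: size_proots_complex degree_pderiv)
  qed
  ultimately have "proots P = proots Q"
    by (metis mset_subset_size less_irrefl subset_mset.le_neq_trans)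
  hence "P = smult (lead_coeff P / lead_coeff Q) Q"
    using complex_poly_decompose_multiset[of P] complex_poly_decompose_multiset[of Q] PQ
    by (metis (no_types, lifting) leading_coeff_0_iff nonzero_eq_divide_eq smult_smult)
  thus ?thesis unfolding P_def Q_def by blast
qed

text \<open>Affine coordinates in which \<open>e1, e2\<close> and \<open>x1, x2\<close> become 1 and
  -1 turn \<open>cheb_pell_like\<close> into the Pell equation, whose constant follows from the
  leading coefficients. The sign left by \<open>pell_unique\<close> is absorbed into
  \<open>a\<close>.\<close>

lemma cheb_form:
  assumes deg: "degree p = n" "n > 0"
    and X: "cheb p {x1, x2}" "odd_fib p {x1, x2} = {e1, e2}"
  shows "\<exists>a. degree a = 1 \<and>
     pcompose p [:(e1 + e2) / 2, (e1 - e2) / 2:] = pcompose a (chebyshev_T n)"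
proof -
  have x: "x1 \<noteq> x2" "card (odd_fib p {x1, x2}) = 2" using X(1) by (auto simp: cheb_def card_2_iff doubleton_eq_iff)
  hence e: "e1 \<noteq> e2" using X(2) by auto
  obtain k where k: "(p - [:x1:]) * (p - [:x2:]) = smult k ([:-e1, 1:] * [:-e2, 1:] * pderiv p ^ 2)"
    using cheb_pell_like[OF _ X] deg by auto
  define h where "h = (e1 - e2) / 2"
  define g where "g = (x1 - x2) / 2"
  define L where "L = [:(e1 + e2) / 2, h:]"
  define M where "M = [:(x1 + x2) / 2, g:]"
  define P where "P = smult (1 / g) (pcompose p L - [:(x1 + x2) / 2:])"
  have h: "h \<noteq> 0" and g: "g \<noteq> 0" using e x by (auto simp: h_def g_def)
  have dL: "degree L = 1" using h by (simp add: L_def)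
  have dP: "degree P = n" using g dL deg by (simp add: P_def degree_pcompose)
  have MP: "pcompose p L = pcompose M P" using g
    by (intro poly_ext) (simp add: M_def P_def poly_pcompose field_simps)
  have P': "pderiv P = smult (h / g) (pcompose (pderiv p) L)"
    by (simp add: P_def pderiv_smult pderiv_diff pderiv_pCons pderiv_pcompose L_def)
  define \<kappa> where "\<kappa> = k"
  have pell: "P ^ 2 - 1 = smult \<kappa> ([:-1, 0, 1:] * pderiv P ^ 2)"
  proof (rule poly_ext)
    fix w
    let ?z = "poly L w" let ?d = "poly (pderiv p) ?z"
    have 1: "(poly p ?z - x1) * (poly p ?z - x2) = k * ((?z - e1) * (?z - e2) * ?d ^ 2)"
      using arg_cong[OF k, of "\<lambda>p. poly p ?z"] by (simp add: algebra_simps)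
    have 2: "(?z - e1) * (?z - e2) = h ^ 2 * (w ^ 2 - 1)"
      by (simp add: L_def h_def field_simps power2_eq_square)
    have 3: "(poly p ?z - x1) * (poly p ?z - x2) = g ^ 2 * (poly P w ^ 2 - 1)"
    proof -
      have "poly p ?z = (x1 + x2) / 2 + g * poly P w"
        using arg_cong[OF MP, of "\<lambda>p. poly p w"] by (simp add: M_def poly_pcompose)
      hence pd: "poly p ?z - x1 = g * (poly P w - 1)" "poly p ?z - x2 = g * (poly P w + 1)"
      proof -
        have x1: "x1 = x2 + 2 * g" by (simp add: g_def)
        have "(x1 + x2) / 2 = x2 + g" by (simp add: x1)
        hence "poly p ?z = x2 + g + g * poly P w" using \<open>poly p ?z = _\<close> by simp
        thus "poly p ?z - x1 = g * (poly P w - 1)" "poly p ?z - x2 = g * (poly P w + 1)"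
          by (simp_all add: x1 algebra_simps)
      qed
      show ?thesis unfolding pd by (simp add: power2_eq_square algebra_simps)
    qed
    have "g ^ 2 * (poly P w ^ 2 - 1) = k * (h ^ 2 * (w ^ 2 - 1) * ?d ^ 2)"
      by (simp only: 1 2 3[symmetric])
    hence "poly P w ^ 2 - 1 = k * ((w ^ 2 - 1) * (h / g * ?d) ^ 2)"
      using g by (simp add: field_simps power_mult_distrib)
    moreover have "poly [:-1, 0, 1:] w = w ^ 2 - 1" by (simp add: power2_eq_square)
    ultimately show "poly (P ^ 2 - 1) w = poly (smult \<kappa> ([:-1, 0, 1:] * pderiv P ^ 2)) w"
      unfolding poly_diff poly_power poly_1 poly_smult poly_mult P' poly_pcompose \<kappa>_def by simp
  qed
  have \<kappa>: "\<kappa> * of_nat n ^ 2 = 1"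
  proof -
    have P0: "P \<noteq> 0" "lead_coeff P \<noteq> 0" using dP deg by auto
    have 1: "degree (pderiv P) = n - 1" "lead_coeff (pderiv P) = of_nat n * lead_coeff P"
      using dP deg(2) by (simp_all add: degree_pderiv coeff_pderiv)
    have "degree (P ^ 2 - 1) = 2 * n"
      using degree_minus_const[of "P ^ 2" 1] P0 dP by (simp add: degree_power_eq one_pCons)
    hence "lead_coeff (P ^ 2 - 1) = lead_coeff (P ^ 2)"
      using P0 dP deg(2) by (simp add: degree_power_eq coeff_pCons one_pCons split: nat.splits)
    hence "lead_coeff P ^ 2 = \<kappa> * (of_nat n * lead_coeff P) ^ 2"
      unfolding pell lead_coeff_smult lead_coeff_mult lead_coeff_power 1(2) by simp
    thus ?thesis using P0 by (simp add: power_mult_distrib)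
  qed
  have "[:-1, 0, 1:] * pderiv P ^ 2 = smult (of_nat n ^ 2) (P ^ 2 - 1)"
    unfolding pell smult_smult using \<kappa> by (simp add: mult.commute)
  hence "P = chebyshev_T n \<or> P = - chebyshev_T n"
    by (rule pell_unique) (use dP deg in auto)
  thus ?thesis
  proof
    assume "P = chebyshev_T n"
    thus ?thesis using MP g by (intro exI[of _ M]) (auto simp: M_def L_def h_def)
  next
    assume P: "P = - chebyshev_T n"
    have "pcompose p L = pcompose [:(x1 + x2) / 2, -g:] (chebyshev_T n)"
      unfolding MP P by (simp add: M_def pcompose_pCons)
    thus ?thesis using g by (intro exI[of _ "[:(x1 + x2) / 2, -g:]"]) (auto simp: L_def h_def)
  qed
qed

section \<open>Alignment of Chebyshev polynomials\<close>

lemma affine_inverse: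
  fixes L :: "complex poly"
  assumes "degree L = 1"
  obtains K where "degree K = 1" "\<And>z. poly K (poly L z) = z" "\<And>z. poly L (poly K z) = z"
proof -
  obtain a b where L: "L = [:a, b:]" "b \<noteq> 0" using assms by (elim degree_eq_1E)
  show ?thesis
  proof (rule that[of "[:- a / b, 1 / b:]"])
    show "poly [:- a / b, 1 / b:] (poly L z) = z" for z
      unfolding L(1) using L(2) by (simp add: add_divide_distrib)
    show "poly L (poly [:- a / b, 1 / b:] z) = z" for z
      unfolding L(1) using L(2) by (simp add: left_diff_distrib right_diff_distrib)
  qed (use L(2) in simp)
qed

lemma chebyshev_T_comm:
  "pcompose (chebyshev_T m) (chebyshev_T n) = pcompose (chebyshev_T n) (chebyshev_T m)"
proof (rule poly_ext)
  fix z :: complex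
  have z: "z = cos (Arccos z)" by simp
  show "poly (pcompose (chebyshev_T m) (chebyshev_T n)) z = poly (pcompose (chebyshev_T n) (chebyshev_T m)) z"
    by (subst (1 2) z) (simp only: poly_pcompose poly_chebyshev_T_cos mult.left_commute)
qed

lemma chebyshev_T_uminus:
  "poly (chebyshev_T n) (- z) = (-1) ^ n * poly (chebyshev_T n) z"
proof -
  define u where "u = Arccos z"
  have z: "z = cos u" by (simp add: u_def)
  have "cos (u + of_real pi) = - cos u"
    by (simp add: cos_add flip: cos_of_real sin_of_real)
  hence "poly (chebyshev_T n) (- z) = cos (of_nat n * (u + of_real pi))"
    using poly_chebyshev_T_cos[of n "u + of_real pi"] by (simp add: z)
  also have "\<dots> = cos (of_nat n * u + of_real (of_nat n * pi))" by (simp add: algebra_simps)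
  also have "\<dots> = (-1) ^ n * cos (of_nat n * u)"
    unfolding cos_add cos_of_real sin_of_real by (simp add: cos_npi)
  finally show ?thesis by (simp add: z poly_chebyshev_T_cos)
qed

text \<open>The two expressions for \<open>y\<close> give two forms of the Chebyshev differential
  equation. Eliminating the term with \<open>z ^ 2\<close> times the second derivative leaves that
  \<open>D\<close> is constant. Its coefficient at \<open>n - 1\<close> forces
  \<open>b0 = 0\<close>, that at \<open>n - 2\<close> forces \<open>b1 ^ 2 = 1\<close>; for
  \<open>n = 2\<close> the latter is the constant term, whence the condition on
  \<open>k0\<close>.\<close>

lemma chebyshev_affine:
  fixes b0 b1 k0 k1 :: complex
  assumes n: "n \<ge> 2" and b1: "b1 \<noteq> 0"
    and eq: "pcompose (chebyshev_T n) [:b0, b1:] = pcompose [:k0, k1:] (chebyshev_T n)"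
  shows "b0 = 0" and "n \<ge> 3 \<or> k0 = 0 \<Longrightarrow> b1 ^ 2 = 1"
proof -
  define C where "C = chebyshev_T n"
  define y where "y = pcompose C [:b0, b1:]"
  have n0: "n > 0" using n by simp
  have dy: "degree y = n" using b1 by (simp add: y_def degree_pcompose C_def degree_chebyshev_T)
  have y': "pderiv y = smult b1 (pcompose (pderiv C) [:b0, b1:])"
    by (simp add: y_def pderiv_pcompose pderiv_pCons)
  have y'': "pderiv (pderiv y) = smult (b1 ^ 2) (pcompose (pderiv (pderiv C)) [:b0, b1:])"
    by (simp add: y' pderiv_smult pderiv_pcompose pderiv_pCons power2_eq_square)
  have yk: "y = smult k1 C + [:k0:]" using eq by (simp add: y_def C_def pcompose_pCons mult.commute)
  have yk': "pderiv y = smult k1 (pderiv C)" "pderiv (pderiv y) = smult k1 (pderiv (pderiv C))"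
    by (simp_all add: yk pderiv_add pderiv_smult pderiv_pCons)
  have ode: "(z ^ 2 - 1) * poly (pderiv (pderiv C)) z + z * poly (pderiv C) z = of_nat n ^ 2 * poly C z" for z
    using arg_cong[OF chebyshev_linear[OF n0], of "\<lambda>p. poly p z"]
    by (simp add: C_def power2_eq_square algebra_simps)
  define D where "D = [:b0 ^ 2 - 1 + b1 ^ 2, 2 * b0 * b1:] * pderiv (pderiv y) + smult (b1 * b0) (pderiv y)"
  have D: "D = [:of_nat n ^ 2 * b1 ^ 2 * k0:]"
  proof (rule poly_ext)
    fix z
    let ?w = "b0 + b1 * z"
    have w: "poly [:b0, b1:] z = ?w" by simp
    have 1: "(?w ^ 2 - 1) * poly (pderiv (pderiv y)) z + b1 * ?w * poly (pderiv y) z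
        = of_nat n ^ 2 * b1 ^ 2 * poly y z"
    proof -
      have "(?w ^ 2 - 1) * poly (pderiv (pderiv y)) z + b1 * ?w * poly (pderiv y) z =
        b1 ^ 2 * ((?w ^ 2 - 1) * poly (pderiv (pderiv C)) ?w + ?w * poly (pderiv C) ?w)"
        unfolding y'' unfolding y' poly_smult poly_pcompose w by (simp add: power2_eq_square algebra_simps)
      thus ?thesis unfolding ode by (simp add: y_def poly_pcompose algebra_simps)
    qed
    have 2: "(z ^ 2 - 1) * poly (pderiv (pderiv y)) z + z * poly (pderiv y) z = of_nat n ^ 2 * (poly y z - k0)"
    proof -
      have "(z ^ 2 - 1) * poly (pderiv (pderiv y)) z + z * poly (pderiv y) z =
        k1 * ((z ^ 2 - 1) * poly (pderiv (pderiv C)) z + z * poly (pderiv C) z)"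
        unfolding yk'(2) unfolding yk'(1) poly_smult by (simp add: algebra_simps)
      thus ?thesis unfolding ode by (simp add: yk algebra_simps)
    qed
    have "poly D z = ((?w ^ 2 - 1) * poly (pderiv (pderiv y)) z + b1 * ?w * poly (pderiv y) z)
       - b1 ^ 2 * ((z ^ 2 - 1) * poly (pderiv (pderiv y)) z + z * poly (pderiv y) z)"
      by (simp add: D_def power2_eq_square algebra_simps)
    thus "poly D z = poly [:of_nat n ^ 2 * b1 ^ 2 * k0:] z"
      unfolding 1 2 by (simp add: algebra_simps)
  qed
  obtain m where m: "n = Suc (Suc m)" using n by (metis add_2_eq_Suc le_Suc_ex)
  have ly: "coeff y n \<noteq> 0" using dy n0 by (metis degree_0 leading_coeff_0_iff less_irrefl)
  have "coeff D (n - 1) = 0" by (simp add: D m)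
  moreover have "coeff D (n - 1) = b0 * b1 * of_nat n * (2 * of_nat n - 1) * coeff y n"
  proof -
    have "coeff y (Suc (Suc (Suc m))) = 0" using dy m by (simp add: coeff_eq_0)
    thus ?thesis by (simp add: D_def m coeff_pderiv algebra_simps)
  qed
  moreover have "(2 * of_nat n - 1 :: complex) \<noteq> 0"
  proof
    assume "(2 * of_nat n - 1 :: complex) = 0"
    hence "of_nat (2 * n) = (of_nat 1 :: complex)" by simp
    hence "2 * n = 1" by (simp only: of_nat_eq_iff)
    thus False by simp
  qed
  ultimately show b0: "b0 = 0" using ly b1 n0 by auto
  show "b1 ^ 2 = 1" if nk: "n \<ge> 3 \<or> k0 = 0"
  proof -
    have "coeff D (n - 2) = 0"
    proof (cases "k0 = 0")
      case False
      then obtain l where "m = Suc l" using nk m by (cases m) auto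
      thus ?thesis by (simp add: D m)
    qed (simp add: D)
    moreover have "coeff D (n - 2) = (b1 ^ 2 - 1) * of_nat n * of_nat (n - 1) * coeff y n"
      by (simp add: D_def m b0 coeff_pderiv algebra_simps)
    ultimately show ?thesis using ly n0 n by auto
  qed
qed

lemma chebyshev_align_aux:
  fixes a b c d :: "complex poly"
  assumes cop: "coprime n m" and pos: "n > 0" "m > 0"
    and aff: "degree a = 1" "degree b = 1" "degree c = 1" "degree d = 1"
    and eq: "pcompose (pcompose c (pcompose (chebyshev_T m) a)) (chebyshev_T n) =
             pcompose (pcompose d (pcompose (chebyshev_T n) b)) (chebyshev_T m)"
  obtains k where "degree k = 1"
    "pcompose c (pcompose (chebyshev_T m) a) = pcompose k (chebyshev_T m)"
    "pcompose d (pcompose (chebyshev_T n) b) = pcompose k (chebyshev_T n)"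
proof -
  let ?C = "chebyshev_T"
  define S where "S = pcompose (?C m) (?C n)"
  have S2: "S = pcompose (?C n) (?C m)" by (simp add: S_def chebyshev_T_comm)
  have "\<exists>U. pcompose (pcompose c (pcompose (?C m) a)) (?C n) = pcompose U S"
    by (rule common_composite[of "?C n" "?C m" S "?C m" "?C n" _
          "pcompose c (pcompose (?C m) a)" "pcompose d (pcompose (?C n) b)"])
       (use cop pos eq S2 in \<open>auto simp: degree_chebyshev_T S_def degree_pcompose\<close>)
  then obtain k where k: "pcompose (pcompose c (pcompose (?C m) a)) (?C n) = pcompose k S" by blast
  have "m * n = degree k * (m * n)"
    using arg_cong[OF k, of degree] aff by (simp add: degree_pcompose degree_chebyshev_T S_def)
  hence dk: "degree k = 1" using pos by simp
  have "pcompose c (pcompose (?C m) a) = pcompose k (?C m)"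
    by (rule poly_eq_of_eq_on_vimage[of "?C n"])
       (use k pos in \<open>auto simp: S_def pcompose_assoc degree_chebyshev_T\<close>)
  moreover have "pcompose d (pcompose (?C n) b) = pcompose k (?C n)"
    by (rule poly_eq_of_eq_on_vimage[of "?C m"])
       (use k pos eq in \<open>auto simp: S2 pcompose_assoc degree_chebyshev_T\<close>)
  ultimately show ?thesis using dk that by blast
qed

lemma affine_eval_inverse:
  fixes c :: "complex poly"
  assumes "degree c = 1" "pcompose c P = pcompose k Q" "degree k = 1"
  obtains h where "degree h = 1" "P = pcompose h Q" "\<And>z. poly c (poly h z) = poly k z"
proof -
  obtain c' where c': "degree c' = 1" "\<And>z. poly c' (poly c z) = z" "\<And>z. poly c (poly c' z) = z"
    using affine_inverse[OF assms(1)] by blast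
  show ?thesis
  proof (rule that[of "pcompose c' k"])
    show "P = pcompose (pcompose c' k) Q"
    proof (rule poly_ext)
      fix z
      have "poly c (poly P z) = poly k (poly Q z)"
        using arg_cong[OF assms(2), of "\<lambda>p. poly p z"] by (simp add: poly_pcompose)
      hence "poly P z = poly c' (poly k (poly Q z))" using c'(2) by metis
      thus "poly P z = poly (pcompose (pcompose c' k) Q) z" by (simp add: poly_pcompose)
    qed
  qed (use c' assms in \<open>auto simp: degree_pcompose poly_pcompose\<close>)
qed

text \<open>For \<open>m = 2\<close>, \<open>T\<^sub>2 \<circ> a\<close> is an affine function of \<open>T\<^sub>2\<close> for every scaling \<open>a\<close>, so that \<open>a\<close> is only
  determined with the help of \<open>c\<close> and \<open>d\<close>.\<close>

lemma chebyshev_align: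
  fixes a b c d :: "complex poly"
  assumes cop: "coprime n m" and nm: "n \<ge> 3" "m \<ge> 2"
    and aff: "degree a = 1" "degree b = 1" "degree c = 1" "degree d = 1"
    and eq: "pcompose (pcompose c (pcompose (chebyshev_T m) a)) (chebyshev_T n) =
             pcompose (pcompose d (pcompose (chebyshev_T n) b)) (chebyshev_T m)"
  shows "poly a 0 = 0" "b = [:0, 1:] \<or> b = [:0, -1:]"
    and "poly c 0 = poly d 0 \<Longrightarrow> a = [:0, 1:] \<or> a = [:0, -1:]"
proof -
  let ?C = "chebyshev_T"
  obtain k where k: "degree k = 1" "pcompose c (pcompose (?C m) a) = pcompose k (?C m)"
    "pcompose d (pcompose (?C n) b) = pcompose k (?C n)"
    by (rule chebyshev_align_aux[OF cop _ _ aff eq]) (use nm that in auto)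
  obtain h1 where h1: "degree h1 = 1" "pcompose (?C m) a = pcompose h1 (?C m)"
      "\<And>z. poly c (poly h1 z) = poly k z"
    by (rule affine_eval_inverse[OF aff(3) k(2) k(1)], rule that, assumption+)
  obtain h2 where h2: "degree h2 = 1" "pcompose (?C n) b = pcompose h2 (?C n)"
      "\<And>z. poly d (poly h2 z) = poly k z"
    by (rule affine_eval_inverse[OF aff(4) k(3) k(1)], rule that, assumption+)
  obtain a0 a1 where a: "a = [:a0, a1:]" "a1 \<noteq> 0" using aff(1) by (elim degree_eq_1E)
  obtain b0 b1 where b: "b = [:b0, b1:]" "b1 \<noteq> 0" using aff(2) by (elim degree_eq_1E)
  obtain u0 u1 where u: "h1 = [:u0, u1:]" using h1(1) by (elim degree_eq_1E)
  obtain v0 v1 where v: "h2 = [:v0, v1:]" using h2(1) by (elim degree_eq_1E)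
  note A = chebyshev_affine[OF nm(2) a(2) h1(2)[unfolded a(1) u]]
  have n2: "n \<ge> 2" using nm by simp
  note B = chebyshev_affine[OF n2 b(2) h2(2)[unfolded b(1) v]]
  show "poly a 0 = 0" using A(1) a by simp
  have "b1 ^ 2 = 1" using B(2) nm by simp
  hence b1: "b1 = 1 \<or> b1 = -1" by (simp add: power2_eq_1_iff)
  thus b_id: "b = [:0, 1:] \<or> b = [:0, -1:]" using b B(1) by auto
  assume cd: "poly c 0 = poly d 0"
  \<comment> \<open>\<open>b\<close> is z or -z, so \<open>h2\<close> acts as a sign on the values
    of the Chebyshev polynomial; a zero of it gives \<open>v0 = 0\<close>. Then
    \<open>poly k 0\<close> is the common value of \<open>c\<close> and \<open>d\<close> at 0, so
    \<open>u0 = 0\<close>, which \<open>chebyshev_affine\<close> needs for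
    \<open>m = 2\<close>.\<close>
  have "v0 = 0"
  proof -
    have ev: "poly h2 (poly (?C n) z) = (if b1 = 1 then 1 else (-1) ^ n) * poly (?C n) z" for z
    proof -
      have "poly h2 (poly (?C n) z) = poly (?C n) (b1 * z)"
        using arg_cong[OF h2(2), of "\<lambda>p. poly p z"] b B(1) by (simp add: poly_pcompose mult.commute)
      thus ?thesis using b1 by (auto simp: chebyshev_T_uminus)
    qed
    obtain z where "poly (?C n) z = 0" using poly_surj[of "?C n" 0] nm by (auto simp: degree_chebyshev_T)
    with ev[of z] show ?thesis by (simp add: v)
  qed
  hence "poly k 0 = poly d 0" using h2(3)[of 0] v by simp
  hence "poly c (poly h1 0) = poly c 0" using h1(3)[of 0] cd by simp
  moreover obtain c0 c1 where "c = [:c0, c1:]" "c1 \<noteq> 0" using aff(3) by (elim degree_eq_1E)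
  ultimately have "u0 = 0" by (simp add: u)
  hence "a1 ^ 2 = 1" using A(2) by simp
  hence "a1 = 1 \<or> a1 = -1" by (simp add: power2_eq_1_iff)
  thus "a = [:0, 1:] \<or> a = [:0, -1:]" using a A(1) by auto
qed

text \<open>\<open>p\<close> and \<open>q\<close> have the same odd points, so a single source
  coordinate \<open>L\<close> normalises both.\<close>

lemma cheb_square_form:
  fixes p q :: "complex poly"
  assumes "degree p = n" "degree q = m" "n > 0" "m > 0"
    and "cheb p X" "cheb q Y" "odd_fib p X = odd_fib q Y"
  obtains a b L where "degree a = 1" "degree b = 1" "degree L = 1"
    "pcompose p L = pcompose a (chebyshev_T n)" "pcompose q L = pcompose b (chebyshev_T m)"
proof -
  obtain x1 x2 where X: "X = {x1, x2}" using assms(5) by (auto simp: cheb_def card_2_iff)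
  obtain y1 y2 where Y: "Y = {y1, y2}" using assms(6) by (auto simp: cheb_def card_2_iff)
  obtain e1 e2 where e: "odd_fib p X = {e1, e2}" "e1 \<noteq> e2" using assms(5) by (auto simp: cheb_def card_2_iff)
  define L where "L = [:(e1 + e2) / 2, (e1 - e2) / 2:]"
  have dL: "degree L = 1" using e(2) by (simp add: L_def)
  obtain a where a: "degree a = 1" "pcompose p L = pcompose a (chebyshev_T n)"
    using cheb_form[OF assms(1,3), of x1 x2 e1 e2] assms(5) e X unfolding L_def by blast
  obtain b where b: "degree b = 1" "pcompose q L = pcompose b (chebyshev_T m)"
    using cheb_form[OF assms(2,4), of y1 y2 e1 e2] assms(6,7) e Y unfolding L_def by metis
  show ?thesis by (rule that[OF a(1) b(1) dL a(2) b(2)])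
qed

lemma compatible_classification:
  assumes comp: "compatible n m F G T" and cop: "coprime n m" and nm: "m < n" "2 \<le> m"
  shows "(\<exists>e x. pure F e x \<and> pure G e x) \<or>
    (\<exists>K Q s s'. degree K = 1 \<and> degree Q = 1 \<and> s \<in> {1, -1} \<and> s' \<in> {1, -1} \<and>
       pcompose K F = smult s (pcompose (chebyshev_T n) Q) \<and>
       pcompose K G = smult s' (pcompose (chebyshev_T m) Q))"
proof -
  let ?C = "chebyshev_T"
  have pos: "n > 0" "m > 0" and n3: "n \<ge> 3" using nm by auto
  obtain U where U: "compatible n m (T n) (T m) U"
    by (rule compatible_step[OF comp cop pos])
  obtain V where V: "compatible n m (U n) (U m) V"
    by (rule compatible_step[OF U cop pos])
  interpret s0: coprime_square "T m" F "T n" G n m by (rule compatible_square[OF comp cop pos])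
  interpret s1: coprime_square "U m" "T n" "U n" "T m" n m by (rule compatible_square[OF U cop pos])
  interpret s2: coprime_square "V m" "U n" "V n" "U m" n m by (rule compatible_square[OF V cop pos])
  from compatible_pure_or_cheb[OF V cop nm] show ?thesis
  proof
    assume "\<exists>e x. pure (V n) e x"
    then obtain e t where "pure (V n) e t" by blast
    then obtain e1 x1 where "pure (U n) e1 x1" using s2.pure_descends nm by blast
    then obtain x2 e2 where 1: "pure (T n) e2 x2" "pure (T m) e2 e1" using s1.pure_descends nm by blast
    then obtain x3 e3 where 2: "pure (T m) x3 x2" "pure F e3 x3" "pure G e3 e2"
      using s0.pure_descends nm by blast
    \<comment> \<open>These are the values of \<open>F\<close> and \<open>G\<close> at their centre.
      \<open>T m\<close> is totally ramified at both, which Riemann-Hurwitz forbids for distinct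
      points, as \<open>m \<ge> 2\<close>.\<close>
    have "x3 = e2"
    proof (rule ccontr)
      assume ne: "x3 \<noteq> e2"
      have f: "{z. poly (T m) z = e1} = {e2}" "{z. poly (T m) z = x2} = {x3}"
        using 1 2 pure_iff[OF s0.degs(4)] by auto
      hence "ramif (T m) e2 = m" "ramif (T m) x3 = m"
        using ramif_single_fibre[OF s0.degs(4)] s0.deg by metis+
      moreover have "e1 \<noteq> x2" using f ne by auto
      moreover have "{z. poly (T m) z \<in> {e1, x2}} = {e2, x3}" using f by auto
      ultimately show False
        using card_vimage_lower(1)[OF s0.degs(4), of "{e1, x2}"] ne s0.deg nm by simp
    qed
    thus ?thesis using 2 by blast
  next
    assume "\<exists>X. cheb (V n) X"
    then obtain X2 where X2: "cheb (V n) X2" by blast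
    note c2 = s2.cheb_descends[OF X2 n3]
    define X1 where "X1 = odd_fib (V m) X2"
    have X1: "cheb (U n) X1" using c2 by (simp add: X1_def)
    note c1 = s1.cheb_descends[OF X1 n3]
    define X0 where "X0 = odd_fib (U m) X1"
    have X0: "cheb (T n) X0" using c1 by (simp add: X0_def)
    note c0 = s0.cheb_descends[OF X0 n3]
    obtain a2 b2 L2 where L2: "degree a2 = 1" "degree b2 = 1" "degree L2 = 1"
      "pcompose (U n) L2 = pcompose a2 (?C n)" "pcompose (U m) L2 = pcompose b2 (?C m)"
      by (rule cheb_square_form[OF s2.deg(1,3) pos]) (use c2 in auto)
    obtain a1 b1 L1 where L1: "degree a1 = 1" "degree b1 = 1" "degree L1 = 1"
      "pcompose (T n) L1 = pcompose a1 (?C n)" "pcompose (T m) L1 = pcompose b1 (?C m)"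
      by (rule cheb_square_form[OF s1.deg(1,3) pos]) (use c1 in auto)
    obtain a0 b0 L0 where L0: "degree a0 = 1" "degree b0 = 1" "degree L0 = 1"
      "pcompose F L0 = pcompose a0 (?C n)" "pcompose G L0 = pcompose b0 (?C m)"
      by (rule cheb_square_form[OF s0.deg(1,3) pos]) (use c0 in auto)
    obtain K2 where K2: "degree K2 = 1" "\<And>z. poly K2 (poly L2 z) = z" "\<And>z. poly L2 (poly K2 z) = z"
      using affine_inverse[OF L2(3)] by blast
    obtain K1 where K1: "degree K1 = 1" "\<And>z. poly K1 (poly L1 z) = z" "\<And>z. poly L1 (poly K1 z) = z"
      using affine_inverse[OF L1(3)] by blast
    obtain K0 where K0: "degree K0 = 1" "\<And>z. poly K0 (poly L0 z) = z" "\<And>z. poly L0 (poly K0 z) = z"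
      using affine_inverse[OF L0(3)] by blast
    \<comment> \<open>The relation \<open>A \<circ> p = B \<circ> q\<close> in normal forms:
      \<open>K\<close> undoes \<open>L'\<close>, so \<open>K \<circ> a\<close> and
      \<open>K \<circ> b\<close> are the coordinate changes between two successive levels.\<close>
    have rel: "pcompose (pcompose b' (pcompose (?C m) (pcompose K a))) (?C n) =
               pcompose (pcompose a' (pcompose (?C n) (pcompose K b))) (?C m)"
      if "pcompose A p = pcompose B q" "pcompose p L = pcompose a (?C n)" "pcompose q L = pcompose b (?C m)"
        "pcompose B L' = pcompose a' (?C n)" "pcompose A L' = pcompose b' (?C m)"
        "\<And>z. poly L' (poly K z) = z" for A p B q L a b L' a' b' K
    proof (rule poly_ext)
      fix z
      have 1: "poly A w = poly b' (poly (?C m) (poly K w))" "poly B w = poly a' (poly (?C n) (poly K w))" for w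
        using arg_cong[OF that(4), of "\<lambda>p. poly p (poly K w)"] arg_cong[OF that(5), of "\<lambda>p. poly p (poly K w)"]
          that(6)[of w] by (simp_all add: poly_pcompose)
      have 2: "poly p (poly L z) = poly a (poly (?C n) z)" "poly q (poly L z) = poly b (poly (?C m) z)"
        using arg_cong[OF that(2), of "\<lambda>p. poly p z"] arg_cong[OF that(3), of "\<lambda>p. poly p z"]
        by (simp_all add: poly_pcompose)
      have "poly A (poly p (poly L z)) = poly B (poly q (poly L z))"
        using arg_cong[OF that(1), of "\<lambda>p. poly p (poly L z)"] by (simp add: poly_pcompose)
      thus "poly (pcompose (pcompose b' (pcompose (?C m) (pcompose K a))) (?C n)) z =
            poly (pcompose (pcompose a' (pcompose (?C n) (pcompose K b))) (?C m)) z"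
        unfolding 1 2 by (simp add: poly_pcompose)
    qed
    note rel1 = rel[OF s1.comp L1(4,5) L2(4,5) K2(3)]
    note rel0 = rel[OF s0.comp L0(4,5) L1(4,5) K1(3)]
    have d: "degree (pcompose K2 a1) = 1" "degree (pcompose K2 b1) = 1"
       "degree (pcompose K1 a0) = 1" "degree (pcompose K1 b0) = 1"
      using K2 K1 L0 L1 by (simp_all add: degree_pcompose)
    note al1 = chebyshev_align[OF cop n3 nm(2) d(1,2) L2(2,1) rel1]
    note al0 = chebyshev_align[OF cop n3 nm(2) d(3,4) L1(2,1) rel0]
    \<comment> \<open>At the upper level \<open>K2 \<circ> a1\<close> and
      \<open>K2 \<circ> b1\<close> both fix 0. So \<open>a1\<close> and \<open>b1\<close> agree at
      0, the extra condition for aligning the lower level.\<close>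
    have "poly K2 (poly a1 0) = poly K2 (poly b1 0)" using al1(1,2) by (auto simp: poly_pcompose[symmetric])
    hence "poly b1 0 = poly a1 0" using K2(3) by metis
    hence a: "pcompose K1 a0 = [:0, 1:] \<or> pcompose K1 a0 = [:0, -1:]" by (rule al0(3))
    have fin: "\<exists>s\<in>{1, -1}. pcompose K1 H = smult s (pcompose (?C l) K0)"
      if H: "pcompose H L0 = pcompose h (?C l)" "pcompose K1 h = [:0, 1:] \<or> pcompose K1 h = [:0, -1:]" for H h l
    proof -
      obtain s where s: "s \<in> {1, -1}" "pcompose K1 h = [:0, s:]" using H(2) by auto
      have "pcompose K1 H = smult s (pcompose (?C l) K0)"
      proof (rule poly_ext)
        fix z
        have "poly H z = poly h (poly (?C l) (poly K0 z))"
          using arg_cong[OF H(1), of "\<lambda>p. poly p (poly K0 z)"] K0(3) by (simp add: poly_pcompose)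
        hence "poly (pcompose K1 H) z = poly (pcompose K1 h) (poly (?C l) (poly K0 z))"
          by (simp add: poly_pcompose)
        thus "poly (pcompose K1 H) z = poly (smult s (pcompose (?C l) K0)) z"
          unfolding s(2) by (simp add: poly_pcompose)
      qed
      thus ?thesis using s(1) by blast
    qed
    obtain s where "s \<in> {1, -1}" "pcompose K1 F = smult s (pcompose (?C n) K0)" using fin[OF L0(4) a] by blast
    moreover obtain s' where "s' \<in> {1, -1}" "pcompose K1 G = smult s' (pcompose (?C m) K0)"
      using fin[OF L0(5) al0(2)] by blast
    ultimately show ?thesis using K1(1) K0(1) by blast
  qed
qed

section \<open>The compact set\<close>

text \<open>The periods of \<open>S\<close> form a closed group \<open>\<Gamma>\<close> such that \<open>n \<sigma> \<in> \<Gamma>\<close> implies \<open>m \<sigma> \<in> \<Gamma>\<close>; as \<open>n\<close> and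
  \<open>m\<close> are coprime, \<open>\<tau> \<in> \<Gamma>\<close> implies \<open>\<tau> / n \<in> \<Gamma>\<close>.\<close>

lemma invariant_under_translations:
  fixes S :: "complex set" and \<alpha> \<beta> :: complex
  assumes cl: "closed S" and per: "\<And>u. u + of_real (2 * pi) \<in> S \<longleftrightarrow> u \<in> S"
    and rel: "\<And>u. of_nat n * u + \<beta> \<in> S \<longleftrightarrow> of_nat m * u + \<alpha> \<in> S"
    and cop: "coprime n m" and n: "n \<ge> 2" and m: "m > 0"
    and u: "u \<in> S"
  shows "u + of_real t \<in> S"
proof -
  define \<Gamma> where "\<Gamma> = {\<tau>::real. \<forall>u. u + of_real \<tau> \<in> S \<longleftrightarrow> u \<in> S}"
  have add: "\<sigma> + \<tau> \<in> \<Gamma>" if "\<sigma> \<in> \<Gamma>" "\<tau> \<in> \<Gamma>" for \<sigma> \<tau>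
    using that unfolding \<Gamma>_def by (simp add: add.assoc[symmetric])
  have neg: "- \<sigma> \<in> \<Gamma>" if "\<sigma> \<in> \<Gamma>" for \<sigma>
  proof -
    have "u + of_real (- \<sigma>) \<in> S \<longleftrightarrow> u \<in> S" for u
    proof -
      have "(u + of_real (- \<sigma>)) + of_real \<sigma> \<in> S \<longleftrightarrow> u + of_real (- \<sigma>) \<in> S"
        using that unfolding \<Gamma>_def by blast
      thus ?thesis by simp
    qed
    thus ?thesis by (simp add: \<Gamma>_def)
  qed
  have nat: "of_nat k * \<sigma> \<in> \<Gamma>" if "\<sigma> \<in> \<Gamma>" for k \<sigma>
  proof (induction k)
    case 0
    show ?case by (simp add: \<Gamma>_def)
  next
    case (Suc k)
    thus ?case using add[OF that Suc] by (simp add: algebra_simps)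
  qed
  have int: "of_int k * \<sigma> \<in> \<Gamma>" if "\<sigma> \<in> \<Gamma>" for k \<sigma>
    using nat[OF that, of "nat k"] neg[OF nat[OF that, of "nat (- k)"]] by (cases "k \<ge> 0") auto
  have mult: "of_nat m * \<sigma> \<in> \<Gamma>" if "of_nat n * \<sigma> \<in> \<Gamma>" for \<sigma> :: real
  proof -
    have "v + of_real (of_nat m * \<sigma>) \<in> S \<longleftrightarrow> v \<in> S" for v
    proof -
      define w where "w = (v - \<alpha>) / of_nat m"
      have v: "v = of_nat m * w + \<alpha>" using m by (simp add: w_def)
      have "v + of_real (of_nat m * \<sigma>) \<in> S \<longleftrightarrow> of_nat m * (w + of_real \<sigma>) + \<alpha> \<in> S"
        by (simp add: v algebra_simps)
      also have "\<dots> \<longleftrightarrow> of_nat n * (w + of_real \<sigma>) + \<beta> \<in> S" by (rule rel[symmetric])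
      also have "\<dots> \<longleftrightarrow> (of_nat n * w + \<beta>) + of_real (of_nat n * \<sigma>) \<in> S"
        by (simp add: algebra_simps)
      also have "\<dots> \<longleftrightarrow> of_nat n * w + \<beta> \<in> S" using that unfolding \<Gamma>_def by blast
      also have "\<dots> \<longleftrightarrow> v \<in> S" by (simp only: rel v)
      finally show ?thesis .
    qed
    thus ?thesis by (simp add: \<Gamma>_def)
  qed
  have "coprime (int n) (int m)" using cop by simp
  then obtain i j :: int where ij: "i * int n + j * int m = 1"
    using bezout_int[of "int n" "int m"] by (auto simp: coprime_iff_gcd_eq_1)
  have div: "\<tau> / of_nat n \<in> \<Gamma>" if "\<tau> \<in> \<Gamma>" for \<tau>
  proof -
    have "of_nat m * (\<tau> / of_nat n) \<in> \<Gamma>" by (rule mult) (use that n in simp)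
    hence "of_int i * \<tau> + of_int j * (of_nat m * (\<tau> / of_nat n)) \<in> \<Gamma>"
      by (intro add int that)
    also have "of_int i * \<tau> + of_int j * (of_nat m * (\<tau> / of_nat n)) =
        of_int (i * int n + j * int m) * (\<tau> / of_nat n)"
      using n by (simp add: field_simps)
    finally show ?thesis by (simp add: ij)
  qed
  have "2 * pi \<in> \<Gamma>" using per by (simp add: \<Gamma>_def)
  hence small: "2 * pi / of_nat n ^ k \<in> \<Gamma>" for k
  proof (induction k)
    case (Suc k)
    thus ?case using div[OF Suc.IH] by (simp add: mult.commute)
  qed simp
  define \<delta> where "\<delta> = (\<lambda>k. 2 * pi / real n ^ k)"
  \<comment> \<open>The periods \<open>\<delta> k\<close> tend to 0, and \<open>s k\<close> is the
    largest multiple of \<open>\<delta> k\<close> not exceeding \<open>t\<close>; closedness of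
    \<open>S\<close> allows passing to the limit.\<close>
  define s where "s = (\<lambda>k. of_int \<lfloor>t / \<delta> k\<rfloor> * \<delta> k)"
  have \<delta>0: "\<delta> k > 0" for k using n by (simp add: \<delta>_def)
  have s\<Gamma>: "s k \<in> \<Gamma>" for k unfolding s_def \<delta>_def by (intro int small)
  have "\<bar>s k - t\<bar> \<le> \<delta> k" for k
  proof -
    define x where "x = t / \<delta> k - of_int \<lfloor>t / \<delta> k\<rfloor>"
    have eq: "t - s k = x * \<delta> k" using \<delta>0[of k] by (simp add: s_def x_def left_diff_distrib)
    have x: "0 \<le> x" "x \<le> 1" unfolding x_def by linarith+
    have "0 \<le> x * \<delta> k" using x \<delta>0[of k] by simp
    moreover have "x * \<delta> k \<le> 1 * \<delta> k" by (rule mult_right_mono) (use x \<delta>0[of k] in auto)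
    ultimately have "0 \<le> t - s k" "t - s k \<le> \<delta> k" unfolding eq by simp_all
    thus ?thesis by simp
  qed
  moreover have "\<delta> \<longlonglongrightarrow> 0"
    unfolding \<delta>_def by (rule LIMSEQ_divide_realpow_zero) (use n in simp)
  ultimately have "(\<lambda>k. s k - t) \<longlonglongrightarrow> 0"
    by (intro Lim_null_comparison[of "\<lambda>k. s k - t" \<delta>] always_eventually allI)
       (simp_all only: real_norm_def)
  hence "s \<longlonglongrightarrow> t" by (simp add: LIM_zero_iff)
  hence lim: "(\<lambda>k. u + of_real (s k)) \<longlonglongrightarrow> u + of_real t" by (intro tendsto_intros)
  have mem: "u + of_real (s k) \<in> S" for k using s\<Gamma>[of k] u by (simp add: \<Gamma>_def)
  show ?thesis by (rule closed_sequentially[OF cl mem lim])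
qed

text \<open>Under \<open>exp (\<i> * u)\<close> powers become multiples, the factor \<open>a\<close>
  becomes a shift by \<open>\<alpha>\<close>, and real translations become rotations. The
  exponential omits 0, which is the only point of its norm.\<close>

lemma union_of_circles_of_power_relation:
  fixes K :: "complex set" and a :: complex
  assumes K: "compact K" and a: "a \<noteq> 0"
    and rel: "\<And>z. z ^ n \<in> K \<longleftrightarrow> a * z ^ m \<in> K"
    and cop: "coprime n m" and n: "n \<ge> 2" and m: "m > 0"
  shows "union_of_circles K"
proof -
  define S where "S = {u. exp (\<i> * u) \<in> K}"
  define \<alpha> where "\<alpha> = - \<i> * Ln a"
  have \<alpha>: "exp (\<i> * \<alpha>) = a" using a by (simp add: \<alpha>_def)
  have "closed S"
  proof -
    have "closed ((\<lambda>u. exp (\<i> * u)) -` K)"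
      by (intro continuous_closed_vimage compact_imp_closed[OF K]) simp
    thus ?thesis by (simp add: S_def vimage_def)
  qed
  have rot: "w' \<in> K" if w: "w \<in> K" "norm w' = norm w" for w w'
  proof (cases "w = 0")
    case True
    thus ?thesis using w by simp
  next
    case False
    hence "w' \<noteq> 0" using w by auto
    define u where "u = - \<i> * Ln w"
    define t where "t = Im (Ln w') - Im (Ln w)"
    have ew: "exp (\<i> * u) = w" using False by (simp add: u_def)
    have "u + of_real t \<in> S"
    proof (rule invariant_under_translations[OF \<open>closed S\<close> _ _ cop n m])
      show "v + of_real (2 * pi) \<in> S \<longleftrightarrow> v \<in> S" for v
      proof -
        have "exp (\<i> * (v + of_real (2 * pi))) = exp (\<i> * v)"
          using exp_2pi_1_int[of 1] by (simp add: distrib_left exp_add exp_plus_2pin[of _ 1] mult_ac)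
        thus ?thesis by (simp add: S_def)
      qed
      show "of_nat n * v + 0 \<in> S \<longleftrightarrow> of_nat m * v + \<alpha> \<in> S" for v
      proof -
        have "exp (\<i> * (of_nat n * v)) = exp (\<i> * v) ^ n"
          by (simp add: exp_of_nat_mult[symmetric] mult_ac)
        moreover have "exp (\<i> * (of_nat m * v + \<alpha>)) = a * exp (\<i> * v) ^ m"
          by (simp add: distrib_left exp_add \<alpha> exp_of_nat_mult[symmetric] mult_ac)
        ultimately show ?thesis using rel by (simp add: S_def)
      qed
      show "u \<in> S" using w ew by (simp add: S_def)
    qed
    moreover have "exp (\<i> * (u + of_real t)) = w'"
    proof -
      have "Re (Ln w') = Re (Ln w)" using w False \<open>w' \<noteq> 0\<close> by (simp add: Re_Ln)
      hence "Ln w' = Ln w + \<i> * of_real t" by (simp add: t_def complex_eq_iff)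
      hence "\<i> * (u + of_real t) = Ln w'" by (simp add: u_def algebra_simps)
      thus ?thesis using \<open>w' \<noteq> 0\<close> by simp
    qed
    ultimately show ?thesis by (simp add: S_def)
  qed
  have "K = (\<Union>r\<in>norm ` K. sphere 0 r)"
  proof
    show "K \<subseteq> (\<Union>r\<in>norm ` K. sphere 0 r)" by auto
    show "(\<Union>r\<in>norm ` K. sphere 0 r) \<subseteq> K"
    proof
      fix z :: complex assume "z \<in> (\<Union>r\<in>norm ` K. sphere 0 r)"
      then obtain w where "w \<in> K" "norm z = norm w" by (auto simp: dist_norm)
      thus "z \<in> K" by (rule rot)
    qed
  qed
  moreover have "norm ` K \<subseteq> {0..}" by auto
  ultimately show ?thesis unfolding union_of_circles_def by blast
qed

text \<open>The signs become shifts by 0 or pi. Translation invariance reduces the lift to a set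
  \<open>I\<close> of imaginary parts, which is stable under multiplication by
  \<open>n / m > 1\<close>. It is bounded, because the cosine is unbounded in the imaginary
  direction and \<open>K\<close> is compact. So \<open>I = {0}\<close>, and \<open>K\<close> is the
  image of the real line.\<close>

lemma segment_of_chebyshev_relation:
  fixes K :: "complex set" and s s' :: complex
  assumes K: "compact K" "K \<noteq> {}" and s: "s \<in> {1, -1}" "s' \<in> {1, -1}"
    and rel: "\<And>z. s * poly (chebyshev_T n) z \<in> K \<longleftrightarrow> s' * poly (chebyshev_T m) z \<in> K"
    and cop: "coprime n m" and nm: "m < n" "m > 0"
  shows "K = closed_segment (-1) 1"
proof -
  define S where "S = {u. cos u \<in> K}"
  have n: "n \<ge> 2" using nm by simp
  have "closed S"
  proof -
    have "closed (cos -` K)"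
      by (intro continuous_closed_vimage compact_imp_closed[OF K(1)]) simp
    thus ?thesis by (simp add: S_def vimage_def)
  qed
  have sgn: "\<exists>\<beta>. \<forall>u. cos (u + of_real \<beta>) = \<sigma> * cos u" if "\<sigma> \<in> {1, -1}" for \<sigma> :: complex
  proof (cases "\<sigma> = 1")
    case True
    thus ?thesis by (intro exI[of _ 0]) simp
  next
    case False
    hence "\<sigma> = -1" using that by simp
    thus ?thesis by (intro exI[of _ pi]) (simp add: cos_add flip: cos_of_real sin_of_real)
  qed
  obtain \<beta> where \<beta>: "\<And>u. cos (u + of_real \<beta>) = s * cos u" using sgn[OF s(1)] by blast
  obtain \<alpha> where \<alpha>: "\<And>u. cos (u + of_real \<alpha>) = s' * cos u" using sgn[OF s(2)] by blast
  have relS: "of_nat n * u + of_real \<beta> \<in> S \<longleftrightarrow> of_nat m * u + of_real \<alpha> \<in> S" for u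
    using rel[of "cos u"] by (simp add: S_def \<alpha> \<beta> poly_chebyshev_T_cos)
  have perS: "u + of_real (2 * pi) \<in> S \<longleftrightarrow> u \<in> S" for u
  proof -
    have "cos (u + of_real (2 * pi)) = cos u"
      unfolding cos_add cos_of_real sin_of_real by simp
    thus ?thesis by (simp add: S_def)
  qed
  have tr: "u + of_real t \<in> S" if "u \<in> S" for u t
    by (rule invariant_under_translations[OF \<open>closed S\<close> perS relS cop n nm(2) that])
  have tr_iff: "u + of_real t \<in> S \<longleftrightarrow> u \<in> S" for u t
    using tr[of u t] tr[of "u + of_real t" "- t"] by auto
  define I where "I = {y. \<i> * of_real y \<in> S}"
  have Im_I: "u \<in> S \<longleftrightarrow> Im u \<in> I" for u
  proof -
    have "u = \<i> * of_real (Im u) + of_real (Re u)" by (simp add: complex_eq_iff)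
    thus ?thesis using tr_iff[of "\<i> * of_real (Im u)" "Re u"] by (simp add: I_def)
  qed
  have scale: "real n / real m * y \<in> I" if "y \<in> I" for y
  proof -
    define w where "w = \<i> * of_real (y / real m)"
    have "of_nat m * w = \<i> * of_real y" using nm by (simp add: w_def)
    hence "of_nat m * w + of_real \<alpha> \<in> S" using that tr_iff by (simp add: I_def)
    hence "of_nat n * w + of_real \<beta> \<in> S" using relS by simp
    hence "of_nat n * w \<in> S" using tr_iff by simp
    moreover have "of_nat n * w = \<i> * of_real (real n / real m * y)" by (simp add: w_def)
    ultimately show ?thesis by (simp add: I_def)
  qed
  obtain B where B: "\<And>z. z \<in> K \<Longrightarrow> norm z \<le> B"
    using compact_imp_bounded[OF K(1)] by (auto simp: bounded_iff)
  have bound: "\<bar>y\<bar> \<le> 2 * B" if "y \<in> I" for y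
  proof -
    have c: "cos (\<i> * of_real y) = of_real ((exp y + exp (- y)) / 2)"
    proof -
      have 1: "\<i> * (\<i> * complex_of_real y) = of_real (- y)" by (simp add: mult.assoc[symmetric])
      have "cos (\<i> * of_real y) = (exp (of_real (- y)) + exp (of_real y)) / 2"
        unfolding cos_exp_eq 1 by simp
      thus ?thesis unfolding exp_of_real by (simp add: add.commute)
    qed
    have "\<bar>y\<bar> \<le> exp y + exp (- y)"
      using exp_ge_add_one_self[of y] exp_ge_add_one_self[of "- y"] exp_gt_zero[of y] exp_gt_zero[of "- y"]
      by linarith
    moreover have "norm (cos (\<i> * of_real y)) \<le> B" using that by (intro B) (simp add: I_def S_def)
    hence "\<bar>(exp y + exp (- y)) / 2\<bar> \<le> B" unfolding c norm_of_real .
    hence "(exp y + exp (- y)) / 2 \<le> B" using abs_ge_self order_trans by blast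
    hence "exp y + exp (- y) \<le> 2 * B" by simp
    ultimately show ?thesis by (rule order_trans)
  qed
  have I0: "y = 0" if y: "y \<in> I" for y
  proof (rule ccontr)
    assume "y \<noteq> 0"
    have "(real n / real m) ^ k * y \<in> I" for k
    proof (induction k)
      case (Suc k)
      show ?case using scale[OF Suc.IH] by (simp add: mult.assoc)
    qed (use y in simp)
    hence le: "(real n / real m) ^ k * \<bar>y\<bar> \<le> 2 * B" for k
      using bound[of "(real n / real m) ^ k * y"] by (simp add: abs_mult)
    have "1 < real n / real m" using nm by simp
    then obtain k where "2 * B / \<bar>y\<bar> < (real n / real m) ^ k" using real_arch_pow by blast
    hence "2 * B < (real n / real m) ^ k * \<bar>y\<bar>" using \<open>y \<noteq> 0\<close> by (simp add: divide_less_eq)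
    thus False using le[of k] by simp
  qed
  have "I \<noteq> {}"
  proof -
    obtain z where "z \<in> K" using K(2) by blast
    hence "Arccos z \<in> S" by (simp add: S_def)
    thus ?thesis using Im_I by blast
  qed
  hence "I = {0}" using I0 by blast
  hence S_real: "u \<in> S \<longleftrightarrow> Im u = 0" for u using Im_I by simp
  have Kr: "z \<in> K \<longleftrightarrow> (\<exists>x\<in>{-1..1}. z = of_real x)" for z
  proof
    assume "z \<in> K"
    hence "Im (Arccos z) = 0" using S_real[of "Arccos z"] by (simp add: S_def)
    hence "Arccos z = of_real (Re (Arccos z))" by (simp add: complex_eq_iff)
    hence "z = of_real (cos (Re (Arccos z)))" by (metis cos_Arccos cos_of_real)
    thus "\<exists>x\<in>{-1..1}. z = of_real x" by (intro bexI[of _ "cos (Re (Arccos z))"]) auto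
  next
    assume "\<exists>x\<in>{-1..1}. z = of_real x"
    then obtain x where x: "-1 \<le> x" "x \<le> 1" "z = of_real x" by auto
    have "complex_of_real (arccos x) \<in> S" using S_real by simp
    hence "of_real (cos (arccos x)) \<in> K" by (simp add: S_def cos_of_real)
    thus "z \<in> K" using x by simp
  qed
  have "closed_segment (-1) 1 = complex_of_real ` closed_segment (-1) 1"
    using closed_segment_of_real[of "-1" 1] by simp
  hence "closed_segment (-1) 1 = complex_of_real ` {-1..1}"
    by (simp add: closed_segment_eq_real_ivl)
  thus ?thesis using Kr by auto
qed

text \<open>Multiplying \<open>T k\<close> by \<open>\<tau> ^ k\<close> removes the leading
  coefficients from the relation if \<open>\<tau> ^ (n - m) = f ^ m / g ^ n\<close>, which is
  solvable as \<open>m < n\<close>.\<close>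

lemma compatible_of_equal_preimages:
  fixes F G :: "complex poly"
  assumes deg: "degree F = n" "degree G = m" "0 < m" "m < n"
    and K: "compact K" "infinite K" and eq: "poly F -` K = poly G -` K"
  obtains T where "compatible n m F G T"
proof -
  obtain T where T: "\<And>k. degree (T k) = k"
    "\<And>a b. a * degree F = b * degree G \<Longrightarrow>
       smult (lead_coeff G ^ b) (pcompose (T a) F) = smult (lead_coeff F ^ a) (pcompose (T b) G)"
    using extremal_relation[OF _ _ K eq] deg by (metis less_trans)
  define f where "f = lead_coeff F"
  define g where "g = lead_coeff G"
  have fg: "f \<noteq> 0" "g \<noteq> 0" using deg by (auto simp: f_def g_def)
  obtain \<tau> where "poly (monom 1 (n - m)) \<tau> = f ^ m / g ^ n"
    using poly_surj[of "monom 1 (n - m)"] deg by (auto simp: degree_monom_eq)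
  hence \<tau>: "\<tau> ^ (n - m) = f ^ m / g ^ n" by (simp add: poly_monom)
  have "\<tau> \<noteq> 0"
  proof
    assume "\<tau> = 0"
    hence "f ^ m / g ^ n = 0" using deg by (simp flip: \<tau> add: zero_power)
    thus False using fg by simp
  qed
  have "\<tau> ^ n = \<tau> ^ m * (f ^ m / g ^ n)"
    unfolding \<tau>[symmetric] power_add[symmetric] using deg by simp
  hence \<tau>': "\<tau> ^ n * g ^ n = \<tau> ^ m * f ^ m" using fg by (simp add: field_simps)
  define U where "U = (\<lambda>k. smult (\<tau> ^ k) (T k))"
  have "pcompose (U (m * k)) F = pcompose (U (n * k)) G" for k
  proof -
    have "smult (g ^ (n * k)) (pcompose (T (m * k)) F) = smult (f ^ (m * k)) (pcompose (T (n * k)) G)"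
      unfolding f_def g_def by (rule T(2)) (simp add: deg)
    hence "smult (\<tau> ^ (m * k)) (smult (g ^ (n * k)) (pcompose (T (m * k)) F)) =
      smult ((\<tau> ^ m * f ^ m) ^ k) (pcompose (T (n * k)) G)"
      by (simp add: power_mult power_mult_distrib)
    also have "\<dots> = smult ((\<tau> ^ n * g ^ n) ^ k) (pcompose (T (n * k)) G)" by (simp only: \<tau>')
    also have "\<dots> = smult (g ^ (n * k)) (pcompose (U (n * k)) G)"
    proof -
      have "(\<tau> ^ n * g ^ n) ^ k = g ^ (n * k) * \<tau> ^ (n * k)"
        by (simp only: power_mult_distrib power_mult[symmetric] mult.commute)
      thus ?thesis by (simp add: U_def pcompose_smult)
    qed
    finally have "smult (g ^ (n * k)) (pcompose (U (m * k)) F) = smult (g ^ (n * k)) (pcompose (U (n * k)) G)"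
      by (simp add: U_def pcompose_smult mult.commute)
    from arg_cong[OF this, of "\<lambda>p. poly p x" for x] show ?thesis
      using fg by (intro poly_ext) simp
  qed
  hence "compatible n m F G U"
    using deg T(1) \<open>\<tau> \<noteq> 0\<close> by (simp add: compatible_def U_def)
  thus ?thesis using that by blast
qed

lemma affine_image:
  fixes A :: "complex poly"
  assumes "degree A = 1"
  shows "poly A z \<in> poly A ` K \<longleftrightarrow> z \<in> K"
proof -
  obtain B where "degree B = 1" "\<And>z. poly B (poly A z) = z" "\<And>z. poly A (poly B z) = z"
    using affine_inverse[OF assms] by blast
  thus ?thesis by (metis image_iff)
qed

lemma compact_poly_image: "compact K \<Longrightarrow> compact (poly A ` K)" for A :: "complex poly"
  by (rule compact_continuous_image) (intro continuous_intros)

theorem mainTheorem12: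
  fixes f g :: "complex poly" and K :: "complex set"
  assumes "degree f > 0" and "degree g > 0"
    and "degree f \<ge> degree g"
    and "compact K" and "infinite K"
    and "poly f -` K = poly g -` K"
  shows "(\<exists>P :: complex poly. f = pcompose P g \<and> poly P -` K = K) \<or>
    (\<exists>A :: complex poly. degree A = 1 \<and>
       (circle_class (pcompose A f) (pcompose A g) (poly A ` K) \<or>
        chebyshev_class (pcompose A f) (pcompose A g) (poly A ` K)))"
proof -
  obtain T0 where T0: "\<And>k. degree (T0 k) = k"
    "\<And>a b. a * degree f = b * degree g \<Longrightarrow>
       smult (lead_coeff g ^ b) (pcompose (T0 a) f) = smult (lead_coeff f ^ a) (pcompose (T0 b) g)"
    using extremal_relation[OF assms(1,2,4,5,6)] by metis
  \<comment> \<open>The extremal relation for \<open>a = degree g\<close> and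
    \<open>b = degree f\<close> provides the common composite that \<open>decompose_coprime\<close>
    asks for.\<close>
  define u where "u = smult (lead_coeff g ^ degree f) (T0 (degree g))"
  define v where "v = smult (lead_coeff f ^ degree g) (T0 (degree f))"
  have "lead_coeff g \<noteq> 0" using assms(2) by auto
  hence "degree u > 0" using assms(2) T0(1) by (simp add: u_def)
  moreover have "pcompose u f = pcompose v g"
    using T0(2)[of "degree g" "degree f"] by (simp add: u_def v_def pcompose_smult mult.commute)
  ultimately obtain w F G where w: "f = pcompose F w" "g = pcompose G w" "degree w > 0"
      and cop: "coprime (degree F) (degree G)"
    using decompose_coprime[OF assms(1,2)] by metis
  define n where "n = degree F"
  define m where "m = degree G"
  have degs: "n > 0" "m > 0" "m \<le> n"
    using assms(1-3) w by (auto simp: n_def m_def degree_pcompose)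
  have FG: "poly F y \<in> K \<longleftrightarrow> poly G y \<in> K" for y
  proof -
    obtain z where z: "poly w z = y" using poly_surj[OF w(3)] by blast
    have "poly f z \<in> K \<longleftrightarrow> poly g z \<in> K" using assms(6) by blast
    thus ?thesis using z by (simp add: w poly_pcompose)
  qed
  show ?thesis
  proof (cases "m = 1")
    case True
    hence "degree G = 1" by (simp add: m_def)
    then obtain H where "degree H = 1"
        and H: "\<And>z. poly H (poly G z) = z" "\<And>z. poly G (poly H z) = z"
      using affine_inverse[of G] by blast
    define P where "P = pcompose F H"
    have "f = pcompose P g" by (rule poly_ext) (simp add: P_def w poly_pcompose H)
    moreover have "poly P -` K = K"
      using FG by (auto simp: P_def poly_pcompose H)
    ultimately show ?thesis by blast
  next
    case False
    hence m2: "m \<ge> 2" using degs by simp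
    have "m \<noteq> n" using cop m2 by (auto simp: n_def m_def)
    hence mn: "m < n" using degs by simp
    have cop': "coprime n m" using cop by (simp add: n_def m_def)
    have "poly F -` K = poly G -` K" using FG by auto
    then obtain T where "compatible n m F G T"
      using compatible_of_equal_preimages[of F n G m K] n_def m_def degs mn assms(4,5) by metis
    from compatible_classification[OF this cop' mn m2]
    consider (pure) e x where "pure F e x" "pure G e x"
      | (cheb) A Q s s' where "degree A = 1" "degree Q = 1" "s \<in> {1, -1}" "s' \<in> {1, -1}"
       "pcompose A F = smult s (pcompose (chebyshev_T n) Q)"
       "pcompose A G = smult s' (pcompose (chebyshev_T m) Q)"
      by blast
    thus ?thesis
    proof cases
      case pure
      then obtain c c' where F: "F = smult c ([:-e, 1:] ^ n) + [:x:]" and G: "G = smult c' ([:-e, 1:] ^ m) + [:x:]"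
        unfolding pure_def n_def m_def by blast
      have c0: "c \<noteq> 0" "c' \<noteq> 0" using F G degs by (auto simp: n_def m_def)
      \<comment> \<open>An \<open>n\<close>-th root of \<open>c\<close> is put into
        \<open>Q\<close>, so that \<open>F\<close> becomes exactly a power and only \<open>G\<close>
        keeps a factor.\<close>
      obtain \<rho> where "poly (monom 1 n) \<rho> = c" using poly_surj[of "monom 1 n" c] degs by (auto simp: degree_monom_eq)
      hence \<rho>: "\<rho> ^ n = c" by (simp add: poly_monom)
      have \<rho>0: "\<rho> \<noteq> 0" using \<rho> c0 degs by auto
      define a where "a = c' / \<rho> ^ m"
      define A where "A = [:-x, 1:]"
      define Q where "Q = smult \<rho> ([:-e, 1:])"
      have Qz: "poly Q z = \<rho> * (z - e)" for z by (simp add: Q_def algebra_simps)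
      have AF: "pcompose A F = Q ^ n"
        by (rule poly_ext) (simp add: A_def Qz F poly_pcompose \<rho>[symmetric] power_mult_distrib)
      have AG: "pcompose A G = smult a (Q ^ m)"
        using \<rho>0 by (intro poly_ext)
          (simp add: A_def Qz G a_def poly_pcompose power_mult_distrib)
      have dA: "degree A = 1" by (simp add: A_def)
      have "union_of_circles (poly A ` K)"
      proof (rule union_of_circles_of_power_relation[OF compact_poly_image[OF assms(4)] _ _ cop' _ degs(2)])
        show "a \<noteq> 0" using c0 \<rho>0 by (simp add: a_def)
        show "2 \<le> n" using mn m2 by simp
        fix z
        obtain y where y: "poly Q y = z" using poly_surj[of Q z] \<rho>0 by (auto simp: Q_def)
        have "z ^ n = poly A (poly F y)" "a * z ^ m = poly A (poly G y)"
          using arg_cong[OF AF, of "\<lambda>p. poly p y"] arg_cong[OF AG, of "\<lambda>p. poly p y"] y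
          by (simp_all add: poly_pcompose)
        thus "z ^ n \<in> poly A ` K \<longleftrightarrow> a * z ^ m \<in> poly A ` K"
          by (simp only: affine_image[OF dA] FG)
      qed
      moreover have "pcompose A f = pcompose Q w ^ n" "pcompose A g = smult a (pcompose Q w ^ m)"
        using AF AG by (simp_all add: w pcompose_assoc pcompose_power pcompose_smult)
      ultimately have "circle_class (pcompose A f) (pcompose A g) (poly A ` K)"
        unfolding circle_class_def by blast
      thus ?thesis using dA by blast
    next
      case cheb
      have "poly A ` K = closed_segment (-1) 1"
      proof (rule segment_of_chebyshev_relation[OF compact_poly_image[OF assms(4)] _ cheb(3,4) _ cop' mn degs(2)])
        show "poly A ` K \<noteq> {}" using assms(5) by auto
        fix z
        obtain y where y: "poly Q y = z" using poly_surj[of Q z] cheb(2) by auto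
        have "s * poly (chebyshev_T n) z = poly A (poly F y)" "s' * poly (chebyshev_T m) z = poly A (poly G y)"
          using arg_cong[OF cheb(5), of "\<lambda>p. poly p y"] arg_cong[OF cheb(6), of "\<lambda>p. poly p y"] y
          by (simp_all add: poly_pcompose)
        thus "s * poly (chebyshev_T n) z \<in> poly A ` K \<longleftrightarrow> s' * poly (chebyshev_T m) z \<in> poly A ` K"
          by (simp only: affine_image[OF cheb(1)] FG)
      qed
      moreover have "pcompose A f = smult s (pcompose (chebyshev_T n) (pcompose Q w))"
         "pcompose A g = smult s' (pcompose (chebyshev_T m) (pcompose Q w))"
        using cheb(5,6) by (simp_all add: w pcompose_assoc pcompose_smult)
      ultimately have "chebyshev_class (pcompose A f) (pcompose A g) (poly A ` K)"
        unfolding chebyshev_class_def using cheb(3,4)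
        by (intro conjI exI[of _ "pcompose Q w"] exI[of _ n] exI[of _ m]) auto
      thus ?thesis using cheb(1) by blast
    qed
  qed
qed

end
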